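(* Let $n\ge1$. For any $n$-exangulated category $(\mathcal C,\mathbb E,\mathfrak s)$ the following are equivalent. (1) $(\mathcal C,\mathbb E,\mathfrak s)$ is $n$-exact, i.e. there exist an $n$-exact structure $\mathcal X$ on $\mathcal C$ (with small extension groups, so that $(\mathcal C,\mathbb G_{\mathcal X},\mathfrak r_{\mathcal X})$ is defined) and an equivalence of $n$-exangulated categories of the form $(\mathrm{Id}_{\mathcal C},\Gamma)\colon(\mathcal C,\mathbb E,\mathfrak s)\to(\mathcal C,\mathbb G_{\mathcal X},\mathfrak r_{\mathcal X})$. (2) Every $\mathfrak s$-inflation is monic and every $\mathfrak s$-deflation is epic.
   Context: **Complexes.** For an additive category $\mathcal D$, $\mathbf C^{n+2}_{\mathcal D}$ is the category of complexes $X_\bullet\colon X_0\xrightarrow{d^X_0}X_1\to\cdots\to X_n\xrightarrow{d^X_n}X_{n+1}$ over $\mathcal D$ concentrated in degrees $0,\dots,n+1$, with chain maps $f_\bullet=(f_0,\dots,f_{n+1})$. For $A,C\in\mathcal D$, $\mathbf C^{n+2}_{(\mathcal D;A,C)}$ is its subcategory of complexes with $X_0=A$, $X_{n+1}=C$ and chain maps with $f_0=\mathrm{id}_A$, $f_{n+1}=\mathrm{id}_C$; two of its morphisms are homotopic if their difference is null-homotopic as a chain map, and $[X_\bullet]_{\mathcal D}$ is the resulting homotopy equivalence class of $X_\bullet$ in $\mathbf C^{n+2}_{(\mathcal D;A,C)}$. For $X\in\mathcal D$ and $0\le i\le n$, $\mathrm{triv}_i(X)_\bullet$ has $X$ in degrees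 $i,i+1$ with differential $\mathrm{id}_X$ between them and $0$ elsewhere. **Extensions.** Let $\mathbb G\colon\mathcal D^{\mathrm{op}}\times\mathcal D\to\mathsf{Ab}$ be biadditive. For $\delta\in\mathbb G(C,A)$, $a\colon A\to B$, $c\colon D\to C$ write $a_*\delta=\mathbb G(C,a)(\delta)$ and $c^*\delta=\mathbb G(c,A)(\delta)$. For $\delta\in\mathbb G(C,A)$, $\rho\in\mathbb G(D,B)$, a morphism $(a,c)\colon\delta\to\rho$ is a pair $a\colon A\to B$, $c\colon C\to D$ with $a_*\delta=c^*\rho$. An $n$-exangle is a pair $\langle X_\bullet,\delta\rangle$ with $X_\bullet\in\mathbf C^{n+2}_{\mathcal D}$, $\delta\in\mathbb G(X_{n+1},X_0)$, $(d^X_0)_*\delta=0$, $(d^X_n)^*\delta=0$, such that for all $X\in\mathcal D$ the sequences $\mathcal D(X,X_0)\to\cdots\to\mathcal D(X,X_{n+1})\to\mathbb G(X,X_0)$ (last map $f\mapsto f^*\delta$) and $\mathcal D(X_{n+1},X)\to\cdots\to\mathcal D(X_0,X)\to\mathbb G(X_{n+1},X)$ (last map $g\mapsto g_*\delta$) are exact. **Exact realisation.** An exact realisation $\mathfrak r$ of $\mathbb G$ assigns to each $\delta\in\mathbb G(C,A)$ a homotopy equivalence class $\mathfrak r(\delta)$ of an object of $\mathbf C^{n+2}_{(\mathcal D;A,C)}$ such that: (R0) if $[X_\bullet]_{\mathcal D}=\mathfrak r(\delta)$, $[Y_\bullet]_{\mathcal D}=\mathfrak r(\rho)$ and $(a,c)\colon\delta\to\rho$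 is a morphism of extensions, there is a chain map $f_\bullet\colon X_\bullet\to Y_\bullet$ (a lift of $(a,c)$) with $f_0=a$, $f_{n+1}=c$; (R1) if $\mathfrak r(\delta)=[X_\bullet]_{\mathcal D}$ then $\langle X_\bullet,\delta\rangle$ is an $n$-exangle; (R2) for all $A,C\in\mathcal D$, $\mathfrak r$ sends $0\in\mathbb G(0,A)$ to $[\mathrm{triv}_0(A)_\bullet]_{\mathcal D}$ and $0\in\mathbb G(C,0)$ to $[\mathrm{triv}_n(C)_\bullet]_{\mathcal D}$. If $\mathfrak r(\delta)=[X_\bullet]_{\mathcal D}$, then $\langle X_\bullet,\delta\rangle$ is called $\mathfrak r$-distinguished, $X_\bullet$ an $\mathfrak r$-conflation, $d^X_0$ an $\mathfrak r$-inflation and $d^X_n$ an $\mathfrak r$-deflation. **$n$-exangulated category.** A triple $(\mathcal D,\mathbb G,\mathfrak r)$ with $\mathcal D$ additive, $\mathbb G$ biadditive and $\mathfrak r$ an exact realisation of $\mathbb G$ such that: (EA1) $\mathfrak r$-inflations are closed under composition; (EA1$^{\mathrm{op}}$) $\mathfrak r$-deflations are closed under composition; (EA2) for $c\colon X_{n+1}\to Y_{n+1}$ and $\mathfrak r$-distinguished $\langle X_\bullet,c^*\rho\rangle$, $\langle Y_\bullet,\rho\rangle$ with $A:=X_0=Y_0$, there is a lift $f_\bullet$ of $(\mathrm{id}_A,c)$ such that $\langle M^f_\bullet,(d^X_0)_*\rho\rangle$ is $\mathfrak r$-distinguished, where $M^f_\bullet$ is the complex $X_1\to X_2\oplus Y_1\to\cdots\to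 X_{n+1}\oplus Y_n\to Y_{n+1}$ with differentials $\begin{bmatrix}-d^X_1\\ f_1\end{bmatrix}$, then $\begin{bmatrix}-d^X_{i}&0\\ f_{i}&d^Y_{i-1}\end{bmatrix}$ for $i=2,\dots,n$, then $\begin{bmatrix}f_{n+1}&d^Y_n\end{bmatrix}$; (EA2$^{\mathrm{op}}$) for $a\colon X_0\to Y_0$ and $\mathfrak r$-distinguished $\langle X_\bullet,\delta\rangle$, $\langle Y_\bullet,a_*\delta\rangle$ with $C:=X_{n+1}=Y_{n+1}$, there is a lift $f_\bullet$ of $(a,\mathrm{id}_C)$ such that $\langle N^f_\bullet,(d^Y_n)^*\delta\rangle$ is $\mathfrak r$-distinguished, where $N^f_\bullet$ is the complex $X_0\to X_1\oplus Y_0\to\cdots\to X_n\oplus Y_{n-1}\to Y_n$ with differentials $\begin{bmatrix}d^X_0\\ f_0\end{bmatrix}$, then $\begin{bmatrix}d^X_i&0\\ f_i&-d^Y_{i-1}\end{bmatrix}$ for $i=1,\dots,n-1$, then $\begin{bmatrix}f_n&-d^Y_{n-1}\end{bmatrix}$. **Functors and equivalences.** An $n$-exangulated functor $(\mathscr F,\Gamma)\colon(\mathcal D,\mathbb G,\mathfrak r)\to(\mathcal D',\mathbb G',\mathfrak r')$ is an additive functor $\mathscr F\colon\mathcal D\to\mathcal D'$ with a natural transformation $\Gamma\colon\mathbb G(-,-)\Rightarrow\mathbb G'(\mathscr F-,\mathscr F-)$ such that $[X_\bullet]_{\mathcal D}=\mathfrak r(\delta)$ implies $[\mathscr F(X_\bullet)]_{\mathcal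 D'}=\mathfrak r'(\Gamma_{(C,A)}(\delta))$ for all $\delta\in\mathbb G(C,A)$. It is an $n$-exangulated equivalence if $\mathscr F$ is an equivalence and $\Gamma$ is a natural isomorphism. **$n$-exact categories (Jasso).** $X_\bullet\in\mathbf C^{n+2}_{\mathcal D}$ is an $n$-exact sequence if for all $X\in\mathcal D$ the sequences $0\to\mathcal D(X,X_0)\to\cdots\to\mathcal D(X,X_{n+1})$ and $0\to\mathcal D(X_{n+1},X)\to\cdots\to\mathcal D(X_0,X)$ are exact. A weak isomorphism of $n$-exact sequences is a chain map $f_\bullet$ such that $f_k$ and $f_{k+1}$ are isomorphisms for some $k\in\{0,\dots,n+1\}$, where $f_{n+2}:=f_0$. Given a chain map $(f_0,\dots,f_n)$ from $X_0\to\cdots\to X_n$ to $Y_0\to\cdots\to Y_n$, its cone is $X_0\to X_1\oplus Y_0\to\cdots\to X_n\oplus Y_{n-1}\to Y_n$ with differentials $\begin{bmatrix}-d^X_0\\ f_0\end{bmatrix}$, $\begin{bmatrix}-d^X_i&0\\ f_i&d^Y_{i-1}\end{bmatrix}$ ($1\le i\le n-1$), $\begin{bmatrix}f_n&d^Y_{n-1}\end{bmatrix}$. It is an $n$-pushout diagram (of $X_0\to\cdots\to X_n$ along $f_0$) if for all $X\in\mathcal D$ applying $\mathcal D(-,X)$ to the cone gives an exact sequence $0\to\mathcal D(Y_n,X)\to\mathcal D(X_n\oplus Y_{n-1},X)\to\cdots\to\mathcal D(X_0,X)$. Dually, it is an $n$-pullback diagram (of $Y_0\to\cdots\to Y_n$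 along $f_n$) if for all $X$ applying $\mathcal D(X,-)$ to the cone gives an exact sequence $0\to\mathcal D(X,X_0)\to\cdots\to\mathcal D(X,Y_n)$. An $n$-exact structure on $\mathcal D$ is a class $\mathcal X$ of $n$-exact sequences closed under weak isomorphisms of $n$-exact sequences (if one of two $n$-exact sequences connected by a weak isomorphism is in $\mathcal X$, so is the other) such that, calling $d^X_0$ (resp. $d^X_n$) for $X_\bullet\in\mathcal X$ an admissible monomorphism (resp. admissible epimorphism): (E0) the zero complex is in $\mathcal X$; (E1) admissible monomorphisms are closed under composition; (E1$^{\mathrm{op}}$) admissible epimorphisms are closed under composition; (E2) for $X_\bullet\in\mathcal X$ and $f\colon X_0\to Y_0$ there is an $n$-pushout diagram of $X_0\to\cdots\to X_n$ along $f$, with target $Y_0\to\cdots\to Y_n$, such that $Y_0\to Y_1$ is an admissible monomorphism; (E2$^{\mathrm{op}}$) for $X_\bullet\in\mathcal X$ and $g\colon Y_{n+1}\to X_{n+1}$ there is an $n$-pullback diagram of $X_1\to\cdots\to X_{n+1}$ along $g$, with source $Y_1\to\cdots\to Y_{n+1}$, such that $Y_n\to Y_{n+1}$ is an admissible epimorphism. The pair $(\mathcal D,\mathcal X)$ is then an $n$-exact category. **From $n$-exact to $n$-exangulated.** Put $\mathbb G_{\mathcal X}(C,A):=\{[X_\bullet]_{\mathcal D}: X_\bullet\in\mathcal X\cap\mathbf C^{n+2}_{(\mathcal D;A,C)}\}$. $(\mathcal D,\mathcal X)$ has small extension groups if $\mathbb G_{\mathcal X}(C,A)$ is a set for all $A,C\in\mathcal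 D$. In that case $\mathbb G_{\mathcal X}$ becomes a biadditive functor $\mathcal D^{\mathrm{op}}\times\mathcal D\to\mathsf{Ab}$ as follows (all well defined). For $a\colon A\to B$, $\mathbb G_{\mathcal X}(C,a)([X_\bullet]_{\mathcal D})=[Y_\bullet]_{\mathcal D}$, where $Y_\bullet\in\mathcal X\cap\mathbf C^{n+2}_{(\mathcal D;B,C)}$ admits a chain map $f_\bullet\colon X_\bullet\to Y_\bullet$ with $f_0=a$, $f_{n+1}=\mathrm{id}_C$ whose part in degrees $0,\dots,n$ is an $n$-pushout diagram. For $c\colon D\to C$, $\mathbb G_{\mathcal X}(c,A)([X_\bullet]_{\mathcal D})=[Y_\bullet]_{\mathcal D}$, where $Y_\bullet\in\mathcal X\cap\mathbf C^{n+2}_{(\mathcal D;A,D)}$ admits a chain map $f_\bullet\colon Y_\bullet\to X_\bullet$ with $f_0=\mathrm{id}_A$, $f_{n+1}=c$ whose part in degrees $1,\dots,n+1$ is an $n$-pullback diagram. Addition is the Baer sum $[X_\bullet]_{\mathcal D}+[Y_\bullet]_{\mathcal D}=\mathbb G_{\mathcal X}(\Delta_C,\nabla_A)([X_\bullet\oplus Y_\bullet]_{\mathcal D})$ with $\Delta_C\colon C\to C\oplus C$ the diagonal and $\nabla_A\colon A\oplus A\to A$ the codiagonal. The realisation is $\mathfrak r_{\mathcal X}(\delta):=[X_\bullet]_{\mathcal D}$ for $\delta=[X_\bullet]_{\mathcal D}\in\mathbb G_{\mathcal X}(C,A)$; then $(\mathcal D,\mathbb G_{\mathcal X},\mathfrak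 r_{\mathcal X})$ is an $n$-exangulated category. *)

theory Defs
  imports "HOL-Algebra.Coset"
begin

section \<open>Additive categories\<close>

text \<open>
  A category has carriers of objects and arrows; an arrow determines its domain and codomain,
  so composition and addition need no object arguments.
\<close>

record ('o, 'm) addcat =
  Obj :: "'o set"
  Arr :: "'m set"
  Dom :: "'m \<Rightarrow> 'o"
  Cod :: "'m \<Rightarrow> 'o"
  idn :: "'o \<Rightarrow> 'm"
  comp :: "'m \<Rightarrow> 'm \<Rightarrow> 'm"  (infixl "\<cdot>\<index>" 75)
  plus_arr :: "'m \<Rightarrow> 'm \<Rightarrow> 'm"  (infixl "\<uplus>\<index>" 65)
  zero_arr :: "'o \<Rightarrow> 'o \<Rightarrow> 'm"

definition Hom :: "('o, 'm) addcat \<Rightarrow> 'o \<Rightarrow> 'o \<Rightarrow> 'm set" where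
  "Hom D A B = {f \<in> Arr D. Dom D f = A \<and> Cod D f = B}"

definition homgrp :: "('o, 'm) addcat \<Rightarrow> 'o \<Rightarrow> 'o \<Rightarrow> 'm monoid" where
  "homgrp D A B = \<lparr>carrier = Hom D A B, monoid.mult = plus_arr D, one = zero_arr D A B\<rparr>"

definition neg_arr :: "('o, 'm) addcat \<Rightarrow> 'm \<Rightarrow> 'm" where
  "neg_arr D f = inv\<^bsub>homgrp D (Dom D f) (Cod D f)\<^esub> f"

locale category =
  fixes D :: "('o, 'm) addcat"
  assumes dom_obj: "f \<in> Arr D \<Longrightarrow> Dom D f \<in> Obj D"
    and cod_obj: "f \<in> Arr D \<Longrightarrow> Cod D f \<in> Obj D"
    and idn_hom: "A \<in> Obj D \<Longrightarrow> idn D A \<in> Hom D A A"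
    and comp_hom: "\<lbrakk>f \<in> Hom D A B; g \<in> Hom D B C\<rbrakk> \<Longrightarrow> g \<cdot>\<^bsub>D\<^esub> f \<in> Hom D A C"
    and comp_assoc: "\<lbrakk>f \<in> Hom D A B; g \<in> Hom D B C; h \<in> Hom D C E\<rbrakk>
      \<Longrightarrow> (h \<cdot>\<^bsub>D\<^esub> g) \<cdot>\<^bsub>D\<^esub> f = h \<cdot>\<^bsub>D\<^esub> (g \<cdot>\<^bsub>D\<^esub> f)"
    and idn_left: "f \<in> Hom D A B \<Longrightarrow> idn D B \<cdot>\<^bsub>D\<^esub> f = f"
    and idn_right: "f \<in> Hom D A B \<Longrightarrow> f \<cdot>\<^bsub>D\<^esub> idn D A = f"

locale preadditive_category = category +
  assumes hom_comm_group: "\<lbrakk>A \<in> Obj D; B \<in> Obj D\<rbrakk> \<Longrightarrow> comm_group (homgrp D A B)"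
    and comp_plus_right: "\<lbrakk>f \<in> Hom D A B; f' \<in> Hom D A B; g \<in> Hom D B C\<rbrakk>
      \<Longrightarrow> g \<cdot>\<^bsub>D\<^esub> (f \<uplus>\<^bsub>D\<^esub> f') = (g \<cdot>\<^bsub>D\<^esub> f) \<uplus>\<^bsub>D\<^esub> (g \<cdot>\<^bsub>D\<^esub> f')"
    and comp_plus_left: "\<lbrakk>f \<in> Hom D A B; g \<in> Hom D B C; g' \<in> Hom D B C\<rbrakk>
      \<Longrightarrow> (g \<uplus>\<^bsub>D\<^esub> g') \<cdot>\<^bsub>D\<^esub> f = (g \<cdot>\<^bsub>D\<^esub> f) \<uplus>\<^bsub>D\<^esub> (g' \<cdot>\<^bsub>D\<^esub> f)"

definition is_zero_obj :: "('o, 'm) addcat \<Rightarrow> 'o \<Rightarrow> bool" where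
  "is_zero_obj D Z \<longleftrightarrow> Z \<in> Obj D \<and>
     (\<forall>A \<in> Obj D. (\<exists>!f. f \<in> Hom D Z A) \<and> (\<exists>!f. f \<in> Hom D A Z))"

definition is_biproduct ::
    "('o, 'm) addcat \<Rightarrow> 'o \<Rightarrow> 'o \<Rightarrow> 'o \<times> 'm \<times> 'm \<times> 'm \<times> 'm \<Rightarrow> bool" where
  "is_biproduct D A B = (\<lambda>(S, i1, i2, p1, p2).
     S \<in> Obj D \<and> i1 \<in> Hom D A S \<and> i2 \<in> Hom D B S \<and> p1 \<in> Hom D S A \<and> p2 \<in> Hom D S B \<and>
     p1 \<cdot>\<^bsub>D\<^esub> i1 = idn D A \<and> p2 \<cdot>\<^bsub>D\<^esub> i2 = idn D B \<and>
     p2 \<cdot>\<^bsub>D\<^esub> i1 = zero_arr D A B \<and> p1 \<cdot>\<^bsub>D\<^esub> i2 = zero_arr D B A \<and>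
     (i1 \<cdot>\<^bsub>D\<^esub> p1) \<uplus>\<^bsub>D\<^esub> (i2 \<cdot>\<^bsub>D\<^esub> p2) = idn D S)"

locale additive_category = preadditive_category +
  assumes ex_zero_obj: "\<exists>Z. is_zero_obj D Z"
    and ex_biproduct: "\<lbrakk>A \<in> Obj D; B \<in> Obj D\<rbrakk> \<Longrightarrow> \<exists>b. is_biproduct D A B b"

text \<open>A fixed choice of zero object and of biproducts.\<close>

definition zero_obj :: "('o, 'm) addcat \<Rightarrow> 'o" where
  "zero_obj D = (SOME Z. is_zero_obj D Z)"

definition biprod :: "('o, 'm) addcat \<Rightarrow> 'o \<Rightarrow> 'o \<Rightarrow> 'o \<times> 'm \<times> 'm \<times> 'm \<times> 'm" where
  "biprod D A B = (SOME b. is_biproduct D A B b)"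

definition dsum :: "('o, 'm) addcat \<Rightarrow> 'o \<Rightarrow> 'o \<Rightarrow> 'o" where
  "dsum D A B = (case biprod D A B of (S, i1, i2, p1, p2) \<Rightarrow> S)"

definition in1 :: "('o, 'm) addcat \<Rightarrow> 'o \<Rightarrow> 'o \<Rightarrow> 'm" where
  "in1 D A B = (case biprod D A B of (S, i1, i2, p1, p2) \<Rightarrow> i1)"

definition in2 :: "('o, 'm) addcat \<Rightarrow> 'o \<Rightarrow> 'o \<Rightarrow> 'm" where
  "in2 D A B = (case biprod D A B of (S, i1, i2, p1, p2) \<Rightarrow> i2)"

definition pr1 :: "('o, 'm) addcat \<Rightarrow> 'o \<Rightarrow> 'o \<Rightarrow> 'm" where
  "pr1 D A B = (case biprod D A B of (S, i1, i2, p1, p2) \<Rightarrow> p1)"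

definition pr2 :: "('o, 'm) addcat \<Rightarrow> 'o \<Rightarrow> 'o \<Rightarrow> 'm" where
  "pr2 D A B = (case biprod D A B of (S, i1, i2, p1, p2) \<Rightarrow> p2)"

text \<open>The column with entries f, g; the row with entries f, g; the matrix with rows a, b and c, d.\<close>

definition col :: "('o, 'm) addcat \<Rightarrow> 'm \<Rightarrow> 'm \<Rightarrow> 'm" where
  "col D f g = (in1 D (Cod D f) (Cod D g) \<cdot>\<^bsub>D\<^esub> f) \<uplus>\<^bsub>D\<^esub> (in2 D (Cod D f) (Cod D g) \<cdot>\<^bsub>D\<^esub> g)"

definition row :: "('o, 'm) addcat \<Rightarrow> 'm \<Rightarrow> 'm \<Rightarrow> 'm" where
  "row D f g = (f \<cdot>\<^bsub>D\<^esub> pr1 D (Dom D f) (Dom D g)) \<uplus>\<^bsub>D\<^esub> (g \<cdot>\<^bsub>D\<^esub> pr2 D (Dom D f) (Dom D g))"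

definition mat :: "('o, 'm) addcat \<Rightarrow> 'm \<Rightarrow> 'm \<Rightarrow> 'm \<Rightarrow> 'm \<Rightarrow> 'm" where
  "mat D a b c d = col D (row D a b) (row D c d)"

definition is_iso :: "('o, 'm) addcat \<Rightarrow> 'm \<Rightarrow> bool" where
  "is_iso D f \<longleftrightarrow> f \<in> Arr D \<and> (\<exists>g \<in> Hom D (Cod D f) (Dom D f).
     g \<cdot>\<^bsub>D\<^esub> f = idn D (Dom D f) \<and> f \<cdot>\<^bsub>D\<^esub> g = idn D (Cod D f))"

definition monic :: "('o, 'm) addcat \<Rightarrow> 'm \<Rightarrow> bool" where
  "monic D f \<longleftrightarrow> f \<in> Arr D \<and>
     (\<forall>Z \<in> Obj D. \<forall>g \<in> Hom D Z (Dom D f). \<forall>h \<in> Hom D Z (Dom D f).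
        f \<cdot>\<^bsub>D\<^esub> g = f \<cdot>\<^bsub>D\<^esub> h \<longrightarrow> g = h)"

definition epic :: "('o, 'm) addcat \<Rightarrow> 'm \<Rightarrow> bool" where
  "epic D f \<longleftrightarrow> f \<in> Arr D \<and>
     (\<forall>Z \<in> Obj D. \<forall>g \<in> Hom D (Cod D f) Z. \<forall>h \<in> Hom D (Cod D f) Z.
        g \<cdot>\<^bsub>D\<^esub> f = h \<cdot>\<^bsub>D\<^esub> f \<longrightarrow> g = h)"

definition comp_closed :: "('o, 'm) addcat \<Rightarrow> 'm set \<Rightarrow> bool" where
  "comp_closed D S \<longleftrightarrow>
     (\<forall>f \<in> S. \<forall>g \<in> S. Cod D f = Dom D g \<longrightarrow> g \<cdot>\<^bsub>D\<^esub> f \<in> S)"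


section \<open>Complexes\<close>

text \<open>
  A complex in degrees 0, ..., m. The components outside the relevant degrees are required
  to be undefined, so that equality of such complexes is the mathematical one.
\<close>

record ('o, 'm) cpx =
  ob :: "nat \<Rightarrow> 'o"
  df :: "nat \<Rightarrow> 'm"

definition cpxs :: "('o, 'm) addcat \<Rightarrow> nat \<Rightarrow> ('o, 'm) cpx set" where
  "cpxs D m = {X. ob X \<in> extensional {..m} \<and> df X \<in> extensional {..<m} \<and>
     (\<forall>i \<le> m. ob X i \<in> Obj D) \<and>
     (\<forall>i < m. df X i \<in> Hom D (ob X i) (ob X (Suc i))) \<and>
     (\<forall>i. Suc i < m \<longrightarrow>
        df X (Suc i) \<cdot>\<^bsub>D\<^esub> df X i = zero_arr D (ob X i) (ob X (Suc (Suc i))))}"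

definition mk_cpx :: "nat \<Rightarrow> (nat \<Rightarrow> 'o) \<Rightarrow> (nat \<Rightarrow> 'm) \<Rightarrow> ('o, 'm) cpx" where
  "mk_cpx m A d = \<lparr>ob = restrict A {..m}, df = restrict d {..<m}\<rparr>"

definition chain_map ::
    "('o, 'm) addcat \<Rightarrow> nat \<Rightarrow> ('o, 'm) cpx \<Rightarrow> ('o, 'm) cpx \<Rightarrow> (nat \<Rightarrow> 'm) \<Rightarrow> bool" where
  "chain_map D m X Y f \<longleftrightarrow>
     (\<forall>i \<le> m. f i \<in> Hom D (ob X i) (ob Y i)) \<and>
     (\<forall>i < m. df Y i \<cdot>\<^bsub>D\<^esub> f i = f (Suc i) \<cdot>\<^bsub>D\<^esub> df X i)"

text \<open>The complexes with fixed end terms A, C (in degrees 0 and n + 1) and their morphisms.\<close>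

definition cpxs_between :: "('o, 'm) addcat \<Rightarrow> nat \<Rightarrow> 'o \<Rightarrow> 'o \<Rightarrow> ('o, 'm) cpx set" where
  "cpxs_between D n A C = {X \<in> cpxs D (Suc n). ob X 0 = A \<and> ob X (Suc n) = C}"

definition chain_map_between ::
    "('o, 'm) addcat \<Rightarrow> nat \<Rightarrow> ('o, 'm) cpx \<Rightarrow> ('o, 'm) cpx \<Rightarrow> (nat \<Rightarrow> 'm) \<Rightarrow> bool" where
  "chain_map_between D n X Y f \<longleftrightarrow> chain_map D (Suc n) X Y f \<and>
     f 0 = idn D (ob X 0) \<and> f (Suc n) = idn D (ob X (Suc n))"

text \<open>Here \<open>h i\<close> is the component of the homotopy from degree \<open>i + 1\<close> of X to degree \<open>i\<close> of Y.\<close>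

definition null_homotopic ::
    "('o, 'm) addcat \<Rightarrow> nat \<Rightarrow> ('o, 'm) cpx \<Rightarrow> ('o, 'm) cpx \<Rightarrow> (nat \<Rightarrow> 'm) \<Rightarrow> bool" where
  "null_homotopic D n X Y f \<longleftrightarrow> (\<exists>h.
     (\<forall>i \<le> n. h i \<in> Hom D (ob X (Suc i)) (ob Y i)) \<and>
     f 0 = h 0 \<cdot>\<^bsub>D\<^esub> df X 0 \<and>
     (\<forall>i < n. f (Suc i) = (df Y i \<cdot>\<^bsub>D\<^esub> h i) \<uplus>\<^bsub>D\<^esub> (h (Suc i) \<cdot>\<^bsub>D\<^esub> df X (Suc i))) \<and>
     f (Suc n) = df Y n \<cdot>\<^bsub>D\<^esub> h n)"

definition homotopic ::
    "('o, 'm) addcat \<Rightarrow> nat \<Rightarrow> ('o, 'm) cpx \<Rightarrow> ('o, 'm) cpx \<Rightarrow> (nat \<Rightarrow> 'm) \<Rightarrow> (nat \<Rightarrow> 'm) \<Rightarrow> bool"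
  where "homotopic D n X Y f g \<longleftrightarrow> null_homotopic D n X Y (\<lambda>i. f i \<uplus>\<^bsub>D\<^esub> neg_arr D (g i))"

definition hclass :: "('o, 'm) addcat \<Rightarrow> nat \<Rightarrow> ('o, 'm) cpx \<Rightarrow> ('o, 'm) cpx set" where
  "hclass D n X = {Y \<in> cpxs_between D n (ob X 0) (ob X (Suc n)). \<exists>f g.
     chain_map_between D n X Y f \<and> chain_map_between D n Y X g \<and>
     homotopic D n X X (\<lambda>i. g i \<cdot>\<^bsub>D\<^esub> f i) (\<lambda>i. idn D (ob X i)) \<and>
     homotopic D n Y Y (\<lambda>i. f i \<cdot>\<^bsub>D\<^esub> g i) (\<lambda>i. idn D (ob Y i))}"

definition triv :: "('o, 'm) addcat \<Rightarrow> nat \<Rightarrow> nat \<Rightarrow> 'o \<Rightarrow> ('o, 'm) cpx" where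
  "triv D n i A = (let T = (\<lambda>j. if j = i \<or> j = Suc i then A else zero_obj D) in
     mk_cpx (Suc n) T (\<lambda>j. if j = i then idn D A else zero_arr D (T j) (T (Suc j))))"

definition zero_cpx :: "('o, 'm) addcat \<Rightarrow> nat \<Rightarrow> ('o, 'm) cpx" where
  "zero_cpx D n =
     mk_cpx (Suc n) (\<lambda>_. zero_obj D) (\<lambda>_. zero_arr D (zero_obj D) (zero_obj D))"

definition dsum_cpx ::
    "('o, 'm) addcat \<Rightarrow> nat \<Rightarrow> ('o, 'm) cpx \<Rightarrow> ('o, 'm) cpx \<Rightarrow> ('o, 'm) cpx" where
  "dsum_cpx D n X Y = mk_cpx (Suc n) (\<lambda>i. dsum D (ob X i) (ob Y i))
     (\<lambda>i. mat D (df X i) (zero_arr D (ob Y i) (ob X (Suc i)))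
                (zero_arr D (ob X i) (ob Y (Suc i))) (df Y i))"

text \<open>The parts of a complex in degrees 0, ..., n and in degrees 1, 2, ... (reindexed from 0).\<close>

definition init_cpx :: "nat \<Rightarrow> ('o, 'm) cpx \<Rightarrow> ('o, 'm) cpx" where
  "init_cpx n X = mk_cpx n (ob X) (df X)"

definition tail_cpx :: "nat \<Rightarrow> ('o, 'm) cpx \<Rightarrow> ('o, 'm) cpx" where
  "tail_cpx n X = mk_cpx n (\<lambda>i. ob X (Suc i)) (\<lambda>i. df X (Suc i))"

text \<open>
  \<open>Mcone\<close> and \<open>Ncone\<close> are the mapping cones of the axioms (EA2) and its dual;
  \<open>cone\<close> is the cone of a chain map between complexes in degrees 0, ..., n.
  All three are complexes in degrees 0, ..., n + 1.
\<close>

definition Mcone ::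
    "('o, 'm) addcat \<Rightarrow> nat \<Rightarrow> ('o, 'm) cpx \<Rightarrow> ('o, 'm) cpx \<Rightarrow> (nat \<Rightarrow> 'm) \<Rightarrow> ('o, 'm) cpx" where
  "Mcone D n X Y f = mk_cpx (Suc n)
     (\<lambda>i. if i = 0 then ob X 1
          else if i \<le> n then dsum D (ob X (i + 1)) (ob Y i)
          else ob Y (n + 1))
     (\<lambda>i. if i = 0 then col D (neg_arr D (df X 1)) (f 1)
          else if i < n then
            mat D (neg_arr D (df X (i + 1))) (zero_arr D (ob Y i) (ob X (i + 2)))
                  (f (i + 1)) (df Y i)
          else row D (f (n + 1)) (df Y n))"

definition Ncone ::
    "('o, 'm) addcat \<Rightarrow> nat \<Rightarrow> ('o, 'm) cpx \<Rightarrow> ('o, 'm) cpx \<Rightarrow> (nat \<Rightarrow> 'm) \<Rightarrow> ('o, 'm) cpx" where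
  "Ncone D n X Y f = mk_cpx (Suc n)
     (\<lambda>i. if i = 0 then ob X 0
          else if i \<le> n then dsum D (ob X i) (ob Y (i - 1))
          else ob Y n)
     (\<lambda>i. if i = 0 then col D (df X 0) (f 0)
          else if i < n then
            mat D (df X i) (zero_arr D (ob Y (i - 1)) (ob X (i + 1)))
                  (f i) (neg_arr D (df Y (i - 1)))
          else row D (f n) (neg_arr D (df Y (n - 1))))"

definition cone ::
    "('o, 'm) addcat \<Rightarrow> nat \<Rightarrow> ('o, 'm) cpx \<Rightarrow> ('o, 'm) cpx \<Rightarrow> (nat \<Rightarrow> 'm) \<Rightarrow> ('o, 'm) cpx" where
  "cone D n X Y f = mk_cpx (Suc n)
     (\<lambda>i. if i = 0 then ob X 0
          else if i \<le> n then dsum D (ob X i) (ob Y (i - 1))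
          else ob Y n)
     (\<lambda>i. if i = 0 then col D (neg_arr D (df X 0)) (f 0)
          else if i < n then
            mat D (neg_arr D (df X i)) (zero_arr D (ob Y (i - 1)) (ob X (i + 1)))
                  (f i) (df Y (i - 1))
          else row D (f n) (df Y (n - 1)))"


section \<open>Exactness of the induced sequences of abelian groups\<close>

definition exact_at ::
    "('a, 'p) monoid_scheme \<Rightarrow> ('b, 'q) monoid_scheme \<Rightarrow> ('c, 'r) monoid_scheme \<Rightarrow>
     ('a \<Rightarrow> 'b) \<Rightarrow> ('b \<Rightarrow> 'c) \<Rightarrow> bool" where
  "exact_at G H K u v \<longleftrightarrow> u ` carrier G = kernel H K v"

text \<open>
  Exactness at degree \<open>i + 1\<close> of the sequences obtained by applying D(Z, -), respectively
  D(-, Z), to the complex X.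
\<close>

definition co_exact_Suc :: "('o, 'm) addcat \<Rightarrow> ('o, 'm) cpx \<Rightarrow> 'o \<Rightarrow> nat \<Rightarrow> bool" where
  "co_exact_Suc D X Z i \<longleftrightarrow>
     exact_at (homgrp D Z (ob X i)) (homgrp D Z (ob X (i + 1))) (homgrp D Z (ob X (i + 2)))
       (\<lambda>g. df X i \<cdot>\<^bsub>D\<^esub> g) (\<lambda>g. df X (i + 1) \<cdot>\<^bsub>D\<^esub> g)"

definition contra_exact_Suc :: "('o, 'm) addcat \<Rightarrow> ('o, 'm) cpx \<Rightarrow> 'o \<Rightarrow> nat \<Rightarrow> bool" where
  "contra_exact_Suc D X Z i \<longleftrightarrow>
     exact_at (homgrp D (ob X (i + 2)) Z) (homgrp D (ob X (i + 1)) Z) (homgrp D (ob X i) Z)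
       (\<lambda>g. g \<cdot>\<^bsub>D\<^esub> df X (i + 1)) (\<lambda>g. g \<cdot>\<^bsub>D\<^esub> df X i)"

text \<open>
  For all Z, exactness of 0 \<open>\<rightarrow>\<close> D(Z, X 0) \<open>\<rightarrow>\<close> ... \<open>\<rightarrow>\<close> D(Z, X (n + 1)), respectively of
  0 \<open>\<rightarrow>\<close> D(X (n + 1), Z) \<open>\<rightarrow>\<close> ... \<open>\<rightarrow>\<close> D(X 0, Z).
\<close>

definition co_left_exact :: "('o, 'm) addcat \<Rightarrow> nat \<Rightarrow> ('o, 'm) cpx \<Rightarrow> bool" where
  "co_left_exact D n X \<longleftrightarrow> (\<forall>Z \<in> Obj D.
     kernel (homgrp D Z (ob X 0)) (homgrp D Z (ob X 1)) (\<lambda>g. df X 0 \<cdot>\<^bsub>D\<^esub> g)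
       = {zero_arr D Z (ob X 0)} \<and>
     (\<forall>i < n. co_exact_Suc D X Z i))"

definition contra_left_exact :: "('o, 'm) addcat \<Rightarrow> nat \<Rightarrow> ('o, 'm) cpx \<Rightarrow> bool" where
  "contra_left_exact D n X \<longleftrightarrow> (\<forall>Z \<in> Obj D.
     kernel (homgrp D (ob X (n + 1)) Z) (homgrp D (ob X n) Z) (\<lambda>g. g \<cdot>\<^bsub>D\<^esub> df X n)
       = {zero_arr D (ob X (n + 1)) Z} \<and>
     (\<forall>i < n. contra_exact_Suc D X Z i))"


section \<open>Biadditive functors and extensions\<close>

text \<open>
  \<open>act G c a\<close> is the homomorphism G(c, a) from G(Cod c, Dom a) to G(Dom c, Cod a).
  The groups are written multiplicatively, as for all groups in \<^theory>\<open>HOL-Algebra.Group\<close>.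
\<close>

record ('o, 'm, 'e) bifun =
  grp :: "'o \<Rightarrow> 'o \<Rightarrow> 'e monoid"
  act :: "'m \<Rightarrow> 'm \<Rightarrow> 'e \<Rightarrow> 'e"

definition push :: "('o, 'm) addcat \<Rightarrow> ('o, 'm, 'e) bifun \<Rightarrow> 'o \<Rightarrow> 'm \<Rightarrow> 'e \<Rightarrow> 'e" where
  "push D G C a = act G (idn D C) a"

definition pull :: "('o, 'm) addcat \<Rightarrow> ('o, 'm, 'e) bifun \<Rightarrow> 'm \<Rightarrow> 'o \<Rightarrow> 'e \<Rightarrow> 'e" where
  "pull D G c A = act G c (idn D A)"

locale biadditive_functor = additive_category D
  for D :: "('o, 'm) addcat" and G :: "('o, 'm, 'e) bifun" +
  assumes grp_comm_group: "\<lbrakk>C \<in> Obj D; A \<in> Obj D\<rbrakk> \<Longrightarrow> comm_group (grp G C A)"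
    and act_hom: "\<lbrakk>c \<in> Hom D C' C; a \<in> Hom D A A'\<rbrakk>
      \<Longrightarrow> act G c a \<in> hom (grp G C A) (grp G C' A')"
    and act_idn: "\<lbrakk>C \<in> Obj D; A \<in> Obj D; \<delta> \<in> carrier (grp G C A)\<rbrakk>
      \<Longrightarrow> act G (idn D C) (idn D A) \<delta> = \<delta>"
    and act_comp: "\<lbrakk>c \<in> Hom D C' C; c' \<in> Hom D C'' C'; a \<in> Hom D A A'; a' \<in> Hom D A' A'';
        \<delta> \<in> carrier (grp G C A)\<rbrakk>
      \<Longrightarrow> act G (c \<cdot>\<^bsub>D\<^esub> c') (a' \<cdot>\<^bsub>D\<^esub> a) \<delta> = act G c' a' (act G c a \<delta>)"
    and push_plus: "\<lbrakk>C \<in> Obj D; a \<in> Hom D A A'; b \<in> Hom D A A'; \<delta> \<in> carrier (grp G C A)\<rbrakk>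
      \<Longrightarrow> push D G C (a \<uplus>\<^bsub>D\<^esub> b) \<delta> = push D G C a \<delta> \<otimes>\<^bsub>grp G C A'\<^esub> push D G C b \<delta>"
    and pull_plus: "\<lbrakk>A \<in> Obj D; c \<in> Hom D C' C; d \<in> Hom D C' C; \<delta> \<in> carrier (grp G C A)\<rbrakk>
      \<Longrightarrow> pull D G (c \<uplus>\<^bsub>D\<^esub> d) A \<delta> = pull D G c A \<delta> \<otimes>\<^bsub>grp G C' A\<^esub> pull D G d A \<delta>"

definition n_exangle ::
    "nat \<Rightarrow> ('o, 'm) addcat \<Rightarrow> ('o, 'm, 'e) bifun \<Rightarrow> ('o, 'm) cpx \<Rightarrow> 'e \<Rightarrow> bool" where
  "n_exangle n D G X \<delta> \<longleftrightarrow>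
     X \<in> cpxs D (Suc n) \<and>
     \<delta> \<in> carrier (grp G (ob X (n + 1)) (ob X 0)) \<and>
     push D G (ob X (n + 1)) (df X 0) \<delta> = \<one>\<^bsub>grp G (ob X (n + 1)) (ob X 1)\<^esub> \<and>
     pull D G (df X n) (ob X 0) \<delta> = \<one>\<^bsub>grp G (ob X n) (ob X 0)\<^esub> \<and>
     (\<forall>Z \<in> Obj D.
        (\<forall>i < n. co_exact_Suc D X Z i) \<and>
        exact_at (homgrp D Z (ob X n)) (homgrp D Z (ob X (n + 1))) (grp G Z (ob X 0))
          (\<lambda>f. df X n \<cdot>\<^bsub>D\<^esub> f) (\<lambda>f. pull D G f (ob X 0) \<delta>)) \<and>
     (\<forall>Z \<in> Obj D.
        (\<forall>i < n. contra_exact_Suc D X Z i) \<and>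
        exact_at (homgrp D (ob X 1) Z) (homgrp D (ob X 0) Z) (grp G (ob X (n + 1)) Z)
          (\<lambda>g. g \<cdot>\<^bsub>D\<^esub> df X 0) (\<lambda>g. push D G (ob X (n + 1)) g \<delta>))"


section \<open>n-exangulated categories\<close>

text \<open>A realisation r assigns to \<open>\<delta> \<in> G(C, A)\<close> the class \<open>r C A \<delta>\<close>.\<close>

type_synonym ('o, 'm, 'e) realisation = "'o \<Rightarrow> 'o \<Rightarrow> 'e \<Rightarrow> ('o, 'm) cpx set"

definition distinguished ::
    "nat \<Rightarrow> ('o, 'm) addcat \<Rightarrow> ('o, 'm, 'e) bifun \<Rightarrow> ('o, 'm, 'e) realisation \<Rightarrow>
     ('o, 'm) cpx \<Rightarrow> 'e \<Rightarrow> bool" where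
  "distinguished n D G r X \<delta> \<longleftrightarrow>
     X \<in> cpxs D (Suc n) \<and> \<delta> \<in> carrier (grp G (ob X (n + 1)) (ob X 0)) \<and>
     r (ob X (n + 1)) (ob X 0) \<delta> = hclass D n X"

definition conflation ::
    "nat \<Rightarrow> ('o, 'm) addcat \<Rightarrow> ('o, 'm, 'e) bifun \<Rightarrow> ('o, 'm, 'e) realisation \<Rightarrow>
     ('o, 'm) cpx \<Rightarrow> bool" where
  "conflation n D G r X \<longleftrightarrow> (\<exists>\<delta>. distinguished n D G r X \<delta>)"

definition inflation ::
    "nat \<Rightarrow> ('o, 'm) addcat \<Rightarrow> ('o, 'm, 'e) bifun \<Rightarrow> ('o, 'm, 'e) realisation \<Rightarrow> 'm \<Rightarrow> bool"
  where "inflation n D G r f \<longleftrightarrow> (\<exists>X. conflation n D G r X \<and> f = df X 0)"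

definition deflation ::
    "nat \<Rightarrow> ('o, 'm) addcat \<Rightarrow> ('o, 'm, 'e) bifun \<Rightarrow> ('o, 'm, 'e) realisation \<Rightarrow> 'm \<Rightarrow> bool"
  where "deflation n D G r f \<longleftrightarrow> (\<exists>X. conflation n D G r X \<and> f = df X n)"

definition lift_of ::
    "('o, 'm) addcat \<Rightarrow> nat \<Rightarrow> ('o, 'm) cpx \<Rightarrow> ('o, 'm) cpx \<Rightarrow> 'm \<Rightarrow> 'm \<Rightarrow> (nat \<Rightarrow> 'm) \<Rightarrow> bool"
  where "lift_of D n X Y a c f \<longleftrightarrow>
     chain_map D (Suc n) X Y f \<and> f 0 = a \<and> f (Suc n) = c"

locale exact_realisation = biadditive_functor D G
  for n :: nat and D :: "('o, 'm) addcat" and G :: "('o, 'm, 'e) bifun"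
    and r :: "('o, 'm, 'e) realisation" +
  assumes realisation_class:
      "\<lbrakk>C \<in> Obj D; A \<in> Obj D; \<delta> \<in> carrier (grp G C A)\<rbrakk>
       \<Longrightarrow> \<exists>X \<in> cpxs_between D n A C. r C A \<delta> = hclass D n X"
    and R0: "\<lbrakk>distinguished n D G r X \<delta>; distinguished n D G r Y \<rho>;
        a \<in> Hom D (ob X 0) (ob Y 0); c \<in> Hom D (ob X (n + 1)) (ob Y (n + 1));
        push D G (ob X (n + 1)) a \<delta> = pull D G c (ob Y 0) \<rho>\<rbrakk>
      \<Longrightarrow> \<exists>f. lift_of D n X Y a c f"
    and R1: "distinguished n D G r X \<delta> \<Longrightarrow> n_exangle n D G X \<delta>"
    and R2_left: "A \<in> Obj D \<Longrightarrow>
        r (zero_obj D) A \<one>\<^bsub>grp G (zero_obj D) A\<^esub> = hclass D n (triv D n 0 A)"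
    and R2_right: "C \<in> Obj D \<Longrightarrow>
        r C (zero_obj D) \<one>\<^bsub>grp G C (zero_obj D)\<^esub> = hclass D n (triv D n n C)"

locale n_exangulated_category = exact_realisation n D G r
  for n :: nat and D :: "('o, 'm) addcat" and G :: "('o, 'm, 'e) bifun"
    and r :: "('o, 'm, 'e) realisation" +
  assumes EA1: "comp_closed D {f. inflation n D G r f}"
    and EA1_op: "comp_closed D {f. deflation n D G r f}"
    and EA2: "\<lbrakk>distinguished n D G r Y \<rho>; ob X 0 = ob Y 0;
        c \<in> Hom D (ob X (n + 1)) (ob Y (n + 1));
        distinguished n D G r X (pull D G c (ob Y 0) \<rho>)\<rbrakk>
      \<Longrightarrow> \<exists>f. lift_of D n X Y (idn D (ob X 0)) c f \<and>
            distinguished n D G r (Mcone D n X Y f) (push D G (ob Y (n + 1)) (df X 0) \<rho>)"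
    and EA2_op: "\<lbrakk>distinguished n D G r X \<delta>; ob X (n + 1) = ob Y (n + 1);
        a \<in> Hom D (ob X 0) (ob Y 0);
        distinguished n D G r Y (push D G (ob X (n + 1)) a \<delta>)\<rbrakk>
      \<Longrightarrow> \<exists>f. lift_of D n X Y a (idn D (ob X (n + 1))) f \<and>
            distinguished n D G r (Ncone D n X Y f) (pull D G (df Y n) (ob X 0) \<delta>)"


section \<open>n-exangulated functors and equivalences\<close>

text \<open>A functor is given by its maps on objects and on arrows.\<close>

definition is_functor ::
    "('o, 'm) addcat \<Rightarrow> ('p, 'k) addcat \<Rightarrow> ('o \<Rightarrow> 'p) \<Rightarrow> ('m \<Rightarrow> 'k) \<Rightarrow> bool" where
  "is_functor D D' Fo Fm \<longleftrightarrow>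
     (\<forall>A \<in> Obj D. Fo A \<in> Obj D' \<and> Fm (idn D A) = idn D' (Fo A)) \<and>
     (\<forall>A B. \<forall>f \<in> Hom D A B. Fm f \<in> Hom D' (Fo A) (Fo B)) \<and>
     (\<forall>A B C. \<forall>f \<in> Hom D A B. \<forall>g \<in> Hom D B C. Fm (g \<cdot>\<^bsub>D\<^esub> f) = Fm g \<cdot>\<^bsub>D'\<^esub> Fm f)"

definition is_additive_functor ::
    "('o, 'm) addcat \<Rightarrow> ('p, 'k) addcat \<Rightarrow> ('o \<Rightarrow> 'p) \<Rightarrow> ('m \<Rightarrow> 'k) \<Rightarrow> bool" where
  "is_additive_functor D D' Fo Fm \<longleftrightarrow> is_functor D D' Fo Fm \<and>
     (\<forall>A B. \<forall>f \<in> Hom D A B. \<forall>g \<in> Hom D A B. Fm (f \<uplus>\<^bsub>D\<^esub> g) = Fm f \<uplus>\<^bsub>D'\<^esub> Fm g)"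

definition nat_iso ::
    "('o, 'm) addcat \<Rightarrow> ('p, 'k) addcat \<Rightarrow> ('o \<Rightarrow> 'p) \<Rightarrow> ('m \<Rightarrow> 'k) \<Rightarrow>
     ('o \<Rightarrow> 'p) \<Rightarrow> ('m \<Rightarrow> 'k) \<Rightarrow> ('o \<Rightarrow> 'k) \<Rightarrow> bool" where
  "nat_iso D D' Fo Fm Ho Hm \<tau> \<longleftrightarrow>
     (\<forall>A \<in> Obj D. \<tau> A \<in> Hom D' (Fo A) (Ho A) \<and> is_iso D' (\<tau> A)) \<and>
     (\<forall>A B. \<forall>f \<in> Hom D A B. \<tau> B \<cdot>\<^bsub>D'\<^esub> Fm f = Hm f \<cdot>\<^bsub>D'\<^esub> \<tau> A)"

definition is_equivalence ::
    "('o, 'm) addcat \<Rightarrow> ('p, 'k) addcat \<Rightarrow> ('o \<Rightarrow> 'p) \<Rightarrow> ('m \<Rightarrow> 'k) \<Rightarrow> bool" where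
  "is_equivalence D D' Fo Fm \<longleftrightarrow> is_functor D D' Fo Fm \<and> (\<exists>Ho Hm \<eta> \<epsilon>.
     is_functor D' D Ho Hm \<and>
     nat_iso D D id id (Ho \<circ> Fo) (Hm \<circ> Fm) \<eta> \<and>
     nat_iso D' D' (Fo \<circ> Ho) (Fm \<circ> Hm) id id \<epsilon>)"

definition map_cpx :: "nat \<Rightarrow> ('o \<Rightarrow> 'p) \<Rightarrow> ('m \<Rightarrow> 'k) \<Rightarrow> ('o, 'm) cpx \<Rightarrow> ('p, 'k) cpx" where
  "map_cpx n Fo Fm X = mk_cpx (Suc n) (\<lambda>i. Fo (ob X i)) (\<lambda>i. Fm (df X i))"

definition n_exangulated_functor ::
    "nat \<Rightarrow> ('o, 'm) addcat \<Rightarrow> ('o, 'm, 'e) bifun \<Rightarrow> ('o, 'm, 'e) realisation \<Rightarrow>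
     ('p, 'k) addcat \<Rightarrow> ('p, 'k, 'd) bifun \<Rightarrow> ('p, 'k, 'd) realisation \<Rightarrow>
     ('o \<Rightarrow> 'p) \<Rightarrow> ('m \<Rightarrow> 'k) \<Rightarrow> ('o \<Rightarrow> 'o \<Rightarrow> 'e \<Rightarrow> 'd) \<Rightarrow> bool" where
  "n_exangulated_functor n D G r D' G' r' Fo Fm \<Gamma> \<longleftrightarrow>
     n_exangulated_category n D G r \<and> n_exangulated_category n D' G' r' \<and>
     is_additive_functor D D' Fo Fm \<and>
     (\<forall>C \<in> Obj D. \<forall>A \<in> Obj D. \<Gamma> C A \<in> hom (grp G C A) (grp G' (Fo C) (Fo A))) \<and>
     (\<forall>C C' A A'. \<forall>c \<in> Hom D C' C. \<forall>a \<in> Hom D A A'. \<forall>\<delta> \<in> carrier (grp G C A).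
        \<Gamma> C' A' (act G c a \<delta>) = act G' (Fm c) (Fm a) (\<Gamma> C A \<delta>)) \<and>
     (\<forall>C \<in> Obj D. \<forall>A \<in> Obj D. \<forall>\<delta> \<in> carrier (grp G C A). \<forall>X \<in> cpxs_between D n A C.
        r C A \<delta> = hclass D n X \<longrightarrow>
        r' (Fo C) (Fo A) (\<Gamma> C A \<delta>) = hclass D' n (map_cpx n Fo Fm X))"

definition n_exangulated_equivalence ::
    "nat \<Rightarrow> ('o, 'm) addcat \<Rightarrow> ('o, 'm, 'e) bifun \<Rightarrow> ('o, 'm, 'e) realisation \<Rightarrow>
     ('p, 'k) addcat \<Rightarrow> ('p, 'k, 'd) bifun \<Rightarrow> ('p, 'k, 'd) realisation \<Rightarrow>
     ('o \<Rightarrow> 'p) \<Rightarrow> ('m \<Rightarrow> 'k) \<Rightarrow> ('o \<Rightarrow> 'o \<Rightarrow> 'e \<Rightarrow> 'd) \<Rightarrow> bool" where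
  "n_exangulated_equivalence n D G r D' G' r' Fo Fm \<Gamma> \<longleftrightarrow>
     n_exangulated_functor n D G r D' G' r' Fo Fm \<Gamma> \<and>
     is_equivalence D D' Fo Fm \<and>
     (\<forall>C \<in> Obj D. \<forall>A \<in> Obj D. \<Gamma> C A \<in> iso (grp G C A) (grp G' (Fo C) (Fo A)))"


section \<open>n-exact categories\<close>

definition n_exact_seq :: "('o, 'm) addcat \<Rightarrow> nat \<Rightarrow> ('o, 'm) cpx \<Rightarrow> bool" where
  "n_exact_seq D n X \<longleftrightarrow>
     X \<in> cpxs D (Suc n) \<and> co_left_exact D n X \<and> contra_left_exact D n X"

text \<open>The last disjunct is the case k = n + 1, in which the component of degree n + 2 is \<open>f 0\<close>.\<close>

definition weak_iso ::
    "('o, 'm) addcat \<Rightarrow> nat \<Rightarrow> ('o, 'm) cpx \<Rightarrow> ('o, 'm) cpx \<Rightarrow> (nat \<Rightarrow> 'm) \<Rightarrow> bool" where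
  "weak_iso D n X Y f \<longleftrightarrow> n_exact_seq D n X \<and> n_exact_seq D n Y \<and>
     chain_map D (Suc n) X Y f \<and>
     ((\<exists>k \<le> n. is_iso D (f k) \<and> is_iso D (f (k + 1))) \<or>
      (is_iso D (f (n + 1)) \<and> is_iso D (f 0)))"

definition n_pushout ::
    "('o, 'm) addcat \<Rightarrow> nat \<Rightarrow> ('o, 'm) cpx \<Rightarrow> ('o, 'm) cpx \<Rightarrow> (nat \<Rightarrow> 'm) \<Rightarrow> bool" where
  "n_pushout D n X Y f \<longleftrightarrow> X \<in> cpxs D n \<and> Y \<in> cpxs D n \<and> chain_map D n X Y f \<and>
     contra_left_exact D n (cone D n X Y f)"

definition n_pullback ::
    "('o, 'm) addcat \<Rightarrow> nat \<Rightarrow> ('o, 'm) cpx \<Rightarrow> ('o, 'm) cpx \<Rightarrow> (nat \<Rightarrow> 'm) \<Rightarrow> bool" where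
  "n_pullback D n X Y f \<longleftrightarrow> X \<in> cpxs D n \<and> Y \<in> cpxs D n \<and> chain_map D n X Y f \<and>
     co_left_exact D n (cone D n X Y f)"

definition adm_mono :: "('o, 'm) cpx set \<Rightarrow> 'm set" where
  "adm_mono \<X> = {df X 0 | X. X \<in> \<X>}"

definition adm_epi :: "nat \<Rightarrow> ('o, 'm) cpx set \<Rightarrow> 'm set" where
  "adm_epi n \<X> = {df X n | X. X \<in> \<X>}"

locale n_exact_category = additive_category D
  for n :: nat and D :: "('o, 'm) addcat" and \<X> :: "('o, 'm) cpx set" +
  assumes n_exact: "X \<in> \<X> \<Longrightarrow> n_exact_seq D n X"
    and weak_iso_closed: "weak_iso D n X Y f \<Longrightarrow> (X \<in> \<X> \<longleftrightarrow> Y \<in> \<X>)"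
    and E0: "zero_cpx D n \<in> \<X>"
    and E1: "comp_closed D (adm_mono \<X>)"
    and E1_op: "comp_closed D (adm_epi n \<X>)"
    and E2: "\<lbrakk>X \<in> \<X>; u \<in> Hom D (ob X 0) B\<rbrakk>
      \<Longrightarrow> \<exists>Y h. n_pushout D n (init_cpx n X) Y h \<and> h 0 = u \<and> df Y 0 \<in> adm_mono \<X>"
    and E2_op: "\<lbrakk>X \<in> \<X>; g \<in> Hom D B (ob X (n + 1))\<rbrakk>
      \<Longrightarrow> \<exists>Y h. n_pullback D n Y (tail_cpx n X) h \<and> h n = g \<and> df Y (n - 1) \<in> adm_epi n \<X>"


section \<open>From n-exact to n-exangulated categories\<close>

text \<open>
  All objects and arrows live in types, so the classes below always form sets and the
  condition of having small extension groups is automatically satisfied.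
\<close>

definition ex_carrier ::
    "nat \<Rightarrow> ('o, 'm) addcat \<Rightarrow> ('o, 'm) cpx set \<Rightarrow> 'o \<Rightarrow> 'o \<Rightarrow> ('o, 'm) cpx set set" where
  "ex_carrier n D \<X> C A = {hclass D n X | X. X \<in> \<X> \<inter> cpxs_between D n A C}"

definition ex_push ::
    "nat \<Rightarrow> ('o, 'm) addcat \<Rightarrow> ('o, 'm) cpx set \<Rightarrow> 'o \<Rightarrow> 'm \<Rightarrow>
     ('o, 'm) cpx set \<Rightarrow> ('o, 'm) cpx set" where
  "ex_push n D \<X> C a \<xi> = (THE \<eta>. \<exists>X Y f.
     X \<in> \<X> \<inter> cpxs_between D n (Dom D a) C \<and> \<xi> = hclass D n X \<and>
     Y \<in> \<X> \<inter> cpxs_between D n (Cod D a) C \<and> \<eta> = hclass D n Y \<and>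
     lift_of D n X Y a (idn D C) f \<and>
     n_pushout D n (init_cpx n X) (init_cpx n Y) f)"

definition ex_pull ::
    "nat \<Rightarrow> ('o, 'm) addcat \<Rightarrow> ('o, 'm) cpx set \<Rightarrow> 'm \<Rightarrow> 'o \<Rightarrow>
     ('o, 'm) cpx set \<Rightarrow> ('o, 'm) cpx set" where
  "ex_pull n D \<X> c A \<xi> = (THE \<eta>. \<exists>X Y f.
     X \<in> \<X> \<inter> cpxs_between D n A (Cod D c) \<and> \<xi> = hclass D n X \<and>
     Y \<in> \<X> \<inter> cpxs_between D n A (Dom D c) \<and> \<eta> = hclass D n Y \<and>
     lift_of D n Y X (idn D A) c f \<and>
     n_pullback D n (tail_cpx n Y) (tail_cpx n X) (\<lambda>i. f (Suc i)))"

text \<open>The bifunctor applied to (c, a), assembled from its two partial functors.\<close>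

definition ex_act ::
    "nat \<Rightarrow> ('o, 'm) addcat \<Rightarrow> ('o, 'm) cpx set \<Rightarrow> 'm \<Rightarrow> 'm \<Rightarrow>
     ('o, 'm) cpx set \<Rightarrow> ('o, 'm) cpx set" where
  "ex_act n D \<X> c a \<xi> = ex_pull n D \<X> c (Cod D a) (ex_push n D \<X> (Cod D c) a \<xi>)"

definition baer_sum ::
    "nat \<Rightarrow> ('o, 'm) addcat \<Rightarrow> ('o, 'm) cpx set \<Rightarrow> 'o \<Rightarrow> 'o \<Rightarrow>
     ('o, 'm) cpx set \<Rightarrow> ('o, 'm) cpx set \<Rightarrow> ('o, 'm) cpx set" where
  "baer_sum n D \<X> C A \<xi> \<eta> = (THE \<zeta>. \<exists>X Y.
     X \<in> \<X> \<inter> cpxs_between D n A C \<and> \<xi> = hclass D n X \<and>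
     Y \<in> \<X> \<inter> cpxs_between D n A C \<and> \<eta> = hclass D n Y \<and>
     \<zeta> = ex_act n D \<X> (col D (idn D C) (idn D C)) (row D (idn D A) (idn D A))
           (hclass D n (dsum_cpx D n X Y)))"

definition ex_grp ::
    "nat \<Rightarrow> ('o, 'm) addcat \<Rightarrow> ('o, 'm) cpx set \<Rightarrow> 'o \<Rightarrow> 'o \<Rightarrow> ('o, 'm) cpx set monoid" where
  "ex_grp n D \<X> C A = \<lparr>carrier = ex_carrier n D \<X> C A,
     monoid.mult = baer_sum n D \<X> C A,
     one = (THE \<epsilon>. \<epsilon> \<in> ex_carrier n D \<X> C A \<and>
        (\<forall>\<xi> \<in> ex_carrier n D \<X> C A.
           baer_sum n D \<X> C A \<epsilon> \<xi> = \<xi> \<and> baer_sum n D \<X> C A \<xi> \<epsilon> = \<xi>))\<rparr>"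

definition ex_bifun ::
    "nat \<Rightarrow> ('o, 'm) addcat \<Rightarrow> ('o, 'm) cpx set \<Rightarrow> ('o, 'm, ('o, 'm) cpx set) bifun" where
  "ex_bifun n D \<X> = \<lparr>grp = ex_grp n D \<X>, act = ex_act n D \<X>\<rparr>"

text \<open>The elements of the extension groups are the classes themselves.\<close>

definition ex_realisation :: "('o, 'm, ('o, 'm) cpx set) realisation" where
  "ex_realisation C A \<delta> = \<delta>"

end

theory Submission
  imports Defs
begin

text \<open>
  If \<open>(Id, \<Gamma>)\<close> is an equivalence onto the n-exangulated category of an n-exact structure, then every
  conflation is homotopy equivalent, with identities at the ends, to an n-exact sequence. Such an
  equivalence shows that its first differential is monic and its last one epic
  (\<open>inflation_monic_deflation_epic_of_equivalence\<close>).

  Conversely, let all inflations be monic and all deflations epic. The n-exact structure is the class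
  of all conflations: the long exact sequences of an n-exangle, together with a monic first and an
  epic last differential, say precisely that a conflation is an n-exact sequence. The tool for
  everything else is a comparison argument for n-exact sequences (\<open>first_component_factors\<close> and
  \<open>last_component_factors\<close>): a chain map whose last component factors through the last differential
  of its target is null-homotopic, so that its first component factors through the first differential
  of its source, and dually. Three facts follow.

  An n-exact sequence that is linked to a conflation by a chain map with identities at the ends is
  itself a conflation for the same extension (\<open>dist_of_chain_map_from\<close>, \<open>dist_of_chain_map_to\<close>).
  This yields the closure of the conflations under weak isomorphisms
  (\<open>conflation_iff_of_weak_iso\<close>). Pushouts and pullbacks are provided by the mapping cones of
  (EA2) and its dual, which up to signs are the cones of n-pullback and n-pushout diagrams.

  Every chain map between conflations is a morphism of extensions
  (\<open>chain_map_is_extension_morphism\<close>). In particular the extension of a conflation is determined by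
  its homotopy class, so the realisation \<open>\<delta> \<mapsto> \<s>(\<delta>)\<close> is a bijection from the given extension group
  onto the set of classes of conflations.

  This bijection is compatible with all operations. The class of a pushout or pullback is forced by
  the previous fact, and for the Baer sum one checks that a direct sum of conflations realises the
  direct sum of the extensions (\<open>dist_dsum_cpx\<close>). Hence the extension bifunctor of the conflations is
  the given one, transported along the realisation (\<open>transport_structure\<close>), and the realisation is
  the required natural isomorphism \<open>\<Gamma>\<close>.
\<close>

section \<open>Additive calculus on typed arrows\<close>

context category
begin

abbreviation compose (infixl "**" 75) where "g ** f \<equiv> g \<cdot>\<^bsub>D\<^esub> f"

lemma in_Hom: "f \<in> Hom D A B \<longleftrightarrow> f \<in> Arr D \<and> Dom D f = A \<and> Cod D f = B"
  by (simp add: Hom_def)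

lemma Hom_obj: "f \<in> Hom D A B \<Longrightarrow> A \<in> Obj D" "f \<in> Hom D A B \<Longrightarrow> B \<in> Obj D"
  using dom_obj cod_obj by (auto simp: in_Hom)

text \<open>
  Typing is expressed by \<open>Arr\<close>, \<open>Dom\<close> and \<open>Cod\<close> rather than by membership in a hom-set: these
  conditions contain no variables beyond those of the rewritten term, so the simplifier can
  discharge them.
\<close>

lemma comp_typing:
  assumes "f \<in> Arr D" "g \<in> Arr D" "Cod D f = Dom D g"
  shows "g ** f \<in> Arr D" "Dom D (g ** f) = Dom D f" "Cod D (g ** f) = Cod D g"
  using comp_hom[of f "Dom D f" "Cod D f" g "Cod D g"] assms by (auto simp: in_Hom)

lemma comp_assoc':
  assumes "f \<in> Arr D" "g \<in> Arr D" "h \<in> Arr D" "Cod D f = Dom D g" "Cod D g = Dom D h"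
  shows "h ** g ** f = h ** (g ** f)"
  using comp_assoc[of f "Dom D f" "Cod D f" g "Cod D g" h "Cod D h"] assms by (auto simp: in_Hom)

lemma idn_typing:
  assumes "A \<in> Obj D"
  shows "idn D A \<in> Arr D" "Dom D (idn D A) = A" "Cod D (idn D A) = A"
  using idn_hom[OF assms] by (auto simp: in_Hom)

lemma idn_left': "\<lbrakk>f \<in> Arr D; Cod D f = B\<rbrakk> \<Longrightarrow> idn D B ** f = f"
  using idn_left[of f "Dom D f" B] by (simp add: in_Hom)

lemma idn_right': "\<lbrakk>f \<in> Arr D; Dom D f = A\<rbrakk> \<Longrightarrow> f ** idn D A = f"
  using idn_right[of f A "Cod D f"] by (simp add: in_Hom)

lemmas category_simps = in_Hom dom_obj cod_obj comp_typing comp_assoc' idn_typing idn_left' idn_right'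

end

context preadditive_category
begin

abbreviation add (infixl "\<boxplus>" 65) where "f \<boxplus> g \<equiv> f \<uplus>\<^bsub>D\<^esub> g"
abbreviation neg ("\<boxminus> _" [81] 80) where "\<boxminus> f \<equiv> neg_arr D f"
abbreviation zr where "zr A B \<equiv> zero_arr D A B"

lemma zero_typing:
  assumes "A \<in> Obj D" "B \<in> Obj D"
  shows "zr A B \<in> Arr D" "Dom D (zr A B) = A" "Cod D (zr A B) = B"
proof -
  interpret g: comm_group "homgrp D A B" using hom_comm_group assms by blast
  have "zr A B \<in> Hom D A B" using g.one_closed by (simp add: homgrp_def)
  then show "zr A B \<in> Arr D" "Dom D (zr A B) = A" "Cod D (zr A B) = B"
    by (auto simp: in_Hom)
qed

lemma add_typing:
  assumes "f \<in> Arr D" "g \<in> Arr D" "Dom D f = Dom D g" "Cod D f = Cod D g"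
  shows "f \<boxplus> g \<in> Arr D" "Dom D (f \<boxplus> g) = Dom D g" "Cod D (f \<boxplus> g) = Cod D g"
proof -
  interpret g: comm_group "homgrp D (Dom D f) (Cod D f)" 
    using hom_comm_group assms dom_obj cod_obj by blast
  have "f \<boxplus> g \<in> Hom D (Dom D f) (Cod D f)"
    using g.m_closed[of f g] assms by (simp add: homgrp_def in_Hom)
  then show "f \<boxplus> g \<in> Arr D" "Dom D (f \<boxplus> g) = Dom D g" "Cod D (f \<boxplus> g) = Cod D g"
    using assms by (auto simp: in_Hom)
qed

lemma neg_typing:
  assumes "f \<in> Arr D"
  shows "\<boxminus> f \<in> Arr D" "Dom D (\<boxminus> f) = Dom D f" "Cod D (\<boxminus> f) = Cod D f"
proof -
  interpret g: comm_group "homgrp D (Dom D f) (Cod D f)" 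
    using hom_comm_group assms dom_obj cod_obj by blast
  have "\<boxminus> f \<in> Hom D (Dom D f) (Cod D f)"
    using g.inv_closed[of f] assms by (simp add: homgrp_def in_Hom neg_arr_def)
  then show "\<boxminus> f \<in> Arr D" "Dom D (\<boxminus> f) = Dom D f" "Cod D (\<boxminus> f) = Cod D f"
    by (auto simp: in_Hom)
qed

lemma add_assoc:
  assumes "f \<in> Arr D" "g \<in> Arr D" "h \<in> Arr D" "Dom D f = Dom D g" "Dom D g = Dom D h"
    "Cod D f = Cod D g" "Cod D g = Cod D h"
  shows "f \<boxplus> g \<boxplus> h = f \<boxplus> (g \<boxplus> h)"
proof -
  interpret g: comm_group "homgrp D (Dom D f) (Cod D f)" 
    using hom_comm_group assms dom_obj cod_obj by blast
  show ?thesis using g.m_assoc[of f g h] assms by (simp add: homgrp_def in_Hom)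
qed

lemma add_commute:
  assumes "f \<in> Arr D" "g \<in> Arr D" "Dom D f = Dom D g" "Cod D f = Cod D g"
  shows "f \<boxplus> g = g \<boxplus> f"
proof -
  interpret g: comm_group "homgrp D (Dom D f) (Cod D f)" 
    using hom_comm_group assms dom_obj cod_obj by blast
  show ?thesis using g.m_comm[of f g] assms by (simp add: homgrp_def in_Hom)
qed

lemma add_left_commute:
  assumes "f \<in> Arr D" "g \<in> Arr D" "h \<in> Arr D" "Dom D f = Dom D g" "Dom D g = Dom D h"
    "Cod D f = Cod D g" "Cod D g = Cod D h"
  shows "f \<boxplus> (g \<boxplus> h) = g \<boxplus> (f \<boxplus> h)"
  using add_assoc[of f g h] add_assoc[of g f h] add_commute[of f g] assms by simp

lemma add_zero:
  assumes "f \<in> Arr D" "Dom D f = A" "Cod D f = B"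
  shows "f \<boxplus> zr A B = f" "zr A B \<boxplus> f = f"
proof -
  interpret g: comm_group "homgrp D A B" 
    using hom_comm_group assms dom_obj cod_obj by blast
  show "f \<boxplus> zr A B = f" "zr A B \<boxplus> f = f"
    using g.r_one[of f] g.l_one[of f] assms by (simp_all add: homgrp_def in_Hom)
qed

lemma add_neg:
  assumes "f \<in> Arr D"
  shows "f \<boxplus> \<boxminus> f = zr (Dom D f) (Cod D f)" "\<boxminus> f \<boxplus> f = zr (Dom D f) (Cod D f)"
proof -
  interpret g: comm_group "homgrp D (Dom D f) (Cod D f)" 
    using hom_comm_group assms dom_obj cod_obj by blast
  show "f \<boxplus> \<boxminus> f = zr (Dom D f) (Cod D f)" "\<boxminus> f \<boxplus> f = zr (Dom D f) (Cod D f)"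
    using g.r_inv[of f] g.l_inv[of f] assms
    by (simp_all add: homgrp_def in_Hom neg_arr_def)
qed

lemma add_neg_cancel:
  assumes "f \<in> Arr D" "g \<in> Arr D" "Dom D f = Dom D g" "Cod D f = Cod D g"
  shows "f \<boxplus> (\<boxminus> f \<boxplus> g) = g" "\<boxminus> f \<boxplus> (f \<boxplus> g) = g"
  using add_assoc[of f "\<boxminus> f" g] add_assoc[of "\<boxminus> f" f g] assms
  by (simp_all add: add_neg add_zero neg_typing)

lemma neg_unique:
  assumes "f \<in> Arr D" "g \<in> Arr D" "Dom D f = Dom D g" "Cod D f = Cod D g"
    "f \<boxplus> g = zr (Dom D f) (Cod D f)"
  shows "g = \<boxminus> f"
  using add_neg_cancel(2)[of f g] assms by (simp add: neg_typing add_zero)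

lemma neg_neg: "f \<in> Arr D \<Longrightarrow> \<boxminus> (\<boxminus> f) = f"
  using neg_unique[of "\<boxminus> f" f] by (simp add: neg_typing add_neg)

lemma neg_zero: "\<lbrakk>A \<in> Obj D; B \<in> Obj D\<rbrakk> \<Longrightarrow> \<boxminus> (zr A B) = zr A B"
  using neg_unique[of "zr A B" "zr A B"] by (simp add: zero_typing add_zero)

lemma neg_add:
  assumes "f \<in> Arr D" "g \<in> Arr D" "Dom D f = Dom D g" "Cod D f = Cod D g"
  shows "\<boxminus> (f \<boxplus> g) = \<boxminus> f \<boxplus> \<boxminus> g"
proof (rule neg_unique[symmetric], goal_cases)
  case 5
  have "f \<boxplus> g \<boxplus> (\<boxminus> f \<boxplus> \<boxminus> g) = f \<boxplus> (g \<boxplus> (\<boxminus> g \<boxplus> \<boxminus> f))"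
    using assms by (simp add: add_assoc add_typing neg_typing add_commute[of "\<boxminus> f"])
  then show ?case using assms by (simp add: add_neg_cancel add_typing neg_typing add_neg)
qed (use assms in \<open>simp_all add: add_typing neg_typing\<close>)

lemma comp_add:
  assumes "f \<in> Arr D" "f' \<in> Arr D" "g \<in> Arr D" "Dom D f = Dom D f'" "Cod D f = Dom D g" "Cod D f' = Dom D g"
  shows "g ** (f \<boxplus> f') = (g ** f) \<boxplus> (g ** f')"
  using comp_plus_right[of f "Dom D f" "Cod D f" f' g "Cod D g"] assms by (simp add: in_Hom)

lemma add_comp:
  assumes "f \<in> Arr D" "g' \<in> Arr D" "g \<in> Arr D" "Cod D g = Cod D g'" "Cod D f = Dom D g" "Cod D f = Dom D g'"
  shows "(g \<boxplus> g') ** f = (g ** f) \<boxplus> (g' ** f)"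
  using comp_plus_left[of f "Dom D f" "Cod D f" g "Cod D g" g'] assms by (simp add: in_Hom)

lemma comp_zero:
  assumes "g \<in> Arr D" "Dom D g = B" "A \<in> Obj D"
  shows "g ** zr A B = zr A (Cod D g)"
proof -
  have B: "B \<in> Obj D" using assms dom_obj by blast
  let ?z = "g ** zr A B"
  have t: "?z \<in> Arr D" "Dom D ?z = A" "Cod D ?z = Cod D g"
    using assms B by (auto simp: comp_typing zero_typing)
  have "?z \<boxplus> ?z = ?z"
    using comp_add[of "zr A B" "zr A B" g] assms B by (simp add: zero_typing add_zero)
  then show ?thesis
    using add_neg_cancel(2)[of ?z ?z] t by (simp add: add_neg)
qed

lemma zero_comp:
  assumes "f \<in> Arr D" "Cod D f = B" "C \<in> Obj D"
  shows "zr B C ** f = zr (Dom D f) C"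
proof -
  have B: "B \<in> Obj D" using assms cod_obj by blast
  let ?z = "zr B C ** f"
  have t: "?z \<in> Arr D" "Dom D ?z = Dom D f" "Cod D ?z = C"
    using assms B by (auto simp: comp_typing zero_typing)
  have "?z \<boxplus> ?z = ?z"
    using add_comp[of f "zr B C" "zr B C"] assms B by (simp add: zero_typing add_zero)
  then show ?thesis
    using add_neg_cancel(2)[of ?z ?z] t by (simp add: add_neg)
qed

lemma comp_neg:
  assumes "f \<in> Arr D" "g \<in> Arr D" "Cod D f = Dom D g"
  shows "g ** \<boxminus> f = \<boxminus> (g ** f)"
  using neg_unique[of "g ** f" "g ** \<boxminus> f"] comp_add[of f "\<boxminus> f" g] assms
  by (simp add: comp_typing neg_typing add_neg comp_zero dom_obj)

lemma neg_comp:
  assumes "f \<in> Arr D" "g \<in> Arr D" "Cod D f = Dom D g"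
  shows "\<boxminus> g ** f = \<boxminus> (g ** f)"
  using neg_unique[of "g ** f" "\<boxminus> g ** f"] add_comp[of f "\<boxminus> g" g] assms
  by (simp add: comp_typing neg_typing add_neg zero_comp cod_obj)

lemmas cat_simps = category_simps zero_typing add_typing neg_typing add_assoc add_zero add_neg
  add_neg_cancel neg_neg neg_zero neg_add comp_add add_comp comp_zero zero_comp comp_neg neg_comp

lemma minus_eq_iff:
  assumes "f \<in> Hom D A B" "g \<in> Hom D A B" "h \<in> Hom D A B"
  shows "f \<boxplus> \<boxminus> g = h \<longleftrightarrow> f = h \<boxplus> g"
proof
  assume "f \<boxplus> \<boxminus> g = h"
  moreover have "f \<boxplus> \<boxminus> g \<boxplus> g = f"
    using assms by (simp add: in_Hom add_assoc neg_typing add_neg add_zero)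
  ultimately show "f = h \<boxplus> g" by simp
next
  assume "f = h \<boxplus> g"
  then show "f \<boxplus> \<boxminus> g = h"
    using assms by (simp add: in_Hom add_assoc neg_typing add_neg add_zero)
qed

lemma minus_eq_zero_iff:
  assumes "f \<in> Hom D A B" "g \<in> Hom D A B"
  shows "f \<boxplus> \<boxminus> g = zr A B \<longleftrightarrow> f = g"
proof -
  have "zr A B \<in> Hom D A B" using Hom_obj[OF assms(1)] by (simp add: in_Hom zero_typing)
  then show ?thesis using minus_eq_iff[of f A B g "zr A B"] assms
    by (simp add: in_Hom add_zero)
qed

lemma monic_zero:
  assumes "monic D m" "m \<in> Hom D A B" "f \<in> Hom D Z A" "m ** f = zr Z B"
  shows "f = zr Z A"
proof -
  have o: "A \<in> Obj D" "B \<in> Obj D" "Z \<in> Obj D" using Hom_obj assms by blast+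
  have "m ** f = m ** zr Z A" using assms o by (simp add: in_Hom comp_zero)
  then show ?thesis using assms o unfolding monic_def
    by (simp add: in_Hom zero_typing)
qed

lemma epic_zero:
  assumes "epic D m" "m \<in> Hom D A B" "f \<in> Hom D B Z" "f ** m = zr A Z"
  shows "f = zr B Z"
proof -
  have o: "A \<in> Obj D" "B \<in> Obj D" "Z \<in> Obj D" using Hom_obj assms by blast+
  have "f ** m = zr B Z ** m" using assms o by (simp add: in_Hom zero_comp)
  then show ?thesis using assms o unfolding epic_def
    by (simp add: in_Hom zero_typing)
qed

end

section \<open>Comparison of complexes\<close>

lemma map_cpx_id:
  assumes "X \<in> cpxs D (Suc n)"
  shows "map_cpx n id id X = X"
  using assms by (cases X) (simp add: map_cpx_def mk_cpx_def cpxs_def extensional_restrict)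

text \<open>
  Exactness in the middle degrees, said directly of arrows: consecutive differentials are weak
  kernels, respectively weak cokernels, of one another. These properties are what comparison
  arguments between complexes consume; only at the two ends is uniqueness (a monic first or an
  epic last differential) needed in addition.
\<close>

definition weak_kernel_cpx :: "('o, 'm) addcat \<Rightarrow> nat \<Rightarrow> ('o, 'm) cpx \<Rightarrow> bool" where
  "weak_kernel_cpx D n X \<longleftrightarrow> (\<forall>i<n. \<forall>Z. \<forall>g \<in> Hom D Z (ob X (Suc i)).
     df X (Suc i) \<cdot>\<^bsub>D\<^esub> g = zero_arr D Z (ob X (Suc (Suc i))) \<longrightarrow>
     (\<exists>k \<in> Hom D Z (ob X i). g = df X i \<cdot>\<^bsub>D\<^esub> k))"

definition weak_cokernel_cpx :: "('o, 'm) addcat \<Rightarrow> nat \<Rightarrow> ('o, 'm) cpx \<Rightarrow> bool" where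
  "weak_cokernel_cpx D n X \<longleftrightarrow> (\<forall>i<n. \<forall>Z. \<forall>g \<in> Hom D (ob X (Suc i)) Z.
     g \<cdot>\<^bsub>D\<^esub> df X i = zero_arr D (ob X i) Z \<longrightarrow>
     (\<exists>k \<in> Hom D (ob X (Suc (Suc i))) Z. g = k \<cdot>\<^bsub>D\<^esub> df X (Suc i)))"

lemma weak_kernelE:
  assumes "weak_kernel_cpx D n X" "i < n" "g \<in> Hom D Z (ob X (Suc i))"
    "df X (Suc i) \<cdot>\<^bsub>D\<^esub> g = zero_arr D Z (ob X (Suc (Suc i)))"
  obtains k where "k \<in> Hom D Z (ob X i)" "g = df X i \<cdot>\<^bsub>D\<^esub> k"
  using assms unfolding weak_kernel_cpx_def by blast

lemma weak_cokernelE: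
  assumes "weak_cokernel_cpx D n X" "i < n" "g \<in> Hom D (ob X (Suc i)) Z"
    "g \<cdot>\<^bsub>D\<^esub> df X i = zero_arr D (ob X i) Z"
  obtains k where "k \<in> Hom D (ob X (Suc (Suc i))) Z" "g = k \<cdot>\<^bsub>D\<^esub> df X (Suc i)"
  using assms unfolding weak_cokernel_cpx_def by blast

context preadditive_category
begin

lemma zero_hom: "\<lbrakk>A \<in> Obj D; B \<in> Obj D\<rbrakk> \<Longrightarrow> zr A B \<in> Hom D A B"
  by (simp add: in_Hom zero_typing)

lemma add_hom: "\<lbrakk>f \<in> Hom D A B; g \<in> Hom D A B\<rbrakk> \<Longrightarrow> f \<boxplus> g \<in> Hom D A B"
  by (simp add: in_Hom add_typing)

lemma neg_hom: "f \<in> Hom D A B \<Longrightarrow> \<boxminus> f \<in> Hom D A B"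
  by (simp add: in_Hom neg_typing)

lemma monicD:
  assumes "monic D m" "m \<in> Hom D A B" "f \<in> Hom D Z A" "g \<in> Hom D Z A" "m ** f = m ** g"
  shows "f = g"
  using assms Hom_obj(1)[OF assms(3)] unfolding monic_def by (simp add: in_Hom)

lemma epicD:
  assumes "epic D m" "m \<in> Hom D A B" "f \<in> Hom D B Z" "g \<in> Hom D B Z" "f ** m = g ** m"
  shows "f = g"
  using assms Hom_obj(2)[OF assms(3)] unfolding epic_def by (simp add: in_Hom)

lemma cpx_ob: "\<lbrakk>X \<in> cpxs D m; i \<le> m\<rbrakk> \<Longrightarrow> ob X i \<in> Obj D"
  by (simp add: cpxs_def)

lemma cpx_df: "\<lbrakk>X \<in> cpxs D m; i < m\<rbrakk> \<Longrightarrow> df X i \<in> Hom D (ob X i) (ob X (Suc i))"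
  by (simp add: cpxs_def)

lemma cpx_df_typing:
  "\<lbrakk>X \<in> cpxs D m; i < m\<rbrakk> \<Longrightarrow> df X i \<in> Arr D"
  "\<lbrakk>X \<in> cpxs D m; i < m\<rbrakk> \<Longrightarrow> Dom D (df X i) = ob X i"
  "\<lbrakk>X \<in> cpxs D m; i < m\<rbrakk> \<Longrightarrow> Cod D (df X i) = ob X (Suc i)"
  by (simp_all add: cpxs_def in_Hom)

lemma cpx_df_df:
  "\<lbrakk>X \<in> cpxs D m; Suc i < m\<rbrakk> \<Longrightarrow> df X (Suc i) ** df X i = zr (ob X i) (ob X (Suc (Suc i)))"
  by (simp add: cpxs_def)

lemma cpx_df_df_comp:
  assumes "X \<in> cpxs D m" "Suc i < m" "g \<in> Arr D" "Cod D g = ob X i"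
  shows "df X (Suc i) ** (df X i ** g) = zr (Dom D g) (ob X (Suc (Suc i)))"
proof -
  have "df X (Suc i) ** (df X i ** g) = df X (Suc i) ** df X i ** g"
    using assms by (simp add: category_simps cpx_df_typing)
  then show ?thesis using assms by (simp add: cpx_df_df cat_simps cpx_ob)
qed

lemma chain_map_hom: "\<lbrakk>chain_map D m X Y f; i \<le> m\<rbrakk> \<Longrightarrow> f i \<in> Hom D (ob X i) (ob Y i)"
  by (simp add: chain_map_def)

lemma chain_map_typing:
  "\<lbrakk>chain_map D m X Y f; i \<le> m\<rbrakk> \<Longrightarrow> f i \<in> Arr D"
  "\<lbrakk>chain_map D m X Y f; i \<le> m\<rbrakk> \<Longrightarrow> Dom D (f i) = ob X i"
  "\<lbrakk>chain_map D m X Y f; i \<le> m\<rbrakk> \<Longrightarrow> Cod D (f i) = ob Y i"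
  by (simp_all add: chain_map_def in_Hom)

lemma chain_map_comm: "\<lbrakk>chain_map D m X Y f; i < m\<rbrakk> \<Longrightarrow> df Y i ** f i = f (Suc i) ** df X i"
  by (simp add: chain_map_def)

lemma chain_map_comp:
  assumes X: "X \<in> cpxs D m" and Y: "Y \<in> cpxs D m" and Z: "Z \<in> cpxs D m"
    and f: "chain_map D m X Y f" and g: "chain_map D m Y Z g"
  shows "chain_map D m X Z (\<lambda>i. g i ** f i)"
  unfolding chain_map_def
proof (intro conjI allI impI)
  fix i assume "i \<le> m"
  then show "g i ** f i \<in> Hom D (ob X i) (ob Z i)"
    using comp_hom chain_map_hom f g by blast
next
  fix i assume i: "i < m"
  have "df Z i ** (g i ** f i) = g (Suc i) ** (df Y i ** f i)"
    using comp_assoc[of "f i" _ _ "g i" _ "df Z i"] comp_assoc[of "f i" _ _ "df Y i" _ "g (Suc i)"] i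
      chain_map_hom[OF f, of i] chain_map_hom[OF g, of i] chain_map_hom[OF g, of "Suc i"]
      cpx_df[OF Y i] cpx_df[OF Z i] chain_map_comm[OF g i] by force
  also have "\<dots> = g (Suc i) ** f (Suc i) ** df X i"
    using comp_assoc[of "df X i" _ _ "f (Suc i)" _ "g (Suc i)"] i
      chain_map_hom[OF f, of "Suc i"] chain_map_hom[OF g, of "Suc i"]
      cpx_df[OF X i] chain_map_comm[OF f i] by force
  finally show "df Z i ** (g i ** f i) = g (Suc i) ** f (Suc i) ** df X i" .
qed

lemma chain_map_add:
  assumes "X \<in> cpxs D m" "Y \<in> cpxs D m" "chain_map D m X Y f" "chain_map D m X Y g"
  shows "chain_map D m X Y (\<lambda>i. f i \<boxplus> g i)"
  unfolding chain_map_def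
proof (intro conjI allI impI)
  fix i assume "i \<le> m"
  then show "f i \<boxplus> g i \<in> Hom D (ob X i) (ob Y i)"
    using add_hom chain_map_hom assms by blast
next
  fix i assume i: "i < m"
  then show "df Y i ** (f i \<boxplus> g i) = (f (Suc i) \<boxplus> g (Suc i)) ** df X i"
    using assms chain_map_comm[OF assms(3) i] chain_map_comm[OF assms(4) i]
    by (simp add: comp_add add_comp chain_map_typing cpx_df_typing)
qed

lemma chain_map_neg:
  assumes "X \<in> cpxs D m" "Y \<in> cpxs D m" "chain_map D m X Y f"
  shows "chain_map D m X Y (\<lambda>i. \<boxminus> f i)"
  unfolding chain_map_def
proof (intro conjI allI impI)
  fix i assume "i \<le> m"
  then show "\<boxminus> f i \<in> Hom D (ob X i) (ob Y i)"
    using neg_hom chain_map_hom assms by blast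
next
  fix i assume i: "i < m"
  then show "df Y i ** \<boxminus> f i = \<boxminus> f (Suc i) ** df X i"
    using assms chain_map_comm[OF assms(3) i] 
    by (simp add: comp_neg neg_comp chain_map_typing cpx_df_typing)
qed

lemma chain_map_diff:
  assumes "X \<in> cpxs D m" "Y \<in> cpxs D m" "chain_map D m X Y f" "chain_map D m X Y g"
  shows "chain_map D m X Y (\<lambda>i. f i \<boxplus> \<boxminus> g i)"
  by (rule chain_map_add[OF assms(1-3) chain_map_neg[OF assms(1,2,4)]])

lemma chain_map_idn:
  assumes "X \<in> cpxs D m"
  shows "chain_map D m X X (\<lambda>i. idn D (ob X i))"
  using assms by (simp add: chain_map_def category_simps cpx_df_typing cpx_ob)

text \<open>
  The comparison argument: a commutative square in degrees \<open>k\<close>, \<open>k + 1\<close> is extended one degree at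
  a time to the left. The component in degree \<open>k\<close>, precomposed with the differential, is killed by
  the next differential and hence factors through the weak kernel.
\<close>

lemma lift_down:
  assumes Y: "Y \<in> cpxs D (Suc n)" and X: "X \<in> cpxs D (Suc n)" and ex: "weak_kernel_cpx D n X"
  shows "\<lbrakk>k \<le> n; g \<in> Hom D (ob Y k) (ob X k); u \<in> Hom D (ob Y (Suc k)) (ob X (Suc k));
      df X k ** g = u ** df Y k\<rbrakk> \<Longrightarrow>
    \<exists>F. (\<forall>i \<le> k. F i \<in> Hom D (ob Y i) (ob X i)) \<and>
        (\<forall>i < k. df X i ** F i = F (Suc i) ** df Y i) \<and> F k = g"
proof (induction k arbitrary: g u)
  case 0
  then show ?case by (intro exI[of _ "\<lambda>_. g"]) simp
next
  case (Suc k)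
  have "df X (Suc k) ** (g ** df Y k) = df X (Suc k) ** g ** df Y k"
    using Suc.prems(1,2) X Y by (simp add: category_simps cpx_df_typing)
  also have "\<dots> = zr (ob Y k) (ob X (Suc (Suc k)))"
    using Suc.prems X Y by (simp add: cat_simps cpx_df_typing cpx_df_df cpx_ob)
  finally have zero: "df X (Suc k) ** (g ** df Y k) = zr (ob Y k) (ob X (Suc (Suc k)))" .
  have "g ** df Y k \<in> Hom D (ob Y k) (ob X (Suc k))"
    using comp_hom[OF cpx_df[OF Y, of k] Suc.prems(2)] Suc.prems(1) by simp
  then obtain g' where g': "g' \<in> Hom D (ob Y k) (ob X k)" "g ** df Y k = df X k ** g'"
    using weak_kernelE[OF ex _ _ zero] Suc.prems(1) by auto
  then obtain F where F: "\<forall>i \<le> k. F i \<in> Hom D (ob Y i) (ob X i)"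
      "\<forall>i < k. df X i ** F i = F (Suc i) ** df Y i" "F k = g'"
    using Suc.IH[of g' g] Suc.prems by auto
  then show ?case using g' Suc.prems
    by (intro exI[of _ "F(Suc k := g)"]) (auto simp: le_Suc_eq less_Suc_eq)
qed

lemma lift_up:
  assumes Y: "Y \<in> cpxs D (Suc n)" and X: "X \<in> cpxs D (Suc n)" and ex: "weak_cokernel_cpx D n Y"
  shows "\<lbrakk>k + j = n; g \<in> Hom D (ob Y (Suc k)) (ob X (Suc k)); u \<in> Hom D (ob Y k) (ob X k);
      df X k ** u = g ** df Y k\<rbrakk> \<Longrightarrow>
    \<exists>F. (\<forall>i. k < i \<and> i \<le> Suc n \<longrightarrow> F i \<in> Hom D (ob Y i) (ob X i)) \<and>
        (\<forall>i. k < i \<and> i \<le> n \<longrightarrow> df X i ** F i = F (Suc i) ** df Y i) \<and> F (Suc k) = g"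
proof (induction j arbitrary: k g u)
  case 0
  show ?case
  proof (intro exI[of _ "\<lambda>_. g"] conjI allI impI)
    fix i assume "k < i \<and> i \<le> Suc n"
    then have "i = Suc k" using 0(1) by simp
    then show "g \<in> Hom D (ob Y i) (ob X i)" using 0(2) by simp
  next
    fix i assume "k < i \<and> i \<le> n"
    then have False using 0(1) by simp
    then show "df X i ** g = g ** df Y i" ..
  qed simp
next
  case (Suc j)
  have k: "Suc k \<le> n" using Suc.prems by simp
  have "df X (Suc k) ** g ** df Y k = df X (Suc k) ** (g ** df Y k)"
    using Suc.prems(2) k X Y by (simp add: category_simps cpx_df_typing)
  also have "\<dots> = df X (Suc k) ** (df X k ** u)" using Suc.prems by simp
  also have "\<dots> = zr (ob Y k) (ob X (Suc (Suc k)))"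
    using Suc.prems(3) k X Y by (simp add: in_Hom cpx_df_df_comp)
  finally have zero: "df X (Suc k) ** g ** df Y k = zr (ob Y k) (ob X (Suc (Suc k)))" .
  have "df X (Suc k) ** g \<in> Hom D (ob Y (Suc k)) (ob X (Suc (Suc k)))"
    using comp_hom[OF Suc.prems(2) cpx_df[OF X, of "Suc k"]] k by simp
  then obtain g' where g': "g' \<in> Hom D (ob Y (Suc (Suc k))) (ob X (Suc (Suc k)))"
      "df X (Suc k) ** g = g' ** df Y (Suc k)"
    using weak_cokernelE[OF ex _ _ zero] k by auto
  then obtain F where F: "\<forall>i. Suc k < i \<and> i \<le> Suc n \<longrightarrow> F i \<in> Hom D (ob Y i) (ob X i)"
      "\<forall>i. Suc k < i \<and> i \<le> n \<longrightarrow> df X i ** F i = F (Suc i) ** df Y i" "F (Suc (Suc k)) = g'"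
    using Suc.IH[of "Suc k" g' g] Suc.prems by auto
  show ?case
  proof (intro exI[of _ "F(Suc k := g)"] conjI allI impI)
    fix i assume i: "k < i \<and> i \<le> Suc n"
    show "(F(Suc k := g)) i \<in> Hom D (ob Y i) (ob X i)"
      using F Suc.prems i by (cases "i = Suc k") auto
  next
    fix i assume i: "k < i \<and> i \<le> n"
    show "df X i ** (F(Suc k := g)) i = (F(Suc k := g)) (Suc i) ** df Y i"
      using F g' i by (cases "i = Suc k") auto
  qed simp
qed

text \<open>
  The same comparison argument one level up. In each degree, the chain map minus the part of the
  homotopy found so far is killed by the differential of the target, and factoring it through the
  weak kernel gives the next homotopy component. In degree 0 there is nothing left to factor
  through, and the monic differential forces equality.
\<close>

lemma null_homotopy_down:
  assumes X: "X \<in> cpxs D (Suc n)" and Y: "Y \<in> cpxs D (Suc n)"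
    and ex: "weak_kernel_cpx D n Y" and mono: "monic D (df Y 0)"
    and e: "chain_map D (Suc n) X Y e"
  shows "\<lbrakk>k \<le> n; t \<in> Hom D (ob X (Suc k)) (ob Y k);
      df Y k ** e k = df Y k ** (t ** df X k)\<rbrakk> \<Longrightarrow>
    \<exists>h. (\<forall>i \<le> k. h i \<in> Hom D (ob X (Suc i)) (ob Y i)) \<and> h k = t \<and> e 0 = h 0 ** df X 0 \<and>
        (\<forall>i < k. e (Suc i) = (df Y i ** h i) \<boxplus> (h (Suc i) ** df X (Suc i)))"
proof (induction k arbitrary: t)
  case 0
  have "t ** df X 0 \<in> Hom D (ob X 0) (ob Y 0)" using comp_hom[OF cpx_df[OF X] 0(2)] by simp
  moreover have "e 0 \<in> Hom D (ob X 0) (ob Y 0)" using chain_map_hom[OF e] by blast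
  ultimately have "e 0 = t ** df X 0"
    using monicD[OF mono cpx_df[OF Y]] 0 by blast
  then show ?case using 0 by (intro exI[of _ "\<lambda>_. t"]) simp
next
  case (Suc k)
  let ?r = "e (Suc k) \<boxplus> \<boxminus> (t ** df X (Suc k))"
  have th: "t ** df X (Suc k) \<in> Hom D (ob X (Suc k)) (ob Y (Suc k))"
    using comp_hom[OF cpx_df[OF X, of "Suc k"] Suc.prems(2)] Suc.prems(1) by simp
  have eh: "e (Suc k) \<in> Hom D (ob X (Suc k)) (ob Y (Suc k))"
    using chain_map_hom[OF e] Suc.prems by simp
  have rh: "?r \<in> Hom D (ob X (Suc k)) (ob Y (Suc k))" using add_hom[OF eh neg_hom[OF th]] .
  have dy: "df Y (Suc k) \<in> Hom D (ob Y (Suc k)) (ob Y (Suc (Suc k)))"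
    using cpx_df[OF Y] Suc.prems by simp
  have "df Y (Suc k) ** ?r = zr (ob X (Suc k)) (ob Y (Suc (Suc k)))"
    using Suc.prems(3) th eh dy by (simp add: comp_add comp_neg in_Hom neg_typing add_neg comp_typing)
  then obtain s where s: "s \<in> Hom D (ob X (Suc k)) (ob Y k)" "?r = df Y k ** s"
    using weak_kernelE[OF ex _ rh] Suc.prems(1) by auto
  have dx: "df X k \<in> Hom D (ob X k) (ob X (Suc k))" using cpx_df[OF X] Suc.prems by simp
  have eq: "e (Suc k) = (df Y k ** s) \<boxplus> (t ** df X (Suc k))"
    using s minus_eq_iff[OF eh th, of "df Y k ** s"] rh by simp
  have "df Y k ** (s ** df X k) = df Y k ** s ** df X k"
    using s dx Suc.prems Y by (simp add: category_simps cpx_df_typing)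
  also have "\<dots> = ?r ** df X k" using s by simp
  also have "\<dots> = e (Suc k) ** df X k \<boxplus> \<boxminus> (t ** df X (Suc k) ** df X k)"
    using dx th eh by (simp add: add_comp neg_comp in_Hom neg_typing)
  also have "t ** df X (Suc k) ** df X k = zr (ob X k) (ob Y (Suc k))"
    using Suc.prems X by (simp add: category_simps cpx_df_typing cpx_df_df comp_zero cpx_ob)
  also have "e (Suc k) ** df X k \<boxplus> \<boxminus> zr (ob X k) (ob Y (Suc k)) = df Y k ** e k"
    using Suc.prems X Y dx eh chain_map_comm[OF e, of k]
    by (simp add: neg_zero cpx_ob add_zero in_Hom comp_typing)
  finally obtain h where h: "\<forall>i \<le> k. h i \<in> Hom D (ob X (Suc i)) (ob Y i)" "h k = s" "e 0 = h 0 ** df X 0"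
        "\<forall>i < k. e (Suc i) = (df Y i ** h i) \<boxplus> (h (Suc i) ** df X (Suc i))"
    using Suc.IH[OF _ s(1)] Suc.prems by auto
  show ?case
    using h Suc.prems eq by (intro exI[of _ "h(Suc k := t)"]) (auto simp: le_Suc_eq less_Suc_eq)
qed

text \<open>
  The dual statement. Of the homotopy only its last component is recorded, since this is all that
  the later arguments use.
\<close>

lemma null_homotopy_up:
  assumes X: "X \<in> cpxs D (Suc n)" and Y: "Y \<in> cpxs D (Suc n)"
    and ex: "weak_cokernel_cpx D n X" and epi: "epic D (df X n)"
    and e: "chain_map D (Suc n) X Y e"
  shows "\<lbrakk>k + j = n; t \<in> Hom D (ob X (Suc k)) (ob Y k);
      e (Suc k) ** df X k = df Y k ** t ** df X k\<rbrakk> \<Longrightarrow>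
    \<exists>s \<in> Hom D (ob X (Suc n)) (ob Y n). e (Suc n) = df Y n ** s"
proof (induction j arbitrary: k t)
  case 0
  then have k: "k = n" by simp
  have "df Y n ** t \<in> Hom D (ob X (Suc n)) (ob Y (Suc n))"
    using comp_hom[OF _ cpx_df[OF Y, of n]] 0 k by simp
  moreover have "e (Suc n) ** df X n = df Y n ** t ** df X n" using 0(3) k by simp
  ultimately have "e (Suc n) = df Y n ** t"
    by (rule epicD[OF epi cpx_df[OF X lessI] chain_map_hom[OF e order_refl]])
  then show ?case using 0(2) k by (intro bexI[of _ t]) simp_all
next
  case (Suc j)
  have k: "Suc k \<le> n" using Suc.prems by simp
  let ?r = "e (Suc k) \<boxplus> \<boxminus> (df Y k ** t)"
  have th: "df Y k ** t \<in> Hom D (ob X (Suc k)) (ob Y (Suc k))"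
    using comp_hom[OF Suc.prems(2)] cpx_df[OF Y, of k] k by simp
  have eh: "e (Suc k) \<in> Hom D (ob X (Suc k)) (ob Y (Suc k))"
    using chain_map_hom[OF e] k by simp
  have rh: "?r \<in> Hom D (ob X (Suc k)) (ob Y (Suc k))" using add_hom[OF eh neg_hom[OF th]] .
  have dx: "df X k \<in> Hom D (ob X k) (ob X (Suc k))"
    using cpx_df[OF X] k by simp
  have "?r ** df X k = zr (ob X k) (ob Y (Suc k))"
    using Suc.prems(3) th eh dx by (simp add: add_comp neg_comp in_Hom neg_typing add_neg comp_typing)
  then obtain s where s: "s \<in> Hom D (ob X (Suc (Suc k))) (ob Y (Suc k))" "?r = s ** df X (Suc k)"
    using weak_cokernelE[OF ex _ rh] k by auto
  have dy: "df Y (Suc k) \<in> Hom D (ob Y (Suc k)) (ob Y (Suc (Suc k)))" using cpx_df[OF Y] k by simp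
  have dd: "df Y (Suc k) ** (df Y k ** t) = zr (ob X (Suc k)) (ob Y (Suc (Suc k)))"
    using Suc.prems(2) k Y by (simp add: in_Hom cpx_df_df_comp)
  have "df Y (Suc k) ** s ** df X (Suc k) = df Y (Suc k) ** (s ** df X (Suc k))"
    using s dy k X by (simp add: category_simps cpx_df_typing)
  also have "\<dots> = df Y (Suc k) ** ?r" using s by simp
  also have "\<dots> = df Y (Suc k) ** e (Suc k) \<boxplus> \<boxminus> (df Y (Suc k) ** (df Y k ** t))"
    using dy th eh by (simp add: comp_add comp_neg in_Hom neg_typing)
  also have "\<dots> = df Y (Suc k) ** e (Suc k)"
    unfolding dd using k X Y dy eh
    by (simp add: neg_zero cpx_ob add_zero in_Hom comp_typing)
  also have "\<dots> = e (Suc (Suc k)) ** df X (Suc k)" using chain_map_comm[OF e] k by simp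
  finally have "e (Suc (Suc k)) ** df X (Suc k) = df Y (Suc k) ** s ** df X (Suc k)" by simp
  from Suc.IH[OF _ s(1) this] show ?case using Suc.prems(1) by simp
qed

lemma co_exact_Suc_iff:
  assumes X: "X \<in> cpxs D (Suc n)" and i: "i < n" and Z: "Z \<in> Obj D"
  shows "co_exact_Suc D X Z i \<longleftrightarrow> (\<forall>g \<in> Hom D Z (ob X (Suc i)).
     df X (Suc i) ** g = zr Z (ob X (Suc (Suc i))) \<longrightarrow> (\<exists>k \<in> Hom D Z (ob X i). g = df X i ** k))"
    (is "?l \<longleftrightarrow> ?r")
proof -
  have "?l \<longleftrightarrow> (\<lambda>g. df X i ** g) ` Hom D Z (ob X i) =
      {g \<in> Hom D Z (ob X (Suc i)). df X (Suc i) ** g = zr Z (ob X (Suc (Suc i)))}"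
    by (simp add: co_exact_Suc_def exact_at_def kernel_def homgrp_def)
  moreover have "(\<lambda>g. df X i ** g) ` Hom D Z (ob X i) \<subseteq>
      {g \<in> Hom D Z (ob X (Suc i)). df X (Suc i) ** g = zr Z (ob X (Suc (Suc i)))}"
    using comp_hom[OF _ cpx_df[OF X, of i]] cpx_df_df_comp[OF X, of i] i by (auto simp: in_Hom)
  ultimately show ?thesis by blast
qed

lemma contra_exact_Suc_iff:
  assumes X: "X \<in> cpxs D (Suc n)" and i: "i < n" and Z: "Z \<in> Obj D"
  shows "contra_exact_Suc D X Z i \<longleftrightarrow> (\<forall>g \<in> Hom D (ob X (Suc i)) Z.
     g ** df X i = zr (ob X i) Z \<longrightarrow> (\<exists>k \<in> Hom D (ob X (Suc (Suc i))) Z. g = k ** df X (Suc i)))"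
    (is "?l \<longleftrightarrow> ?r")
proof -
  have "?l \<longleftrightarrow> (\<lambda>g. g ** df X (Suc i)) ` Hom D (ob X (Suc (Suc i))) Z =
      {g \<in> Hom D (ob X (Suc i)) Z. g ** df X i = zr (ob X i) Z}"
    by (simp add: contra_exact_Suc_def exact_at_def kernel_def homgrp_def)
  moreover have "k ** df X (Suc i) ** df X i = zr (ob X i) Z"
    if "k \<in> Hom D (ob X (Suc (Suc i))) Z" for k
    using that X i Z by (simp add: category_simps cpx_df_typing cpx_df_df comp_zero cpx_ob)
  then have "(\<lambda>g. g ** df X (Suc i)) ` Hom D (ob X (Suc (Suc i))) Z \<subseteq>
      {g \<in> Hom D (ob X (Suc i)) Z. g ** df X i = zr (ob X i) Z}"
    using comp_hom[OF cpx_df[OF X, of "Suc i"]] i by auto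
  ultimately show ?thesis by blast
qed

lemma monic_iff_kernel:
  assumes m: "m \<in> Hom D A B"
  shows "monic D m \<longleftrightarrow> (\<forall>Z \<in> Obj D. kernel (homgrp D Z A) (homgrp D Z B) (\<lambda>g. m ** g) = {zr Z A})"
proof
  assume mono: "monic D m"
  show "\<forall>Z \<in> Obj D. kernel (homgrp D Z A) (homgrp D Z B) (\<lambda>g. m ** g) = {zr Z A}"
  proof
    fix Z assume Z: "Z \<in> Obj D"
    have "m ** zr Z A = zr Z B" "zr Z A \<in> Hom D Z A"
      using m Z Hom_obj[OF m] by (simp_all add: in_Hom comp_zero zero_typing)
    then have "{g \<in> Hom D Z A. m ** g = zr Z B} = {zr Z A}"
      using monic_zero[OF mono m] by blast
    then show "kernel (homgrp D Z A) (homgrp D Z B) (\<lambda>g. m ** g) = {zr Z A}"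
      by (simp add: kernel_def homgrp_def)
  qed
next
  assume k: "\<forall>Z \<in> Obj D. kernel (homgrp D Z A) (homgrp D Z B) (\<lambda>g. m ** g) = {zr Z A}"
  show "monic D m" unfolding monic_def
  proof (intro conjI ballI impI)
    show "m \<in> Arr D" using m by (simp add: in_Hom)
    fix Z g h assume Z: "Z \<in> Obj D" and g: "g \<in> Hom D Z (Dom D m)" and h: "h \<in> Hom D Z (Dom D m)"
      and eq: "m ** g = m ** h"
    have g: "g \<in> Hom D Z A" and h: "h \<in> Hom D Z A" using g h m by (simp_all add: in_Hom)
    have gh: "g \<boxplus> \<boxminus> h \<in> Hom D Z A" using add_hom[OF g neg_hom[OF h]] .
    have "m ** (g \<boxplus> \<boxminus> h) = zr Z B"
      using g h m eq by (simp add: in_Hom comp_add comp_neg neg_typing add_neg comp_typing)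
    then have "g \<boxplus> \<boxminus> h \<in> kernel (homgrp D Z A) (homgrp D Z B) (\<lambda>g. m ** g)"
      using gh by (simp add: kernel_def homgrp_def)
    then have "g \<boxplus> \<boxminus> h = zr Z A" using k Z by blast
    then show "g = h" using minus_eq_zero_iff[OF g h] by simp
  qed
qed

lemma epic_iff_kernel:
  assumes m: "m \<in> Hom D A B"
  shows "epic D m \<longleftrightarrow> (\<forall>Z \<in> Obj D. kernel (homgrp D B Z) (homgrp D A Z) (\<lambda>g. g ** m) = {zr B Z})"
proof
  assume epi: "epic D m"
  show "\<forall>Z \<in> Obj D. kernel (homgrp D B Z) (homgrp D A Z) (\<lambda>g. g ** m) = {zr B Z}"
  proof
    fix Z assume Z: "Z \<in> Obj D"
    have "zr B Z ** m = zr A Z" "zr B Z \<in> Hom D B Z"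
      using m Z Hom_obj[OF m] by (simp_all add: in_Hom zero_comp zero_typing)
    then have "{g \<in> Hom D B Z. g ** m = zr A Z} = {zr B Z}"
      using epic_zero[OF epi m] by blast
    then show "kernel (homgrp D B Z) (homgrp D A Z) (\<lambda>g. g ** m) = {zr B Z}"
      by (simp add: kernel_def homgrp_def)
  qed
next
  assume k: "\<forall>Z \<in> Obj D. kernel (homgrp D B Z) (homgrp D A Z) (\<lambda>g. g ** m) = {zr B Z}"
  show "epic D m" unfolding epic_def
  proof (intro conjI ballI impI)
    show "m \<in> Arr D" using m by (simp add: in_Hom)
    fix Z g h assume Z: "Z \<in> Obj D" and g: "g \<in> Hom D (Cod D m) Z" and h: "h \<in> Hom D (Cod D m) Z"
      and eq: "g ** m = h ** m"
    have g: "g \<in> Hom D B Z" and h: "h \<in> Hom D B Z" using g h m by (simp_all add: in_Hom)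
    have gh: "g \<boxplus> \<boxminus> h \<in> Hom D B Z" using add_hom[OF g neg_hom[OF h]] .
    have "(g \<boxplus> \<boxminus> h) ** m = zr A Z"
      using g h m eq by (simp add: in_Hom add_comp neg_comp neg_typing add_neg comp_typing)
    then have "g \<boxplus> \<boxminus> h \<in> kernel (homgrp D B Z) (homgrp D A Z) (\<lambda>g. g ** m)"
      using gh by (simp add: kernel_def homgrp_def)
    then have "g \<boxplus> \<boxminus> h = zr B Z" using k Z by blast
    then show "g = h" using minus_eq_zero_iff[OF g h] by simp
  qed
qed

lemma weak_kernel_cpx_iff:
  assumes X: "X \<in> cpxs D (Suc n)"
  shows "weak_kernel_cpx D n X \<longleftrightarrow> (\<forall>Z \<in> Obj D. \<forall>i<n. co_exact_Suc D X Z i)"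
  unfolding weak_kernel_cpx_def using co_exact_Suc_iff[OF X] Hom_obj(1) by blast

lemma weak_cokernel_cpx_iff:
  assumes X: "X \<in> cpxs D (Suc n)"
  shows "weak_cokernel_cpx D n X \<longleftrightarrow> (\<forall>Z \<in> Obj D. \<forall>i<n. contra_exact_Suc D X Z i)"
  unfolding weak_cokernel_cpx_def using contra_exact_Suc_iff[OF X] Hom_obj(2) by blast

lemma co_left_exact_iff:
  assumes X: "X \<in> cpxs D (Suc n)"
  shows "co_left_exact D n X \<longleftrightarrow> weak_kernel_cpx D n X \<and> monic D (df X 0)"
proof -
  have "monic D (df X 0) \<longleftrightarrow> (\<forall>Z \<in> Obj D.
     kernel (homgrp D Z (ob X 0)) (homgrp D Z (ob X 1)) (\<lambda>g. df X 0 ** g) = {zr Z (ob X 0)})"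
    using monic_iff_kernel[OF cpx_df[OF X]] by simp
  with weak_kernel_cpx_iff[OF X] show ?thesis unfolding co_left_exact_def by blast
qed

lemma contra_left_exact_iff:
  assumes X: "X \<in> cpxs D (Suc n)"
  shows "contra_left_exact D n X \<longleftrightarrow> weak_cokernel_cpx D n X \<and> epic D (df X n)"
proof -
  have "epic D (df X n) \<longleftrightarrow> (\<forall>Z \<in> Obj D.
     kernel (homgrp D (ob X (n + 1)) Z) (homgrp D (ob X n) Z) (\<lambda>g. g ** df X n) = {zr (ob X (n + 1)) Z})"
    using epic_iff_kernel[OF cpx_df[OF X]] by simp
  with weak_cokernel_cpx_iff[OF X] show ?thesis unfolding contra_left_exact_def by blast
qed

lemma n_exact_seq_iff:
  "n_exact_seq D n X \<longleftrightarrow> X \<in> cpxs D (Suc n) \<and> weak_kernel_cpx D n X \<and> monic D (df X 0) \<and>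
     weak_cokernel_cpx D n X \<and> epic D (df X n)"
  unfolding n_exact_seq_def using co_left_exact_iff contra_left_exact_iff by blast

lemma n_exact_seqD:
  assumes "n_exact_seq D n X"
  shows "X \<in> cpxs D (Suc n)" "weak_kernel_cpx D n X" "monic D (df X 0)"
    "weak_cokernel_cpx D n X" "epic D (df X n)"
  using assms by (simp_all add: n_exact_seq_iff)

lemma null_homotopicI:
  assumes "\<And>i. i \<le> n \<Longrightarrow> h i \<in> Hom D (ob X (Suc i)) (ob Y i)"
    "f 0 = h 0 ** df X 0"
    "\<And>i. i < n \<Longrightarrow> f (Suc i) = (df Y i ** h i) \<boxplus> (h (Suc i) ** df X (Suc i))"
    "f (Suc n) = df Y n ** h n"
  shows "null_homotopic D n X Y f"
  using assms unfolding null_homotopic_def by blast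

lemma null_homotopicE:
  assumes "null_homotopic D n X Y f"
  obtains h where "\<And>i. i \<le> n \<Longrightarrow> h i \<in> Hom D (ob X (Suc i)) (ob Y i)"
    "f 0 = h 0 ** df X 0"
    "\<And>i. i < n \<Longrightarrow> f (Suc i) = (df Y i ** h i) \<boxplus> (h (Suc i) ** df X (Suc i))"
    "f (Suc n) = df Y n ** h n"
  using assms unfolding null_homotopic_def by blast

lemma null_homotopic_cong:
  assumes "null_homotopic D n X Y f" "\<And>i. i \<le> Suc n \<Longrightarrow> f i = g i"
  shows "null_homotopic D n X Y g"
  using assms(1) unfolding null_homotopic_def by (simp add: assms(2)[symmetric])

lemma null_homotopic_zero:
  assumes X: "X \<in> cpxs D (Suc n)" and Y: "Y \<in> cpxs D (Suc n)"
  shows "null_homotopic D n X Y (\<lambda>i. zr (ob X i) (ob Y i))"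
proof (rule null_homotopicI[where h = "\<lambda>i. zr (ob X (Suc i)) (ob Y i)"])
qed (use X Y in \<open>simp_all add: zero_hom zero_comp comp_zero cpx_ob cpx_df_typing add_zero zero_typing\<close>)

lemma null_homotopic_add:
  assumes X: "X \<in> cpxs D (Suc n)" and Y: "Y \<in> cpxs D (Suc n)"
    and "null_homotopic D n X Y f" and "null_homotopic D n X Y g"
  shows "null_homotopic D n X Y (\<lambda>i. f i \<boxplus> g i)"
proof -
  obtain h where h: "\<And>i. i \<le> n \<Longrightarrow> h i \<in> Hom D (ob X (Suc i)) (ob Y i)"
    "f 0 = h 0 ** df X 0"
    "\<And>i. i < n \<Longrightarrow> f (Suc i) = (df Y i ** h i) \<boxplus> (h (Suc i) ** df X (Suc i))"
    "f (Suc n) = df Y n ** h n" using assms(3) by (rule null_homotopicE) blast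
  obtain k where k: "\<And>i. i \<le> n \<Longrightarrow> k i \<in> Hom D (ob X (Suc i)) (ob Y i)"
    "g 0 = k 0 ** df X 0"
    "\<And>i. i < n \<Longrightarrow> g (Suc i) = (df Y i ** k i) \<boxplus> (k (Suc i) ** df X (Suc i))"
    "g (Suc n) = df Y n ** k n" using assms(4) by (rule null_homotopicE) blast
  note hk = h(1)[unfolded in_Hom] k(1)[unfolded in_Hom]
  show ?thesis
  proof (rule null_homotopicI[where h = "\<lambda>i. h i \<boxplus> k i"])
    show "h i \<boxplus> k i \<in> Hom D (ob X (Suc i)) (ob Y i)" if "i \<le> n" for i
      using add_hom h(1) k(1) that by blast
    show "f 0 \<boxplus> g 0 = (h 0 \<boxplus> k 0) ** df X 0"
      using X hk[of 0] by (simp add: h(2) k(2) add_comp cpx_df_typing)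
    show "f (Suc n) \<boxplus> g (Suc n) = df Y n ** (h n \<boxplus> k n)"
      using Y hk[of n] by (simp add: h(4) k(4) comp_add cpx_df_typing)
    fix i assume i: "i < n"
    have t: "df Y i ** h i \<in> Arr D" "df Y i ** k i \<in> Arr D" "h (Suc i) ** df X (Suc i) \<in> Arr D" 
        "k (Suc i) ** df X (Suc i) \<in> Arr D"
      "Dom D (df Y i ** h i) = ob X (Suc i)" "Dom D (df Y i ** k i) = ob X (Suc i)"
      "Dom D (h (Suc i) ** df X (Suc i)) = ob X (Suc i)" "Dom D (k (Suc i) ** df X (Suc i)) = ob X (Suc i)"
      "Cod D (df Y i ** h i) = ob Y (Suc i)" "Cod D (df Y i ** k i) = ob Y (Suc i)"
      "Cod D (h (Suc i) ** df X (Suc i)) = ob Y (Suc i)" "Cod D (k (Suc i) ** df X (Suc i)) = ob Y (Suc i)"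
      using X Y i hk[of i] hk[of "Suc i"] by (simp_all add: comp_typing cpx_df_typing)
    show "f (Suc i) \<boxplus> g (Suc i) =
        (df Y i ** (h i \<boxplus> k i)) \<boxplus> ((h (Suc i) \<boxplus> k (Suc i)) ** df X (Suc i))"
      using X Y i hk[of i] hk[of "Suc i"] t
      by (simp add: h(3) k(3) comp_add add_comp cpx_df_typing add_assoc add_typing
          add_left_commute[of "h (Suc i) ** df X (Suc i)" "df Y i ** k i"])
  qed
qed

lemma null_homotopic_comp_left:
  assumes X: "X \<in> cpxs D (Suc n)" and Y: "Y \<in> cpxs D (Suc n)" and Z: "Z \<in> cpxs D (Suc n)"
    and "null_homotopic D n X Y f" and g: "chain_map D (Suc n) Y Z g"
  shows "null_homotopic D n X Z (\<lambda>i. g i ** f i)"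
proof -
  obtain h where h: "\<And>i. i \<le> n \<Longrightarrow> h i \<in> Hom D (ob X (Suc i)) (ob Y i)"
    "f 0 = h 0 ** df X 0"
    "\<And>i. i < n \<Longrightarrow> f (Suc i) = (df Y i ** h i) \<boxplus> (h (Suc i) ** df X (Suc i))"
    "f (Suc n) = df Y n ** h n" using assms(4) by (rule null_homotopicE) blast
  have sq: "g (Suc i) ** (df Y i ** h i) = df Z i ** (g i ** h i)" if "i \<le> n" for i
    using that h(1)[of i, unfolded in_Hom] chain_map_comm[OF g, of i] X Y Z
      comp_assoc'[of "h i" "df Y i" "g (Suc i)"] comp_assoc'[of "h i" "g i" "df Z i"]
    by (simp add: chain_map_typing[OF g] cpx_df_typing)
  show ?thesis
  proof (rule null_homotopicI[where h = "\<lambda>i. g i ** h i"])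
    show "g i ** h i \<in> Hom D (ob X (Suc i)) (ob Z i)" if "i \<le> n" for i
      using that h(1)[of i] comp_hom[OF h(1) chain_map_hom[OF g]] by simp
    show "g 0 ** f 0 = g 0 ** h 0 ** df X 0"
      using X h(1)[of 0, unfolded in_Hom] by (simp add: h(2) comp_assoc' cpx_df_typing chain_map_typing[OF g])
    show "g (Suc n) ** f (Suc n) = df Z n ** (g n ** h n)" using sq[of n] by (simp add: h(4))
    fix i assume i: "i < n"
    show "g (Suc i) ** f (Suc i) = df Z i ** (g i ** h i) \<boxplus> g (Suc i) ** h (Suc i) ** df X (Suc i)"
      using X Y i h(1)[of i, unfolded in_Hom] h(1)[of "Suc i", unfolded in_Hom] sq[of i]
      by (simp add: h(3) comp_add comp_typing comp_assoc' cpx_df_typing chain_map_typing[OF g])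
  qed
qed

lemma null_homotopic_comp_right:
  assumes X: "X \<in> cpxs D (Suc n)" and Y: "Y \<in> cpxs D (Suc n)" and Z: "Z \<in> cpxs D (Suc n)"
    and "null_homotopic D n Y Z f" and g: "chain_map D (Suc n) X Y g"
  shows "null_homotopic D n X Z (\<lambda>i. f i ** g i)"
proof -
  obtain h where h: "\<And>i. i \<le> n \<Longrightarrow> h i \<in> Hom D (ob Y (Suc i)) (ob Z i)"
    "f 0 = h 0 ** df Y 0"
    "\<And>i. i < n \<Longrightarrow> f (Suc i) = (df Z i ** h i) \<boxplus> (h (Suc i) ** df Y (Suc i))"
    "f (Suc n) = df Z n ** h n" using assms(4) by (rule null_homotopicE) blast
  have sq: "h i ** df Y i ** g i = h i ** g (Suc i) ** df X i" if "i \<le> n" for i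
    using that h(1)[of i, unfolded in_Hom] chain_map_comm[OF g, of i] X Y
    by (simp add: chain_map_typing[OF g] cpx_df_typing comp_assoc')
  show ?thesis
  proof (rule null_homotopicI[where h = "\<lambda>i. h i ** g (Suc i)"])
    show "h i ** g (Suc i) \<in> Hom D (ob X (Suc i)) (ob Z i)" if "i \<le> n" for i
      using that h(1)[of i] comp_hom[OF chain_map_hom[OF g] h(1)] by simp
    show "f 0 ** g 0 = h 0 ** g (Suc 0) ** df X 0" using sq[of 0] by (simp add: h(2))
    show "f (Suc n) ** g (Suc n) = df Z n ** (h n ** g (Suc n))"
      using Z h(1)[of n, unfolded in_Hom] by (simp add: h(4) comp_assoc' cpx_df_typing chain_map_typing[OF g])
    fix i assume i: "i < n"
    show "f (Suc i) ** g (Suc i) = df Z i ** (h i ** g (Suc i)) \<boxplus> h (Suc i) ** g (Suc (Suc i)) ** df X (Suc i)"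
      using Y Z i h(1)[of i, unfolded in_Hom] h(1)[of "Suc i", unfolded in_Hom] sq[of "Suc i", symmetric]
      by (simp add: h(3) add_comp comp_typing comp_assoc' cpx_df_typing chain_map_typing[OF g])
  qed
qed

lemma chain_map_between_comp:
  assumes "X \<in> cpxs D (Suc n)" "Y \<in> cpxs D (Suc n)" "Z \<in> cpxs D (Suc n)"
    and "chain_map_between D n X Y f" "chain_map_between D n Y Z g"
  shows "chain_map_between D n X Z (\<lambda>i. g i ** f i)"
proof -
  have f: "chain_map D (Suc n) X Y f" "f 0 = idn D (ob X 0)" "f (Suc n) = idn D (ob X (Suc n))"
    and g: "chain_map D (Suc n) Y Z g" "g 0 = idn D (ob Y 0)" "g (Suc n) = idn D (ob Y (Suc n))"
    using assms(4,5) by (auto simp: chain_map_between_def)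
  have "ob Y 0 = ob X 0" "ob Y (Suc n) = ob X (Suc n)"
    using chain_map_typing(3)[OF f(1), of 0] chain_map_typing(3)[OF f(1), of "Suc n"] f(2,3) assms(1)
    by (simp_all add: idn_typing cpx_ob)
  then show ?thesis
    using chain_map_comp[OF assms(1-3) f(1) g(1)] f g assms(1)
    by (simp add: chain_map_between_def idn_left' idn_typing cpx_ob)
qed

lemma hclass_self:
  assumes X: "X \<in> cpxs D (Suc n)"
  shows "X \<in> hclass D n X"
proof -
  let ?f = "\<lambda>i. idn D (ob X i)"
  have c: "chain_map_between D n X X ?f"
    using chain_map_idn[OF X] by (simp add: chain_map_between_def)
  have "null_homotopic D n X X (\<lambda>i. (?f i ** ?f i) \<boxplus> \<boxminus> ?f i)"
    by (rule null_homotopic_cong[OF null_homotopic_zero[OF X X]])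
       (simp add: idn_left' idn_typing add_neg cpx_ob[OF X])
  then have "homotopic D n X X (\<lambda>i. ?f i ** ?f i) ?f" by (simp add: homotopic_def)
  then show ?thesis using c X unfolding hclass_def cpxs_between_def by blast
qed

lemma hclass_sym:
  assumes X: "X \<in> cpxs D (Suc n)" and "Y \<in> hclass D n X"
  shows "X \<in> hclass D n Y"
  using assms unfolding hclass_def cpxs_between_def by auto

text \<open>
  The transitivity step for homotopy equivalence:
  \<open>g g' f' f - 1 = g (g' f' - 1) f + (g f - 1)\<close>.
\<close>

lemma homotopic_idn_comp:
  assumes X: "X \<in> cpxs D (Suc n)" and Y: "Y \<in> cpxs D (Suc n)" and Z: "Z \<in> cpxs D (Suc n)"
    and f: "chain_map D (Suc n) X Y f" and g: "chain_map D (Suc n) Y X g"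
    and f': "chain_map D (Suc n) Y Z f'" and g': "chain_map D (Suc n) Z Y g'"
    and h: "homotopic D n X X (\<lambda>i. g i ** f i) (\<lambda>i. idn D (ob X i))"
    and h': "homotopic D n Y Y (\<lambda>i. g' i ** f' i) (\<lambda>i. idn D (ob Y i))"
  shows "homotopic D n X X (\<lambda>i. (g i ** g' i) ** (f' i ** f i)) (\<lambda>i. idn D (ob X i))"
proof -
  have "null_homotopic D n X X (\<lambda>i. (g i ** ((g' i ** f' i \<boxplus> \<boxminus> idn D (ob Y i)) ** f i)) \<boxplus>
      (g i ** f i \<boxplus> \<boxminus> idn D (ob X i)))"
    using null_homotopic_add[OF X X null_homotopic_comp_left[OF X Y X null_homotopic_comp_right[OF X Y Y _ f] g]]
      h h' unfolding homotopic_def by blast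
  then show ?thesis unfolding homotopic_def
  proof (rule null_homotopic_cong)
    fix i assume i: "i \<le> Suc n"
    note t = chain_map_typing[OF f i] chain_map_typing[OF g i] chain_map_typing[OF f' i]
      chain_map_typing[OF g' i] cpx_ob[OF X i] cpx_ob[OF Y i]
    show "(g i ** ((g' i ** f' i \<boxplus> \<boxminus> idn D (ob Y i)) ** f i)) \<boxplus> (g i ** f i \<boxplus> \<boxminus> idn D (ob X i))
      = (g i ** g' i) ** (f' i ** f i) \<boxplus> \<boxminus> idn D (ob X i)"
      using t by (simp add: cat_simps)
  qed
qed

lemma hclass_trans:
  assumes X: "X \<in> cpxs D (Suc n)" and Y: "Y \<in> hclass D n X" and Z: "Z \<in> hclass D n Y"
  shows "Z \<in> hclass D n X"
proof -
  have Yc: "Y \<in> cpxs D (Suc n)" "ob Y 0 = ob X 0" "ob Y (Suc n) = ob X (Suc n)"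
    and Zc: "Z \<in> cpxs D (Suc n)" "ob Z 0 = ob Y 0" "ob Z (Suc n) = ob Y (Suc n)"
    using Y Z by (auto simp: hclass_def cpxs_between_def)
  obtain f g where fg: "chain_map_between D n X Y f" "chain_map_between D n Y X g"
     "homotopic D n X X (\<lambda>i. g i ** f i) (\<lambda>i. idn D (ob X i))"
     "homotopic D n Y Y (\<lambda>i. f i ** g i) (\<lambda>i. idn D (ob Y i))"
    using Y unfolding hclass_def by blast
  obtain f' g' where fg': "chain_map_between D n Y Z f'" "chain_map_between D n Z Y g'"
     "homotopic D n Y Y (\<lambda>i. g' i ** f' i) (\<lambda>i. idn D (ob Y i))"
     "homotopic D n Z Z (\<lambda>i. f' i ** g' i) (\<lambda>i. idn D (ob Z i))"
    using Z unfolding hclass_def by blast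
  note c = fg(1,2)[unfolded chain_map_between_def] fg'(1,2)[unfolded chain_map_between_def]
  have "homotopic D n X X (\<lambda>i. (g i ** g' i) ** (f' i ** f i)) (\<lambda>i. idn D (ob X i))"
    using homotopic_idn_comp[OF X Yc(1) Zc(1)] c fg fg' by blast
  moreover have "homotopic D n Z Z (\<lambda>i. (f' i ** f i) ** (g i ** g' i)) (\<lambda>i. idn D (ob Z i))"
    using homotopic_idn_comp[OF Zc(1) Yc(1) X] c fg fg' by blast
  ultimately show ?thesis
    using chain_map_between_comp[OF X Yc(1) Zc(1) fg(1) fg'(1)]
      chain_map_between_comp[OF Zc(1) Yc(1) X fg'(2) fg(2)] Yc Zc
    unfolding hclass_def cpxs_between_def by (intro CollectI conjI exI) auto
qed

lemma hclass_eq: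
  assumes X: "X \<in> cpxs D (Suc n)" and Y: "Y \<in> hclass D n X"
  shows "hclass D n Y = hclass D n X"
proof -
  have Yc: "Y \<in> cpxs D (Suc n)" using Y by (auto simp: hclass_def cpxs_between_def)
  show ?thesis
    using hclass_trans[OF X Y] hclass_trans[OF Yc hclass_sym[OF X Y]] by blast
qed

text \<open>
  The difference to the identity vanishes in degree \<open>n + 1\<close>, so the zero arrow starts a
  null-homotopy that then runs down to degree 0.
\<close>

lemma chain_map_between_homotopic_idn:
  assumes X: "n_exact_seq D n X" and f: "chain_map_between D n X X f"
  shows "homotopic D n X X f (\<lambda>i. idn D (ob X i))"
proof -
  note X' = n_exact_seqD[OF X]
  let ?e = "\<lambda>i. f i \<boxplus> \<boxminus> idn D (ob X i)"
  have f': "chain_map D (Suc n) X X f" "f 0 = idn D (ob X 0)" "f (Suc n) = idn D (ob X (Suc n))"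
    using f by (auto simp: chain_map_between_def)
  have e: "chain_map D (Suc n) X X ?e"
    using chain_map_diff[OF X'(1) X'(1) f'(1) chain_map_idn[OF X'(1)]] .
  have e_last: "?e (Suc n) = zr (ob X (Suc n)) (ob X (Suc n))"
    using f'(3) X'(1) by (simp add: add_neg idn_typing cpx_ob)
  let ?t = "zr (ob X (Suc n)) (ob X n)"
  have o: "ob X n \<in> Obj D" "ob X (Suc n) \<in> Obj D" using X'(1) by (simp_all add: cpx_ob)
  have "df X n ** ?e n = zr (ob X n) (ob X (Suc n))"
    using chain_map_comm[OF e, of n] e_last o X'(1) by (simp add: zero_comp cpx_df_typing)
  also have "\<dots> = df X n ** (?t ** df X n)"
    using o X'(1) by (simp add: zero_comp comp_zero cpx_df_typing)
  finally obtain h where h: "\<forall>i \<le> n. h i \<in> Hom D (ob X (Suc i)) (ob X i)" "h n = ?t" "?e 0 = h 0 ** df X 0"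
        "\<forall>i < n. ?e (Suc i) = (df X i ** h i) \<boxplus> (h (Suc i) ** df X (Suc i))"
    using null_homotopy_down[OF X'(1) X'(1) X'(2,3) e order_refl zero_hom[OF o(2,1)]] by blast
  have "?e (Suc n) = df X n ** h n"
    using e_last h(2) o X'(1) by (simp add: comp_zero cpx_df_typing)
  then show ?thesis unfolding homotopic_def using h by (intro null_homotopicI[where h = h]) blast+
qed

text \<open>
  The two composites are the identity at the ends, hence homotopic to identities by the previous
  lemma: between n-exact sequences the homotopies of a homotopy equivalence come for free.
\<close>

lemma hclass_eqI:
  assumes X: "n_exact_seq D n X" and Y: "n_exact_seq D n Y"
    and f: "chain_map_between D n X Y f" and g: "chain_map_between D n Y X g"
  shows "hclass D n X = hclass D n Y"
proof -
  note Xc = n_exact_seqD(1)[OF X] and Yc = n_exact_seqD(1)[OF Y]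
  have "ob Y 0 = ob X 0" "ob Y (Suc n) = ob X (Suc n)"
    using f Xc chain_map_typing(3)[of "Suc n" X Y f 0] chain_map_typing(3)[of "Suc n" X Y f "Suc n"]
    by (simp_all add: chain_map_between_def idn_typing cpx_ob)
  moreover have "homotopic D n X X (\<lambda>i. g i ** f i) (\<lambda>i. idn D (ob X i))"
    using chain_map_between_homotopic_idn[OF X chain_map_between_comp[OF Xc Yc Xc f g]] .
  moreover have "homotopic D n Y Y (\<lambda>i. f i ** g i) (\<lambda>i. idn D (ob Y i))"
    using chain_map_between_homotopic_idn[OF Y chain_map_between_comp[OF Yc Xc Yc g f]] .
  ultimately have "Y \<in> hclass D n X"
    using f g Yc unfolding hclass_def cpxs_between_def by blast
  then show ?thesis using hclass_eq[OF Xc] by blast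
qed

lemma chain_map_of_square:
  assumes X: "X \<in> cpxs D (Suc n)" and Y: "Y \<in> cpxs D (Suc n)"
    and wc: "weak_cokernel_cpx D n X" and wk: "weak_kernel_cpx D n Y"
    and k: "k \<le> n" and u: "u \<in> Hom D (ob X k) (ob Y k)" and v: "v \<in> Hom D (ob X (Suc k)) (ob Y (Suc k))"
    and sq: "df Y k ** u = v ** df X k"
  shows "\<exists>f. chain_map D (Suc n) X Y f \<and> f k = u \<and> f (Suc k) = v"
proof -
  obtain F where F: "\<forall>i \<le> k. F i \<in> Hom D (ob X i) (ob Y i)"
    "\<forall>i < k. df Y i ** F i = F (Suc i) ** df X i" "F k = u"
    using lift_down[OF X Y wk k u v sq] by blast
  have "k + (n - k) = n" using k by simp
  from lift_up[OF X Y wc this v u sq]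
  obtain H where H: "\<forall>i. k < i \<and> i \<le> Suc n \<longrightarrow> H i \<in> Hom D (ob X i) (ob Y i)"
    "\<forall>i. k < i \<and> i \<le> n \<longrightarrow> df Y i ** H i = H (Suc i) ** df X i" "H (Suc k) = v"
    by blast
  let ?f = "\<lambda>i. if i \<le> k then F i else H i"
  have "chain_map D (Suc n) X Y ?f" unfolding chain_map_def
  proof (intro conjI allI impI)
    fix i assume "i \<le> Suc n"
    then show "?f i \<in> Hom D (ob X i) (ob Y i)" using F(1) H(1) by (cases "i \<le> k") simp_all
  next
    fix i assume i: "i < Suc n"
    consider "i < k" | "i = k" | "k < i" by linarith
    then show "df Y i ** ?f i = ?f (Suc i) ** df X i"
    proof cases
      case 1 then show ?thesis using F(2) by simp
    next
      case 2 then show ?thesis using F(3) H(3) sq by simp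
    next
      case 3 then show ?thesis using H(2) i by simp
    qed
  qed
  then show ?thesis using F(3) H(3) by (intro exI[of _ ?f]) simp
qed

text \<open>
  The null-homotopy started by the given factorisation ends in degree 0 with the claimed one. This
  transfers information from one end of a complex to the other, and almost all later arguments are
  instances of it or of its dual.
\<close>

lemma first_component_factors:
  assumes X: "X \<in> cpxs D (Suc n)" and Y: "n_exact_seq D n Y" and e: "chain_map D (Suc n) X Y e"
    and k: "k \<le> n" and t: "t \<in> Hom D (ob X (Suc k)) (ob Y k)" and eq: "e (Suc k) = df Y k ** t"
  shows "\<exists>h \<in> Hom D (ob X 1) (ob Y 0). e 0 = h ** df X 0"
proof -
  note Y' = n_exact_seqD[OF Y]
  have "df Y k ** e k = df Y k ** t ** df X k" using chain_map_comm[OF e, of k] k eq by simp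
  also have "\<dots> = df Y k ** (t ** df X k)"
    using comp_assoc[OF cpx_df[OF X, of k] t cpx_df[OF Y'(1), of k]] k by simp
  finally obtain h where h: "\<forall>i \<le> k. h i \<in> Hom D (ob X (Suc i)) (ob Y i)" "e 0 = h 0 ** df X 0"
    using null_homotopy_down[OF X Y'(1-3) e k t] by blast
  then have "h 0 \<in> Hom D (ob X 1) (ob Y 0)" by simp
  with h(2) show ?thesis by blast
qed

lemma last_component_factors:
  assumes X: "n_exact_seq D n X" and Y: "Y \<in> cpxs D (Suc n)" and e: "chain_map D (Suc n) X Y e"
    and k: "k \<le> n" and t: "t \<in> Hom D (ob X (Suc k)) (ob Y k)" and eq: "e k = t ** df X k"
  shows "\<exists>s \<in> Hom D (ob X (Suc n)) (ob Y n). e (Suc n) = df Y n ** s"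
proof -
  note X' = n_exact_seqD[OF X]
  have "e (Suc k) ** df X k = df Y k ** (t ** df X k)" using chain_map_comm[OF e, of k] k eq by simp
  also have "\<dots> = df Y k ** t ** df X k"
    using comp_assoc[OF cpx_df[OF X'(1), of k] t cpx_df[OF Y, of k]] k by simp
  finally have "e (Suc k) ** df X k = df Y k ** t ** df X k" .
  moreover have "k + (n - k) = n" using k by simp
  ultimately show ?thesis using null_homotopy_up[OF X'(1) Y X'(4,5) e _ t] by blast
qed

text \<open>
  Subtracting the null-homotopic map whose homotopy is \<open>s\<close> at the left end, \<open>t\<close> at the right end and
  zero in between changes the two end components independently; here \<open>n \<ge> 1\<close> keeps \<open>s\<close> and \<open>t\<close> in
  different degrees.
\<close>

lemma chain_map_adjust_ends:
  assumes X: "X \<in> cpxs D (Suc n)" and Y: "Y \<in> cpxs D (Suc n)" and n: "n \<ge> 1"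
    and p: "chain_map D (Suc n) X Y p"
    and s: "s \<in> Hom D (ob X 1) (ob Y 0)" and t: "t \<in> Hom D (ob X (Suc n)) (ob Y n)"
  shows "\<exists>q. chain_map D (Suc n) X Y q \<and> q 0 = p 0 \<boxplus> \<boxminus> (s ** df X 0) \<and>
             q (Suc n) = p (Suc n) \<boxplus> \<boxminus> (df Y n ** t)"
proof -
  define h where "h i = (if i = 0 then s else if i = n then t else zr (ob X (Suc i)) (ob Y i))" for i
  have h: "h i \<in> Hom D (ob X (Suc i)) (ob Y i)" if "i \<le> n" for i
    using that s t X Y by (simp add: h_def zero_hom cpx_ob)
  have h0: "h 0 = s" and hn: "h n = t" using n by (simp_all add: h_def)
  define e where "e i = (if i = 0 then h 0 ** df X 0 else if i = Suc n then df Y n ** h n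
     else (df Y (i - 1) ** h (i - 1)) \<boxplus> (h i ** df X i))" for i
  have "chain_map D (Suc n) X Y e" unfolding chain_map_def
  proof (intro conjI allI impI)
    fix i assume i: "i \<le> Suc n"
    show "e i \<in> Hom D (ob X i) (ob Y i)"
    proof (cases i)
      case 0
      then show ?thesis using comp_hom[OF cpx_df[OF X, of 0] h[of 0]] by (simp add: e_def)
    next
      case (Suc j)
      show ?thesis
      proof (cases "i = Suc n")
        case True
        then show ?thesis using comp_hom[OF h cpx_df[OF Y, of n]] by (simp add: e_def)
      next
        case False
        then show ?thesis
          using add_hom[OF comp_hom[OF h[of j] cpx_df[OF Y, of j]] comp_hom[OF cpx_df[OF X, of "Suc j"] h[of "Suc j"]]]
            Suc i by (simp add: e_def)
      qed
    qed
  next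
    fix i assume i: "i < Suc n"
    have hi: "h i \<in> Arr D" "Dom D (h i) = ob X (Suc i)" "Cod D (h i) = ob Y i"
      using h[of i] i by (simp_all add: in_Hom)
    have "df Y i ** e i = df Y i ** (h i ** df X i)"
    proof (cases i)
      case 0 then show ?thesis using i by (simp add: e_def)
    next
      case (Suc j)
      then show ?thesis
        using i hi X Y h[of j, unfolded in_Hom] cpx_df_df_comp[OF Y, of j "h j"]
        by (simp add: e_def comp_add comp_typing cpx_df_typing zero_comp add_zero comp_zero cpx_ob)
    qed
    moreover have "e (Suc i) ** df X i = df Y i ** (h i ** df X i)"
    proof (cases "i = n")
      case True then show ?thesis using hi X Y by (simp add: e_def comp_assoc' cpx_df_typing)
    next
      case False
      then show ?thesis
        using i hi X Y h[of "Suc i", unfolded in_Hom]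
        by (simp add: e_def add_comp comp_typing cpx_df_typing comp_assoc' cpx_df_df comp_zero add_zero cpx_ob)
    qed
    ultimately show "df Y i ** e i = e (Suc i) ** df X i" by simp
  qed
  then have "chain_map D (Suc n) X Y (\<lambda>i. p i \<boxplus> \<boxminus> e i)" using chain_map_diff[OF X Y p] by blast
  moreover have "e 0 = s ** df X 0" "e (Suc n) = df Y n ** t" by (simp_all add: e_def h0 hn)
  ultimately show ?thesis by (intro exI[of _ "\<lambda>i. p i \<boxplus> \<boxminus> e i"]) simp
qed

lemma idn_minus_solve:
  assumes "A \<in> Obj D" "p \<in> Hom D A A" "p \<boxplus> \<boxminus> idn D A = x" "x \<in> Hom D A A"
  shows "p \<boxplus> \<boxminus> x = idn D A"
proof -
  have "p = x \<boxplus> idn D A" using minus_eq_iff[of p A A "idn D A" x] assms idn_hom by blast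
  also have "\<dots> = idn D A \<boxplus> x"
    using assms by (intro add_commute) (simp_all add: in_Hom idn_typing)
  finally have "p = idn D A \<boxplus> x" .
  then show ?thesis using minus_eq_iff[of p A A x "idn D A"] assms idn_hom by blast
qed

end

section \<open>Extensions under pushing forward and pulling back\<close>

context biadditive_functor
begin

abbreviation Ext where "Ext C A \<equiv> carrier (grp G C A)"

lemma push_closed:
  "\<lbrakk>C \<in> Obj D; a \<in> Hom D A A'; \<delta> \<in> Ext C A\<rbrakk> \<Longrightarrow> push D G C a \<delta> \<in> Ext C A'"
  using act_hom[OF idn_hom, of C a A A'] by (auto simp: push_def hom_def)

lemma pull_closed:
  "\<lbrakk>A \<in> Obj D; c \<in> Hom D C' C; \<delta> \<in> Ext C A\<rbrakk> \<Longrightarrow> pull D G c A \<delta> \<in> Ext C' A"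
  using act_hom[OF _ idn_hom, of c C' C A] by (auto simp: pull_def hom_def)

lemma push_mult:
  "\<lbrakk>C \<in> Obj D; a \<in> Hom D A A'; \<delta> \<in> Ext C A; \<epsilon> \<in> Ext C A\<rbrakk>
    \<Longrightarrow> push D G C a (\<delta> \<otimes>\<^bsub>grp G C A\<^esub> \<epsilon>) = push D G C a \<delta> \<otimes>\<^bsub>grp G C A'\<^esub> push D G C a \<epsilon>"
  using act_hom[OF idn_hom, of C a A A'] by (auto simp: push_def hom_def)

lemma pull_mult:
  "\<lbrakk>A \<in> Obj D; c \<in> Hom D C' C; \<delta> \<in> Ext C A; \<epsilon> \<in> Ext C A\<rbrakk>
    \<Longrightarrow> pull D G c A (\<delta> \<otimes>\<^bsub>grp G C A\<^esub> \<epsilon>) = pull D G c A \<delta> \<otimes>\<^bsub>grp G C' A\<^esub> pull D G c A \<epsilon>"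
  using act_hom[OF _ idn_hom, of c C' C A] by (auto simp: pull_def hom_def)

lemma grp_idem_one:
  assumes "C \<in> Obj D" "A \<in> Obj D" "x \<in> Ext C A" "x \<otimes>\<^bsub>grp G C A\<^esub> x = x"
  shows "x = \<one>\<^bsub>grp G C A\<^esub>"
proof -
  interpret g: comm_group "grp G C A" using grp_comm_group assms by blast
  show ?thesis using assms g.l_cancel_one by blast
qed

lemma push_one:
  assumes "C \<in> Obj D" "a \<in> Hom D A A'"
  shows "push D G C a \<one>\<^bsub>grp G C A\<^esub> = \<one>\<^bsub>grp G C A'\<^esub>"
proof -
  interpret g: comm_group "grp G C A" using grp_comm_group assms(1) Hom_obj[OF assms(2)] by blast
  show ?thesis
    using grp_idem_one[OF assms(1) Hom_obj(2)[OF assms(2)] push_closed[OF assms g.one_closed]]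
      push_mult[OF assms g.one_closed g.one_closed] by simp
qed

lemma pull_one:
  assumes "A \<in> Obj D" "c \<in> Hom D C' C"
  shows "pull D G c A \<one>\<^bsub>grp G C A\<^esub> = \<one>\<^bsub>grp G C' A\<^esub>"
proof -
  interpret g: comm_group "grp G C A" using grp_comm_group assms(1) Hom_obj[OF assms(2)] by blast
  show ?thesis
    using grp_idem_one[OF Hom_obj(1)[OF assms(2)] assms(1) pull_closed[OF assms g.one_closed]]
      pull_mult[OF assms g.one_closed g.one_closed] by simp
qed

lemma push_comp:
  assumes "C \<in> Obj D" "a \<in> Hom D A A'" "a' \<in> Hom D A' A''" "\<delta> \<in> Ext C A"
  shows "push D G C (a' ** a) \<delta> = push D G C a' (push D G C a \<delta>)"
  using act_comp[OF idn_hom idn_hom assms(2,3,4)] assms(1) by (simp add: push_def idn_left' idn_typing)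

lemma pull_comp:
  assumes "A \<in> Obj D" "c \<in> Hom D C' C" "c' \<in> Hom D C'' C'" "\<delta> \<in> Ext C A"
  shows "pull D G (c ** c') A \<delta> = pull D G c' A (pull D G c A \<delta>)"
  using act_comp[OF assms(2,3) idn_hom idn_hom assms(4)] assms(1) by (simp add: pull_def idn_left' idn_typing)

lemma act_pull_push:
  assumes "c \<in> Hom D C' C" "a \<in> Hom D A A'" "\<delta> \<in> Ext C A"
  shows "act G c a \<delta> = pull D G c A' (push D G C a \<delta>)"
  using act_comp[OF idn_hom assms(1,2) idn_hom assms(3)] Hom_obj[OF assms(1)] Hom_obj[OF assms(2)] assms
  by (simp add: push_def pull_def idn_left' idn_right' in_Hom)

lemma act_push_pull:
  assumes "c \<in> Hom D C' C" "a \<in> Hom D A A'" "\<delta> \<in> Ext C A"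
  shows "act G c a \<delta> = push D G C' a (pull D G c A \<delta>)"
  using act_comp[OF assms(1) idn_hom idn_hom assms(2,3)] Hom_obj[OF assms(1)] Hom_obj[OF assms(2)] assms
  by (simp add: push_def pull_def idn_left' idn_right' in_Hom)

lemma push_pull_commute:
  assumes "c \<in> Hom D C' C" "a \<in> Hom D A A'" "\<delta> \<in> Ext C A"
  shows "push D G C' a (pull D G c A \<delta>) = pull D G c A' (push D G C a \<delta>)"
  using act_pull_push[OF assms] act_push_pull[OF assms] by simp

lemma push_idn: "\<lbrakk>C \<in> Obj D; A \<in> Obj D; \<delta> \<in> Ext C A\<rbrakk> \<Longrightarrow> push D G C (idn D A) \<delta> = \<delta>"
  by (simp add: push_def act_idn)

lemma pull_idn: "\<lbrakk>C \<in> Obj D; A \<in> Obj D; \<delta> \<in> Ext C A\<rbrakk> \<Longrightarrow> pull D G (idn D C) A \<delta> = \<delta>"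
  by (simp add: pull_def act_idn)

lemma push_zero:
  assumes "C \<in> Obj D" "A \<in> Obj D" "A' \<in> Obj D" "\<delta> \<in> Ext C A"
  shows "push D G C (zr A A') \<delta> = \<one>\<^bsub>grp G C A'\<^esub>"
  using push_plus[OF assms(1) zero_hom zero_hom assms(4), of A'] assms
    grp_idem_one[OF assms(1,3) push_closed[OF assms(1) zero_hom assms(4)]]
  by (simp add: add_zero zero_typing)

lemma pull_zero:
  assumes "C \<in> Obj D" "A \<in> Obj D" "C' \<in> Obj D" "\<delta> \<in> Ext C A"
  shows "pull D G (zr C' C) A \<delta> = \<one>\<^bsub>grp G C' A\<^esub>"
  using pull_plus[OF assms(2) zero_hom zero_hom assms(4), of C'] assms
    grp_idem_one[OF assms(3,2) pull_closed[OF assms(2) zero_hom assms(4)]]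
  by (simp add: add_zero zero_typing)

lemma push_neg:
  assumes "C \<in> Obj D" "a \<in> Hom D A A'" "\<delta> \<in> Ext C A"
  shows "push D G C (\<boxminus> a) \<delta> = inv\<^bsub>grp G C A'\<^esub> push D G C a \<delta>"
proof -
  note o = Hom_obj[OF assms(2)]
  interpret g: comm_group "grp G C A'" using grp_comm_group assms(1) o by blast
  have "push D G C (\<boxminus> a) \<delta> \<otimes>\<^bsub>grp G C A'\<^esub> push D G C a \<delta> = push D G C (\<boxminus> a \<boxplus> a) \<delta>"
    using push_plus[OF assms(1) neg_hom[OF assms(2)] assms(2,3)] by simp
  also have "\<dots> = \<one>\<^bsub>grp G C A'\<^esub>"
    using push_zero[OF assms(1) o assms(3)] assms(2) by (simp add: add_neg in_Hom)
  finally show ?thesis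
    using g.inv_equality push_closed assms neg_hom by metis
qed

text \<open>
  Arrows that are inverse to one another only up to homotopy are still inverse on extensions.
\<close>

lemma push_eq_of_factor:
  assumes C: "C \<in> Obj D" and a: "a \<in> Hom D A A" and d: "d \<in> Hom D A B" and h: "h \<in> Hom D B A"
    and eq: "a \<boxplus> \<boxminus> idn D A = h ** d"
    and \<delta>: "\<delta> \<in> Ext C A" and kill: "push D G C d \<delta> = \<one>\<^bsub>grp G C B\<^esub>"
  shows "push D G C a \<delta> = \<delta>"
proof -
  note A = Hom_obj(1)[OF a]
  interpret g: comm_group "grp G C A" using grp_comm_group C A by blast
  have hd: "h ** d \<in> Hom D A A" using comp_hom[OF d h] .
  have "a = (h ** d) \<boxplus> idn D A" using minus_eq_iff[OF a idn_hom[OF A] hd] eq by blast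
  then have "push D G C a \<delta> = push D G C (h ** d) \<delta> \<otimes>\<^bsub>grp G C A\<^esub> push D G C (idn D A) \<delta>"
    using push_plus[OF C hd idn_hom[OF A] \<delta>] by simp
  also have "push D G C (h ** d) \<delta> = \<one>\<^bsub>grp G C A\<^esub>"
    using push_comp[OF C d h \<delta>] kill push_one[OF C h] by simp
  finally show ?thesis using \<delta> by (simp add: push_idn C A)
qed

end

section \<open>Conflations with monic inflations and epic deflations\<close>

text \<open>
  The hypotheses of the harder implication. In this locale every conflation turns out to be an
  n-exact sequence.
\<close>

locale monic_epic_exangulated = n_exangulated_category n D G r
  for n :: nat and D :: "('o, 'm) addcat" and G :: "('o, 'm, 'e) bifun"
    and r :: "('o, 'm, 'e) realisation" +
  assumes n_pos: "n \<ge> 1"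
    and inflation_monic: "inflation n D G r f \<Longrightarrow> monic D f"
    and deflation_epic: "deflation n D G r f \<Longrightarrow> epic D f"
begin

abbreviation dist where "dist X \<delta> \<equiv> distinguished n D G r X \<delta>"

lemma dist_cpx: "dist X \<delta> \<Longrightarrow> X \<in> cpxs D (Suc n)"
  by (simp add: distinguished_def)

lemma dist_carrier: "dist X \<delta> \<Longrightarrow> \<delta> \<in> Ext (ob X (Suc n)) (ob X 0)"
  by (simp add: distinguished_def)

lemma dist_hclass: "dist X \<delta> \<Longrightarrow> r (ob X (Suc n)) (ob X 0) \<delta> = hclass D n X"
  by (simp add: distinguished_def)

lemma dist_obj:
  assumes "dist X \<delta>"
  shows "i \<le> Suc n \<Longrightarrow> ob X i \<in> Obj D" "ob X 0 \<in> Obj D" "ob X (Suc n) \<in> Obj D"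
  using cpx_ob[OF dist_cpx[OF assms]] by simp_all

lemma dist_exact:
  assumes "dist X \<delta>"
  shows "n_exact_seq D n X"
proof -
  note X = dist_cpx[OF assms]
  have "\<forall>Z \<in> Obj D. \<forall>i < n. co_exact_Suc D X Z i" "\<forall>Z \<in> Obj D. \<forall>i < n. contra_exact_Suc D X Z i"
    using R1[OF assms] unfolding n_exangle_def by blast+
  then have "weak_kernel_cpx D n X" "weak_cokernel_cpx D n X"
    using weak_kernel_cpx_iff[OF X] weak_cokernel_cpx_iff[OF X] by blast+
  moreover have "monic D (df X 0)" "epic D (df X n)"
    using inflation_monic deflation_epic assms unfolding inflation_def deflation_def conflation_def
    by blast+
  ultimately show ?thesis using X by (simp add: n_exact_seq_iff)
qed

lemma dist_push: "dist X \<delta> \<Longrightarrow> push D G (ob X (Suc n)) (df X 0) \<delta> = \<one>\<^bsub>grp G (ob X (Suc n)) (ob X (Suc 0))\<^esub>"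
  using R1[of X \<delta>] by (simp add: n_exangle_def)

lemma dist_pull: "dist X \<delta> \<Longrightarrow> pull D G (df X n) (ob X 0) \<delta> = \<one>\<^bsub>grp G (ob X n) (ob X 0)\<^esub>"
  using R1[of X \<delta>] by (simp add: n_exangle_def)

lemma dist_factor_right:
  assumes X: "dist X \<delta>" and f: "f \<in> Hom D Z (ob X (Suc n))"
    and eq: "pull D G f (ob X 0) \<delta> = \<one>\<^bsub>grp G Z (ob X 0)\<^esub>"
  shows "\<exists>k \<in> Hom D Z (ob X n). f = df X n ** k"
proof -
  have "exact_at (homgrp D Z (ob X n)) (homgrp D Z (ob X (Suc n))) (grp G Z (ob X 0))
      (\<lambda>f. df X n ** f) (\<lambda>f. pull D G f (ob X 0) \<delta>)"
    using R1[OF X] Hom_obj(1)[OF f] unfolding n_exangle_def by simp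
  then have "(\<lambda>f. df X n ** f) ` Hom D Z (ob X n) =
      {f \<in> Hom D Z (ob X (Suc n)). pull D G f (ob X 0) \<delta> = \<one>\<^bsub>grp G Z (ob X 0)\<^esub>}"
    by (simp add: exact_at_def kernel_def homgrp_def)
  then show ?thesis using f eq by blast
qed

lemma dist_factor_left:
  assumes X: "dist X \<delta>" and g: "g \<in> Hom D (ob X 0) Z"
    and eq: "push D G (ob X (Suc n)) g \<delta> = \<one>\<^bsub>grp G (ob X (Suc n)) Z\<^esub>"
  shows "\<exists>k \<in> Hom D (ob X (Suc 0)) Z. g = k ** df X 0"
proof -
  have "exact_at (homgrp D (ob X (Suc 0)) Z) (homgrp D (ob X 0) Z) (grp G (ob X (Suc n)) Z)
      (\<lambda>g. g ** df X 0) (\<lambda>g. push D G (ob X (Suc n)) g \<delta>)"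
    using R1[OF X] Hom_obj(2)[OF g] unfolding n_exangle_def by simp
  then have "(\<lambda>g. g ** df X 0) ` Hom D (ob X (Suc 0)) Z =
      {g \<in> Hom D (ob X 0) Z. push D G (ob X (Suc n)) g \<delta> = \<one>\<^bsub>grp G (ob X (Suc n)) Z\<^esub>}"
    by (simp add: exact_at_def kernel_def homgrp_def)
  then show ?thesis using g eq by blast
qed

lemma realise:
  assumes "C \<in> Obj D" "A \<in> Obj D" "\<delta> \<in> Ext C A"
  obtains X where "dist X \<delta>" "ob X 0 = A" "ob X (Suc n) = C"
  using realisation_class[OF assms] assms(3) unfolding cpxs_between_def distinguished_def by auto

lemma dist_lift:
  assumes "dist X \<delta>" "dist Y \<rho>" "a \<in> Hom D (ob X 0) (ob Y 0)" "c \<in> Hom D (ob X (Suc n)) (ob Y (Suc n))"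
    "push D G (ob X (Suc n)) a \<delta> = pull D G c (ob Y 0) \<rho>"
  obtains f where "chain_map D (Suc n) X Y f" "f 0 = a" "f (Suc n) = c"
  using R0[of X \<delta> Y \<rho> a c] assms unfolding lift_of_def by auto

lemma dist_chain_map_of_square:
  assumes "n_exact_seq D n X" "n_exact_seq D n Y" "k \<le> n"
    "u \<in> Hom D (ob X k) (ob Y k)" "v \<in> Hom D (ob X (Suc k)) (ob Y (Suc k))" "df Y k ** u = v ** df X k"
  obtains f where "chain_map D (Suc n) X Y f" "f k = u" "f (Suc k) = v"
  using chain_map_of_square[of X n Y k u v] n_exact_seqD[OF assms(1)] n_exact_seqD[OF assms(2)] assms(3-6)
  by blast

lemma equal_last_imp_first_factors:
  assumes X: "X \<in> cpxs D (Suc n)" and Y: "n_exact_seq D n Y"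
    and f: "chain_map D (Suc n) X Y f" and g: "chain_map D (Suc n) X Y g" and eq: "f (Suc n) = g (Suc n)"
  obtains h where "h \<in> Hom D (ob X (Suc 0)) (ob Y 0)" "f 0 \<boxplus> \<boxminus> g 0 = h ** df X 0"
proof -
  note Y' = n_exact_seqD[OF Y]
  have o: "ob X (Suc n) \<in> Obj D" "ob Y n \<in> Obj D" using cpx_ob X Y'(1) by simp_all
  have z: "f (Suc n) \<boxplus> \<boxminus> g (Suc n) = df Y n ** zr (ob X (Suc n)) (ob Y n)"
    using eq chain_map_typing[OF g, of "Suc n"] cpx_df_typing[OF Y'(1), of n] o
    by (simp add: add_neg comp_zero)
  from first_component_factors[OF X Y chain_map_diff[OF X Y'(1) f g] order_refl zero_hom[OF o] z]
  show ?thesis using that by auto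
qed

lemma equal_first_imp_last_factors:
  assumes X: "n_exact_seq D n X" and Y: "Y \<in> cpxs D (Suc n)"
    and f: "chain_map D (Suc n) X Y f" and g: "chain_map D (Suc n) X Y g" and eq: "f 0 = g 0"
  obtains s where "s \<in> Hom D (ob X (Suc n)) (ob Y n)" "f (Suc n) \<boxplus> \<boxminus> g (Suc n) = df Y n ** s"
proof -
  note X' = n_exact_seqD[OF X]
  have o: "ob X (Suc 0) \<in> Obj D" "ob Y 0 \<in> Obj D" using cpx_ob X'(1) Y by simp_all
  have z: "f 0 \<boxplus> \<boxminus> g 0 = zr (ob X (Suc 0)) (ob Y 0) ** df X 0"
    using eq chain_map_typing[OF g, of 0] cpx_df_typing[OF X'(1), of 0] o
    by (simp add: add_neg zero_comp)
  from last_component_factors[OF X Y chain_map_diff[OF X'(1) Y f g] _ zero_hom[OF o] z]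
  show ?thesis using that by auto
qed

lemma chain_map_between_ends:
  assumes "X \<in> cpxs D (Suc n)" "chain_map_between D n X Y f"
  shows "chain_map D (Suc n) X Y f" "f 0 = idn D (ob X 0)" "f (Suc n) = idn D (ob X (Suc n))"
    "ob Y 0 = ob X 0" "ob Y (Suc n) = ob X (Suc n)"
proof -
  show f: "chain_map D (Suc n) X Y f" "f 0 = idn D (ob X 0)" "f (Suc n) = idn D (ob X (Suc n))"
    using assms by (auto simp: chain_map_between_def)
  show "ob Y 0 = ob X 0" "ob Y (Suc n) = ob X (Suc n)"
    using chain_map_typing(3)[OF f(1), of 0] chain_map_typing(3)[OF f(1), of "Suc n"] f(2,3) assms(1)
    by (simp_all add: idn_typing cpx_ob)
qed

lemma dist_transport:
  assumes "dist X \<delta>" "n_exact_seq D n Y" "chain_map_between D n X Y f" "chain_map_between D n Y X g"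
  shows "dist Y \<delta>"
proof -
  note e = chain_map_between_ends[OF dist_cpx[OF assms(1)] assms(3)]
  show ?thesis
    using assms(1) hclass_eqI[OF dist_exact[OF assms(1)] assms(2-4)] n_exact_seqD(1)[OF assms(2)] e(4,5)
    by (simp add: distinguished_def)
qed

text \<open>
  The point is to find a chain map back. One exists as soon as the last differential \<open>d\<close> of \<open>Y\<close>
  factors through that of \<open>X\<close>, that is, as soon as \<open>d\<close> pulls \<open>\<delta>\<close> back to the trivial extension. To see
  the latter, realise the pullback by \<open>P\<close> and compose a lift from \<open>P\<close> to \<open>X\<close> with \<open>f\<close>: the last
  component of the composite is \<open>d\<close> itself, so its first component, an identity, factors through the
  first differential of \<open>P\<close>, which therefore splits.
\<close>

lemma dist_of_chain_map_from:
  assumes X: "dist X \<delta>" and Y: "n_exact_seq D n Y" and f: "chain_map_between D n X Y f"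
  shows "dist Y \<delta>"
proof -
  let ?A = "ob X 0" and ?C = "ob X (Suc n)"
  note Xc = dist_cpx[OF X] and Xe = dist_exact[OF X] and Y' = n_exact_seqD[OF Y]
  note f' = chain_map_between_ends[OF Xc f]
  note oX = dist_obj(2,3)[OF X]
  have oY: "ob Y n \<in> Obj D" using cpx_ob[OF Y'(1)] by simp
  have dY: "df Y n \<in> Hom D (ob Y n) ?C" using cpx_df[OF Y'(1), of n] f'(5) by simp
  \<comment> \<open>this extension is shown to be trivial\<close>
  let ?\<theta> = "pull D G (df Y n) ?A \<delta>"
  have \<theta>: "?\<theta> \<in> Ext (ob Y n) ?A" using pull_closed[OF oX(1) dY dist_carrier[OF X]] .
  obtain P where P: "dist P ?\<theta>" "ob P 0 = ?A" "ob P (Suc n) = ob Y n"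
    using realise[OF oY oX(1) \<theta>] .
  note Pc = dist_cpx[OF P(1)]
  obtain g where g: "chain_map D (Suc n) P X g" "g 0 = idn D ?A" "g (Suc n) = df Y n"
    using dist_lift[OF P(1) X, of "idn D ?A" "df Y n"] P(2,3) dY \<theta> oX oY by (auto simp: idn_hom push_idn)
  note e = chain_map_comp[OF Pc Xc Y'(1) g(1) f'(1)]
  have last: "f (Suc n) ** g (Suc n) = df Y n ** idn D (ob Y n)"
    using dY oX oY by (simp add: f'(3) g(3) in_Hom idn_left' idn_right')
  have first: "f 0 ** g 0 = idn D ?A" using oX by (simp add: f'(2) g(2) idn_left' idn_typing)
  obtain h where h: "h \<in> Hom D (ob P 1) (ob Y 0)" "idn D ?A = h ** df P 0"
    using first_component_factors[OF Pc Y e order_refl _ last] P(3) oY first by (auto simp: idn_hom)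
  have dP: "df P 0 \<in> Hom D ?A (ob P (Suc 0))" using cpx_df[OF Pc, of 0] P(2) by simp
  have h': "h \<in> Hom D (ob P (Suc 0)) ?A" using h(1) f'(4) by simp
  have "?\<theta> = push D G (ob Y n) (h ** df P 0) ?\<theta>" using h(2) push_idn[OF oY oX(1) \<theta>] by simp
  also have "\<dots> = \<one>\<^bsub>grp G (ob Y n) ?A\<^esub>"
    using push_comp[OF oY dP h' \<theta>] dist_push[OF P(1)] P(2,3) push_one[OF oY h'] by simp
  finally have split: "?\<theta> = \<one>\<^bsub>grp G (ob Y n) ?A\<^esub>" .
  obtain k where k: "k \<in> Hom D (ob Y n) (ob X n)" "df Y n = df X n ** k"
    using dist_factor_right[OF X dY split] by blast
  have "df X n ** k = idn D ?C ** df Y n" using k dY by (simp add: in_Hom idn_left')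
  then obtain q where q: "chain_map D (Suc n) Y X q" "q (Suc n) = idn D ?C"
    using dist_chain_map_of_square[OF Y Xe order_refl k(1), of "idn D ?C"] f'(5) oX by (auto simp: idn_hom)
  have fq: "chain_map D (Suc n) Y Y (\<lambda>i. f i ** q i)" using chain_map_comp[OF Y'(1) Xc Y'(1) q(1) f'(1)] .
  obtain s where s: "s \<in> Hom D (ob Y (Suc 0)) (ob Y 0)" "f 0 ** q 0 \<boxplus> \<boxminus> idn D (ob Y 0) = s ** df Y 0"
    using equal_last_imp_first_factors[OF Y'(1) Y fq chain_map_idn[OF Y'(1)]] q(2) f'(3,5) oX
    by (auto simp: idn_left' idn_typing)
  have q0: "q 0 \<in> Hom D ?A ?A" using chain_map_hom[OF q(1), of 0] f'(4) by simp
  have s0: "s ** df Y 0 \<in> Hom D ?A ?A" using comp_hom[OF cpx_df[OF Y'(1), of 0] s(1)] f'(4) by simp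
  have adj: "q 0 \<boxplus> \<boxminus> (s ** df Y 0) = idn D ?A"
    using idn_minus_solve[OF oX(1) q0 _ s0] s(2) f'(2,4) q0 by (simp add: idn_left' in_Hom)
  have z: "zr (ob Y (Suc n)) (ob X n) \<in> Hom D (ob Y (Suc n)) (ob X n)"
    using zero_hom oX dist_obj(1)[OF X, of n] f'(5) by simp
  have s': "s \<in> Hom D (ob Y 1) (ob X 0)" using s(1) f'(4) by simp
  obtain q' where q': "chain_map D (Suc n) Y X q'" "q' 0 = q 0 \<boxplus> \<boxminus> (s ** df Y 0)"
      "q' (Suc n) = q (Suc n) \<boxplus> \<boxminus> (df X n ** zr (ob Y (Suc n)) (ob X n))"
    using chain_map_adjust_ends[OF Y'(1) Xc n_pos q(1) s' z] by blast
  have "q' (Suc n) = idn D ?C"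
    using q'(3) q(2) oX f'(5) by (simp add: comp_zero neg_zero cpx_df_typing[OF Xc] add_zero idn_typing)
  then have "chain_map_between D n Y X q'"
    using q' adj f'(4,5) by (simp add: chain_map_between_def)
  then show ?thesis using dist_transport[OF X Y f] by blast
qed

text \<open>
  The dual argument, with the pushout of \<open>\<delta>\<close> along the first differential of \<open>X\<close>.
\<close>

lemma dist_of_chain_map_to:
  assumes X: "n_exact_seq D n X" and Y: "dist Y \<delta>" and f: "chain_map_between D n X Y f"
  shows "dist X \<delta>"
proof -
  let ?A = "ob Y 0" and ?C = "ob Y (Suc n)"
  note Yc = dist_cpx[OF Y] and Ye = dist_exact[OF Y] and X' = n_exact_seqD[OF X]
  note f' = chain_map_between_ends[OF X'(1) f]
  note oY = dist_obj(2,3)[OF Y]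
  have oX: "ob X (Suc 0) \<in> Obj D" using cpx_ob[OF X'(1)] by simp
  have dX: "df X 0 \<in> Hom D ?A (ob X (Suc 0))" using cpx_df[OF X'(1), of 0] f'(4) by simp
  \<comment> \<open>this extension is shown to be trivial\<close>
  let ?\<theta> = "push D G ?C (df X 0) \<delta>"
  have \<theta>: "?\<theta> \<in> Ext ?C (ob X (Suc 0))" using push_closed[OF oY(2) dX dist_carrier[OF Y]] .
  obtain P where P: "dist P ?\<theta>" "ob P 0 = ob X (Suc 0)" "ob P (Suc n) = ?C"
    using realise[OF oY(2) oX \<theta>] .
  note Pc = dist_cpx[OF P(1)]
  obtain g where g: "chain_map D (Suc n) Y P g" "g 0 = df X 0" "g (Suc n) = idn D ?C"
    using dist_lift[OF Y P(1), of "df X 0" "idn D ?C"] P(2,3) dX \<theta> oX oY by (auto simp: idn_hom pull_idn)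
  note e = chain_map_comp[OF X'(1) Yc Pc f'(1) g(1)]
  have first: "g 0 ** f 0 = idn D (ob X (Suc 0)) ** df X 0"
    using dX oX oY f'(4) by (simp add: f'(2) g(2) in_Hom idn_left' idn_right')
  have last: "g (Suc n) ** f (Suc n) = idn D ?C" using oY f'(5) by (simp add: f'(3) g(3) idn_left' idn_typing)
  obtain h where h: "h \<in> Hom D (ob X (Suc n)) (ob P n)" "idn D ?C = df P n ** h"
    using last_component_factors[OF X Pc e _ _ first] P(2) oX last by (auto simp: idn_hom)
  have dP: "df P n \<in> Hom D (ob P n) ?C" using cpx_df[OF Pc, of n] P(3) by simp
  have h': "h \<in> Hom D ?C (ob P n)" using h(1) f'(5) by simp
  have "?\<theta> = pull D G (df P n ** h) (ob X (Suc 0)) ?\<theta>" using h(2) pull_idn[OF oY(2) oX \<theta>] by simp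
  also have "\<dots> = \<one>\<^bsub>grp G ?C (ob X (Suc 0))\<^esub>"
    using pull_comp[OF oX dP h' \<theta>] dist_pull[OF P(1)] P(2,3) pull_one[OF oX h'] by simp
  finally have split: "?\<theta> = \<one>\<^bsub>grp G ?C (ob X (Suc 0))\<^esub>" .
  obtain k where k: "k \<in> Hom D (ob Y (Suc 0)) (ob X (Suc 0))" "df X 0 = k ** df Y 0"
    using dist_factor_left[OF Y dX split] by blast
  have "df X 0 ** idn D ?A = k ** df Y 0" using k dX by (simp add: in_Hom idn_right')
  then obtain q where q: "chain_map D (Suc n) Y X q" "q 0 = idn D ?A"
    using dist_chain_map_of_square[OF Ye X _ _ k(1), of "idn D ?A"] f'(4) oY by (auto simp: idn_hom)
  have qf: "chain_map D (Suc n) X X (\<lambda>i. q i ** f i)" using chain_map_comp[OF X'(1) Yc X'(1) f'(1) q(1)] .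
  obtain s where s: "s \<in> Hom D (ob X (Suc n)) (ob X n)"
      "q (Suc n) ** f (Suc n) \<boxplus> \<boxminus> idn D (ob X (Suc n)) = df X n ** s"
    using equal_first_imp_last_factors[OF X X'(1) qf chain_map_idn[OF X'(1)]] q(2) f'(2,4) oY
    by (auto simp: idn_left' idn_typing)
  have q1: "q (Suc n) \<in> Hom D ?C ?C" using chain_map_hom[OF q(1), of "Suc n"] f'(5) by simp
  have s1: "df X n ** s \<in> Hom D ?C ?C" using comp_hom[OF s(1) cpx_df[OF X'(1), of n]] f'(5) by simp
  have adj: "q (Suc n) \<boxplus> \<boxminus> (df X n ** s) = idn D ?C"
    using idn_minus_solve[OF oY(2) q1 _ s1] s(2) f'(3,5) q1 by (simp add: idn_right' in_Hom)
  have z: "zr (ob Y 1) (ob X 0) \<in> Hom D (ob Y 1) (ob X 0)"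
    using zero_hom oY dist_obj(1)[OF Y, of 1] f'(4) by simp
  have s': "s \<in> Hom D (ob Y (Suc n)) (ob X n)" using s(1) f'(5) by simp
  obtain q' where q': "chain_map D (Suc n) Y X q'" "q' 0 = q 0 \<boxplus> \<boxminus> (zr (ob Y 1) (ob X 0) ** df Y 0)"
      "q' (Suc n) = q (Suc n) \<boxplus> \<boxminus> (df X n ** s)"
    using chain_map_adjust_ends[OF Yc X'(1) n_pos q(1) z s'] by blast
  have "q' 0 = idn D ?A"
    using q'(2) q(2) oY f'(4) by (simp add: zero_comp neg_zero cpx_df_typing[OF Yc] add_zero idn_typing)
  then have "chain_map_between D n Y X q'"
    using q' adj f'(4,5) by (simp add: chain_map_between_def)
  moreover have "ob X 0 = ?A" "ob X (Suc n) = ?C" using f'(4,5) by simp_all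
  ultimately show ?thesis using dist_transport[OF Y X _ f] by blast
qed

text \<open>
  In a general n-exangulated category a chain map between distinguished n-exangles need not be a
  morphism of extensions: in a triangulated category, the complex from \<open>A\<close> over 0 to \<open>C\<close> realises
  every isomorphism from \<open>C\<close> to the shift of \<open>A\<close>. Here it is one. The two extensions to be compared, \<open>f\<^sub>0\<close> pushing \<open>\<delta>\<close> forward and
  \<open>f\<^sub>n\<^sub>+\<^sub>1\<close> pulling \<open>\<rho>\<close> back, are combined into one extension \<open>\<sigma>\<close> by the biproduct of two copies
  of the left end of \<open>Y\<close>. Since the last differential of \<open>X\<close> kills \<open>\<sigma>\<close>, there is a chain map
  \<open>w\<close> from \<open>X\<close> to a realisation \<open>W\<close> of \<open>\<sigma>\<close> with an identity at the right end. Both projections of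
  \<open>w 0\<close> agree with \<open>f 0\<close> up to arrows factoring through the first differential of \<open>X\<close>, so the
  difference of the projections sends \<open>w 0\<close> to such an arrow. Carried over to the right end, this
  says that the realisation of the difference of the two extensions splits.
\<close>

lemma chain_map_is_extension_morphism:
  assumes X: "dist X \<delta>" and Y: "dist Y \<rho>" and f: "chain_map D (Suc n) X Y f"
  shows "push D G (ob X (Suc n)) (f 0) \<delta> = pull D G (f (Suc n)) (ob Y 0) \<rho>"
proof -
  let ?A = "ob X 0" and ?C = "ob X (Suc n)" and ?B = "ob Y 0"
  note Xc = dist_cpx[OF X] and Xe = dist_exact[OF X] and Yc = dist_cpx[OF Y] and Ye = dist_exact[OF Y]
  note oX = dist_obj(2,3)[OF X] and oY = dist_obj(2,3)[OF Y]
  note \<delta> = dist_carrier[OF X] and \<rho> = dist_carrier[OF Y]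
  have f0: "f 0 \<in> Hom D ?A ?B" and fl: "f (Suc n) \<in> Hom D ?C (ob Y (Suc n))" and fn: "f n \<in> Hom D (ob X n) (ob Y n)"
    using chain_map_hom[OF f] by simp_all
  have dX: "df X n \<in> Hom D (ob X n) ?C" and dY: "df Y n \<in> Hom D (ob Y n) (ob Y (Suc n))"
    using cpx_df[OF Xc] cpx_df[OF Yc] by simp_all
  let ?\<delta>1 = "push D G ?C (f 0) \<delta>" and ?\<delta>2 = "pull D G (f (Suc n)) ?B \<rho>"
  have d1: "?\<delta>1 \<in> Ext ?C ?B" using push_closed[OF oX(2) f0 \<delta>] .
  have d2: "?\<delta>2 \<in> Ext ?C ?B" using pull_closed[OF oY(1) fl \<rho>] .
  interpret B: comm_group "grp G ?C ?B" using grp_comm_group oX oY by blast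
  have kill1: "pull D G (df X n) ?B ?\<delta>1 = \<one>\<^bsub>grp G (ob X n) ?B\<^esub>"
    using push_pull_commute[OF dX f0 \<delta>] dist_pull[OF X] push_one[OF Hom_obj(1)[OF dX] f0] by simp
  have kill2: "pull D G (df X n) ?B ?\<delta>2 = \<one>\<^bsub>grp G (ob X n) ?B\<^esub>"
    using pull_comp[OF oY(1) fl dX \<rho>] pull_comp[OF oY(1) dY fn \<rho>] chain_map_comm[OF f, of n]
      dist_pull[OF Y] pull_one[OF oY(1) fn] by simp
  obtain S i1 i2 p1 p2 where "is_biproduct D ?B ?B (S, i1, i2, p1, p2)"
    using ex_biproduct[OF oY(1) oY(1)] by (metis prod_cases5)
  then have S: "S \<in> Obj D" and i: "i1 \<in> Hom D ?B S" "i2 \<in> Hom D ?B S" and p: "p1 \<in> Hom D S ?B" "p2 \<in> Hom D S ?B"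
    and pi: "p1 ** i1 = idn D ?B" "p2 ** i2 = idn D ?B" "p2 ** i1 = zr ?B ?B" "p1 ** i2 = zr ?B ?B"
    by (simp_all add: is_biproduct_def)
  let ?\<sigma>1 = "push D G ?C i1 ?\<delta>1" and ?\<sigma>2 = "push D G ?C i2 ?\<delta>2"
  let ?\<sigma> = "?\<sigma>1 \<otimes>\<^bsub>grp G ?C S\<^esub> ?\<sigma>2"
  interpret S: comm_group "grp G ?C S" using grp_comm_group oX S by blast
  interpret XS: comm_group "grp G (ob X n) S" using grp_comm_group Hom_obj[OF dX] S by blast
  have \<sigma>12: "?\<sigma>1 \<in> Ext ?C S" "?\<sigma>2 \<in> Ext ?C S"
    using push_closed[OF oX(2) i(1) d1] push_closed[OF oX(2) i(2) d2] .
  then have \<sigma>: "?\<sigma> \<in> Ext ?C S" by simp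
  have p\<sigma>: "push D G ?C p1 ?\<sigma>1 = ?\<delta>1" "push D G ?C p1 ?\<sigma>2 = \<one>\<^bsub>grp G ?C ?B\<^esub>"
    "push D G ?C p2 ?\<sigma>1 = \<one>\<^bsub>grp G ?C ?B\<^esub>" "push D G ?C p2 ?\<sigma>2 = ?\<delta>2"
    using push_comp[OF oX(2) i(1) p(1) d1, symmetric] push_comp[OF oX(2) i(2) p(1) d2, symmetric]
      push_comp[OF oX(2) i(1) p(2) d1, symmetric] push_comp[OF oX(2) i(2) p(2) d2, symmetric]
      push_idn[OF oX(2) oY(1) d1] push_zero[OF oX(2) oY(1) oY(1) d2]
      push_idn[OF oX(2) oY(1) d2] push_zero[OF oX(2) oY(1) oY(1) d1] pi by simp_all
  have p1\<sigma>: "push D G ?C p1 ?\<sigma> = ?\<delta>1"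
    using push_mult[OF oX(2) p(1) \<sigma>12] p\<sigma>(1,2) d1 by simp
  have p2\<sigma>: "push D G ?C p2 ?\<sigma> = ?\<delta>2"
    using push_mult[OF oX(2) p(2) \<sigma>12] p\<sigma>(3,4) d2 by simp
  have "pull D G (df X n) S ?\<sigma>1 = \<one>\<^bsub>grp G (ob X n) S\<^esub>"
    using push_pull_commute[OF dX i(1) d1] kill1 push_one[OF Hom_obj(1)[OF dX] i(1)] by simp
  moreover have "pull D G (df X n) S ?\<sigma>2 = \<one>\<^bsub>grp G (ob X n) S\<^esub>"
    using push_pull_commute[OF dX i(2) d2] kill2 push_one[OF Hom_obj(1)[OF dX] i(2)] by simp
  ultimately have kill: "pull D G (df X n) S ?\<sigma> = \<one>\<^bsub>grp G (ob X n) S\<^esub>"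
    using pull_mult[OF S dX \<sigma>12] by simp
  obtain W where W: "dist W ?\<sigma>" "ob W 0 = S" "ob W (Suc n) = ?C" using realise[OF oX(2) S \<sigma>] .
  note Wc = dist_cpx[OF W(1)] and We = dist_exact[OF W(1)]
  have "df X n \<in> Hom D (ob X n) (ob W (Suc n))" "pull D G (df X n) (ob W 0) ?\<sigma> = \<one>\<^bsub>grp G (ob X n) (ob W 0)\<^esub>"
    using dX W kill by simp_all
  from dist_factor_right[OF W(1) this] obtain k where k: "k \<in> Hom D (ob X n) (ob W n)" "df X n = df W n ** k"
    by blast
  have "df W n ** k = idn D ?C ** df X n" using k(2)[symmetric] dX by (simp add: in_Hom idn_left')
  then obtain w where w: "chain_map D (Suc n) X W w" "w (Suc n) = idn D ?C"
    using dist_chain_map_of_square[OF Xe We order_refl k(1), of "idn D ?C"] W(3) oX by (auto simp: idn_hom)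
  have w0: "w 0 \<in> Hom D ?A S" using chain_map_hom[OF w(1), of 0] W(2) by simp
  \<comment> \<open>the first projection of \<open>w 0\<close>: compare \<open>w\<close>, followed by a lift of \<open>p1\<close>, with a lift of \<open>f 0\<close>\<close>
  obtain U where U: "dist U ?\<delta>1" "ob U 0 = ?B" "ob U (Suc n) = ?C" using realise[OF oX(2) oY(1) d1] .
  note Uc = dist_cpx[OF U(1)] and Ue = dist_exact[OF U(1)]
  obtain u where u: "chain_map D (Suc n) X U u" "u 0 = f 0" "u (Suc n) = idn D ?C"
    using dist_lift[OF X U(1), of "f 0" "idn D ?C"] f0 U(2,3) oX oY d1 by (auto simp: idn_hom pull_idn)
  obtain v where v: "chain_map D (Suc n) W U v" "v 0 = p1" "v (Suc n) = idn D ?C"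
    using dist_lift[OF W(1) U(1), of p1 "idn D ?C"] p U(2,3) W(2,3) oX oY d1 p1\<sigma> by (auto simp: idn_hom pull_idn)
  have "v (Suc n) ** w (Suc n) = u (Suc n)" using v(3) w(2) u(3) oX by (simp add: idn_left' idn_typing)
  from equal_last_imp_first_factors[OF Xc Ue chain_map_comp[OF Xc Wc Uc w(1) v(1)] u(1) this]
  obtain h1 where h1: "h1 \<in> Hom D (ob X (Suc 0)) ?B" "p1 ** w 0 \<boxplus> \<boxminus> f 0 = h1 ** df X 0"
    using U(2) u(2) v(2) by auto
  \<comment> \<open>the second projection: lift \<open>p2\<close> directly to \<open>Y\<close> and compare with \<open>f\<close>\<close>
  obtain v' where v': "chain_map D (Suc n) W Y v'" "v' 0 = p2" "v' (Suc n) = f (Suc n)"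
    using dist_lift[OF W(1) Y, of p2 "f (Suc n)"] p W(2,3) fl p2\<sigma> by auto
  have "v' (Suc n) ** w (Suc n) = f (Suc n)" using v'(3) w(2) fl by (simp add: in_Hom idn_right')
  from equal_last_imp_first_factors[OF Xc Ye chain_map_comp[OF Xc Wc Yc w(1) v'(1)] f this]
  obtain h2 where h2: "h2 \<in> Hom D (ob X (Suc 0)) ?B" "p2 ** w 0 \<boxplus> \<boxminus> f 0 = h2 ** df X 0"
    using v'(2) by auto
  let ?p = "p1 \<boxplus> \<boxminus> p2" and ?h = "h1 \<boxplus> \<boxminus> h2"
  have pp: "?p \<in> Hom D S ?B" using add_hom[OF p(1) neg_hom[OF p(2)]] .
  have hh: "?h \<in> Hom D (ob X (Suc 0)) ?B" using add_hom[OF h1(1) neg_hom[OF h2(1)]] .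
  have d0: "df X 0 \<in> Hom D ?A (ob X (Suc 0))" using cpx_df[OF Xc, of 0] by simp
  have a1: "p1 ** w 0 = h1 ** df X 0 \<boxplus> f 0"
    using minus_eq_iff[OF comp_hom[OF w0 p(1)] f0 comp_hom[OF d0 h1(1)]] h1(2) by simp
  have a2: "p2 ** w 0 = h2 ** df X 0 \<boxplus> f 0"
    using minus_eq_iff[OF comp_hom[OF w0 p(2)] f0 comp_hom[OF d0 h2(1)]] h2(2) by simp
  have "?p ** w 0 = p1 ** w 0 \<boxplus> \<boxminus> (p2 ** w 0)"
    using p w0 by (simp add: in_Hom add_comp neg_comp neg_typing)
  also have "\<dots> = h1 ** df X 0 \<boxplus> (f 0 \<boxplus> \<boxminus> f 0 \<boxplus> \<boxminus> (h2 ** df X 0))"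
    unfolding a1 a2 using h1(1) h2(1) f0 d0
    by (simp add: in_Hom neg_add comp_typing add_typing neg_typing add_assoc add_commute[of "\<boxminus> (h2 ** df X 0)"])
  also have "\<dots> = h1 ** df X 0 \<boxplus> \<boxminus> (h2 ** df X 0)"
    using h1(1) h2(1) f0 d0 by (simp add: in_Hom comp_typing neg_typing add_neg add_zero)
  also have "\<dots> = ?h ** df X 0"
    using h1(1) h2(1) d0 by (simp add: in_Hom add_comp neg_comp neg_typing)
  finally have ph: "?p ** w 0 = ?h ** df X 0" .
  \<comment> \<open>\<open>\<tau>\<close> is the difference of the two extensions; its realisation \<open>V\<close> splits\<close>
  let ?\<tau> = "push D G ?C ?p ?\<sigma>"
  have \<tau>: "?\<tau> \<in> Ext ?C ?B" using push_closed[OF oX(2) pp \<sigma>] .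
  have \<tau>eq: "?\<tau> = ?\<delta>1 \<otimes>\<^bsub>grp G ?C ?B\<^esub> inv\<^bsub>grp G ?C ?B\<^esub> ?\<delta>2"
    using push_plus[OF oX(2) p(1) neg_hom[OF p(2)] \<sigma>] push_neg[OF oX(2) p(2) \<sigma>] p1\<sigma> p2\<sigma> by simp
  obtain V where V: "dist V ?\<tau>" "ob V 0 = ?B" "ob V (Suc n) = ?C" using realise[OF oX(2) oY(1) \<tau>] .
  note Vc = dist_cpx[OF V(1)]
  obtain z where z: "chain_map D (Suc n) W V z" "z 0 = ?p" "z (Suc n) = idn D ?C"
    using dist_lift[OF W(1) V(1), of ?p "idn D ?C"] pp V(2,3) W(2,3) oX oY \<tau> by (auto simp: idn_hom pull_idn)
  have zw0: "z 0 ** w 0 = ?h ** df X 0" using z(2) ph by simp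
  have zw1: "z (Suc n) ** w (Suc n) = idn D ?C" using z(3) w(2) oX by (simp add: idn_left' idn_typing)
  have hh': "?h \<in> Hom D (ob X (Suc 0)) (ob V 0)" using hh V(2) by simp
  obtain s where s: "s \<in> Hom D ?C (ob V n)" "idn D ?C = df V n ** s"
    using last_component_factors[OF Xe Vc chain_map_comp[OF Xc Wc Vc w(1) z(1)] _ hh' zw0] zw1 by auto
  have dV: "df V n \<in> Hom D (ob V n) ?C" using cpx_df[OF Vc, of n] V(3) by simp
  have "?\<tau> = pull D G (df V n ** s) ?B ?\<tau>" using s(2) pull_idn[OF oX(2) oY(1) \<tau>] by simp
  also have "\<dots> = \<one>\<^bsub>grp G ?C ?B\<^esub>"
    using pull_comp[OF oY(1) dV s(1) \<tau>] dist_pull[OF V(1)] V(2,3) pull_one[OF oY(1) s(1)] by simp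
  finally have "?\<delta>1 \<otimes>\<^bsub>grp G ?C ?B\<^esub> inv\<^bsub>grp G ?C ?B\<^esub> ?\<delta>2 = \<one>\<^bsub>grp G ?C ?B\<^esub>" using \<tau>eq by simp
  then have "inv\<^bsub>grp G ?C ?B\<^esub> ?\<delta>1 = inv\<^bsub>grp G ?C ?B\<^esub> ?\<delta>2"
    using B.inv_unique'[OF d1 B.inv_closed[OF d2]] B.inv_comm d1 d2 by simp
  then show ?thesis using d1 d2 B.inv_inj inj_onD[of "m_inv (grp G ?C ?B)"] by simp
qed

text \<open>
  The case of the identity chain map; this makes the realisation injective.
\<close>

lemma dist_unique:
  assumes "dist X \<delta>" "dist X \<delta>'"
  shows "\<delta> = \<delta>'"
proof -
  note oX = dist_obj(2,3)[OF assms(1)]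
  show ?thesis
    using chain_map_is_extension_morphism[OF assms chain_map_idn[OF dist_cpx[OF assms(1)]]]
      push_idn[OF oX(2,1) dist_carrier[OF assms(1)]] pull_idn[OF oX(2,1) dist_carrier[OF assms(2)]] by simp
qed

text \<open>
  A weak isomorphism need not be invertible at the ends of the complexes, because \<open>X\<close> and \<open>Y\<close> may
  differ by contractible summands. What survives are one-sided inverses \<open>a\<close> and \<open>c\<close> of its end
  components up to arrows that factor through the outer differentials. They suffice to transport
  \<open>\<delta>\<close> to an extension \<open>\<rho>\<close> between the ends of \<open>Y\<close> and to map its realisation to \<open>Y\<close>; correcting
  this chain map at the ends reduces the claim to the case of identities.
\<close>

lemma dist_of_almost_iso_ends:
  assumes X: "dist X \<delta>" and Y: "n_exact_seq D n Y" and f: "chain_map D (Suc n) X Y f"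
    and a: "a \<in> Hom D (ob Y 0) (ob X 0)" and c: "c \<in> Hom D (ob Y (Suc n)) (ob X (Suc n))"
    and h: "h \<in> Hom D (ob X (Suc 0)) (ob X 0)" "a ** f 0 \<boxplus> \<boxminus> idn D (ob X 0) = h ** df X 0"
    and t: "t \<in> Hom D (ob Y (Suc n)) (ob Y n)" "f (Suc n) ** c \<boxplus> \<boxminus> idn D (ob Y (Suc n)) = df Y n ** t"
  shows "conflation n D G r Y"
proof -
  let ?A = "ob X 0" and ?C = "ob X (Suc n)" and ?B = "ob Y 0" and ?E = "ob Y (Suc n)"
  note Xc = dist_cpx[OF X] and Y' = n_exact_seqD[OF Y] and \<delta> = dist_carrier[OF X]
  note oX = dist_obj(2,3)[OF X]
  have oY: "?B \<in> Obj D" "?E \<in> Obj D" using cpx_ob[OF Y'(1)] by simp_all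
  have f0: "f 0 \<in> Hom D ?A ?B" and fl: "f (Suc n) \<in> Hom D ?C ?E" using chain_map_hom[OF f] by simp_all
  have dX: "df X 0 \<in> Hom D ?A (ob X (Suc 0))" using cpx_df[OF Xc] by simp
  let ?\<epsilon> = "pull D G c ?A \<delta>"
  have \<epsilon>: "?\<epsilon> \<in> Ext ?E ?A" using pull_closed[OF oX(1) c \<delta>] .
  let ?\<rho> = "push D G ?E (f 0) ?\<epsilon>"
  have \<rho>: "?\<rho> \<in> Ext ?E ?B" using push_closed[OF oY(2) f0 \<epsilon>] .
  have kill: "push D G ?E (df X 0) ?\<epsilon> = \<one>\<^bsub>grp G ?E (ob X (Suc 0))\<^esub>"
    using push_pull_commute[OF c dX \<delta>] dist_push[OF X] pull_one[OF Hom_obj(2)[OF dX] c] by simp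
  have af: "a ** f 0 \<in> Hom D ?A ?A" using comp_hom[OF f0 a] .
  have "push D G ?E (a ** f 0) ?\<epsilon> = ?\<epsilon>"
    using push_eq_of_factor[OF oY(2) af dX h(1) h(2) \<epsilon> kill] .
  then have a\<rho>: "push D G ?E a ?\<rho> = ?\<epsilon>" using push_comp[OF oY(2) f0 a \<epsilon>] by simp
  obtain W where W: "dist W ?\<rho>" "ob W 0 = ?B" "ob W (Suc n) = ?E" using realise[OF oY(2,1) \<rho>] .
  note Wc = dist_cpx[OF W(1)]
  obtain v where v: "chain_map D (Suc n) W X v" "v 0 = a" "v (Suc n) = c"
    using dist_lift[OF W(1) X, of a c] a c W(2,3) a\<rho> by auto
  let ?p = "\<lambda>i. f i ** v i"
  have p: "chain_map D (Suc n) W Y ?p" using chain_map_comp[OF Wc Xc Y'(1) v(1) f] .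
  have fa: "f 0 ** a \<in> Hom D ?B ?B" using comp_hom[OF a f0] .
  let ?e = "f 0 ** a \<boxplus> \<boxminus> idn D ?B"
  have e: "?e \<in> Hom D ?B ?B" using add_hom[OF fa neg_hom[OF idn_hom[OF oY(1)]]] .
  interpret g: comm_group "grp G ?E ?B" using grp_comm_group oY by blast
  have "push D G ?E (f 0 ** a) ?\<rho> = ?\<rho>" using push_comp[OF oY(2) a f0 \<rho>] a\<rho> by simp
  then have "push D G ?E ?e ?\<rho> = \<one>\<^bsub>grp G ?E ?B\<^esub>"
    using push_plus[OF oY(2) fa neg_hom[OF idn_hom[OF oY(1)]] \<rho>] push_neg[OF oY(2) idn_hom[OF oY(1)] \<rho>]
      push_idn[OF oY(2,1) \<rho>] \<rho> by simp
  then obtain s where s: "s \<in> Hom D (ob W (Suc 0)) ?B" "?e = s ** df W 0"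
    using dist_factor_left[OF W(1), of ?e ?B] e W(2,3) by auto
  have s1: "s \<in> Hom D (ob W 1) (ob Y 0)" using s(1) by simp
  have t1: "t \<in> Hom D (ob W (Suc n)) (ob Y n)" using t(1) W(3) by simp
  obtain q where q: "chain_map D (Suc n) W Y q" "q 0 = ?p 0 \<boxplus> \<boxminus> (s ** df W 0)"
      "q (Suc n) = ?p (Suc n) \<boxplus> \<boxminus> (df Y n ** t)"
    using chain_map_adjust_ends[OF Wc Y'(1) n_pos p s1 t1] by blast
  have "q 0 = idn D ?B"
    using q(2) idn_minus_solve[OF oY(1) fa s(2)] e s(2) v(2) by simp
  moreover have "q (Suc n) = idn D ?E"
    using q(3) idn_minus_solve[OF oY(2) comp_hom[OF c fl] t(2) comp_hom[OF t(1) cpx_df[OF Y'(1)]]] v(3) by simp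
  ultimately have "chain_map_between D n W Y q" using q(1) W(2,3) by (simp add: chain_map_between_def)
  then have "dist Y ?\<rho>" using dist_of_chain_map_from[OF W(1) Y] by blast
  then show ?thesis unfolding conflation_def by blast
qed

end

section \<open>Matrices and mapping cones\<close>

context additive_category
begin

lemma biprod_props:
  assumes "A \<in> Obj D" "B \<in> Obj D"
  shows "is_biproduct D A B (dsum D A B, in1 D A B, in2 D A B, pr1 D A B, pr2 D A B)"
proof -
  have "is_biproduct D A B (biprod D A B)"
    unfolding biprod_def using someI_ex[OF ex_biproduct[OF assms]] .
  then show ?thesis
    by (cases "biprod D A B") (simp add: dsum_def in1_def in2_def pr1_def pr2_def)
qed

lemma biprod_simps:
  assumes "A \<in> Obj D" "B \<in> Obj D"
  shows "dsum D A B \<in> Obj D"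
    "in1 D A B \<in> Arr D" "Dom D (in1 D A B) = A" "Cod D (in1 D A B) = dsum D A B"
    "in2 D A B \<in> Arr D" "Dom D (in2 D A B) = B" "Cod D (in2 D A B) = dsum D A B"
    "pr1 D A B \<in> Arr D" "Dom D (pr1 D A B) = dsum D A B" "Cod D (pr1 D A B) = A"
    "pr2 D A B \<in> Arr D" "Dom D (pr2 D A B) = dsum D A B" "Cod D (pr2 D A B) = B"
    "pr1 D A B ** in1 D A B = idn D A" "pr2 D A B ** in2 D A B = idn D B"
    "pr2 D A B ** in1 D A B = zr A B" "pr1 D A B ** in2 D A B = zr B A"
    "(in1 D A B ** pr1 D A B) \<boxplus> (in2 D A B ** pr2 D A B) = idn D (dsum D A B)"
  using biprod_props[OF assms] by (simp_all add: is_biproduct_def in_Hom)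

lemma col_typing:
  assumes "f \<in> Arr D" "g \<in> Arr D" "Dom D f = Dom D g"
  shows "col D f g \<in> Arr D" "Dom D (col D f g) = Dom D g" "Cod D (col D f g) = dsum D (Cod D f) (Cod D g)"
  using assms by (simp_all add: col_def cat_simps biprod_simps)

lemma row_typing:
  assumes "f \<in> Arr D" "g \<in> Arr D" "Cod D f = Cod D g"
  shows "row D f g \<in> Arr D" "Dom D (row D f g) = dsum D (Dom D f) (Dom D g)" "Cod D (row D f g) = Cod D g"
  using assms by (simp_all add: row_def cat_simps biprod_simps)

lemma mat_typing:
  assumes "a \<in> Arr D" "b \<in> Arr D" "c \<in> Arr D" "d \<in> Arr D"
    "Cod D a = Cod D b" "Cod D c = Cod D d" "Dom D a = Dom D c" "Dom D b = Dom D d"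
  shows "mat D a b c d \<in> Arr D" "Dom D (mat D a b c d) = dsum D (Dom D c) (Dom D d)"
    "Cod D (mat D a b c d) = dsum D (Cod D b) (Cod D d)"
  using assms by (simp_all add: mat_def col_typing row_typing)

lemma pr_in_comp:
  assumes "f \<in> Arr D" "A \<in> Obj D" "B \<in> Obj D"
  shows "Cod D f = A \<Longrightarrow> pr1 D A B ** (in1 D A B ** f) = f"
    "Cod D f = B \<Longrightarrow> pr2 D A B ** (in2 D A B ** f) = f"
    "Cod D f = A \<Longrightarrow> pr2 D A B ** (in1 D A B ** f) = zr (Dom D f) B"
    "Cod D f = B \<Longrightarrow> pr1 D A B ** (in2 D A B ** f) = zr (Dom D f) A"
  using assms by (simp_all add: comp_assoc'[symmetric] biprod_simps idn_left' zero_comp)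

lemma row_comp_col:
  assumes "p \<in> Arr D" "q \<in> Arr D" "e \<in> Arr D" "f \<in> Arr D"
    "Cod D p = Cod D q" "Dom D e = Dom D f" "Cod D e = Dom D p" "Cod D f = Dom D q"
  shows "row D p q ** col D e f = (p ** e) \<boxplus> (q ** f)"
  using assms by (simp add: row_def col_def cat_simps biprod_simps pr_in_comp)

lemma col_comp:
  assumes "e \<in> Arr D" "f \<in> Arr D" "g \<in> Arr D" "Dom D e = Dom D f" "Cod D g = Dom D f"
  shows "col D e f ** g = col D (e ** g) (f ** g)"
  using assms by (simp add: col_def cat_simps biprod_simps)

lemma comp_row:
  assumes "p \<in> Arr D" "q \<in> Arr D" "g \<in> Arr D" "Cod D p = Cod D q" "Dom D g = Cod D q"
  shows "g ** row D p q = row D (g ** p) (g ** q)"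
  using assms by (simp add: row_def cat_simps biprod_simps)

lemma row_add:
  assumes "p \<in> Arr D" "q \<in> Arr D" "p' \<in> Arr D" "q' \<in> Arr D" "Cod D p = Cod D q"
    "Dom D p = Dom D p'" "Dom D q = Dom D q'" "Cod D p = Cod D p'" "Cod D q = Cod D q'"
  shows "row D p q \<boxplus> row D p' q' = row D (p \<boxplus> p') (q \<boxplus> q')"
proof -
  let ?a = "p ** pr1 D (Dom D p) (Dom D q)" and ?b = "q ** pr2 D (Dom D p) (Dom D q)"
    and ?c = "p' ** pr1 D (Dom D p) (Dom D q)" and ?d = "q' ** pr2 D (Dom D p) (Dom D q)"
  have "?b \<boxplus> (?c \<boxplus> ?d) = ?c \<boxplus> (?b \<boxplus> ?d)"
    by (rule add_left_commute) (use assms in \<open>simp_all add: cat_simps biprod_simps\<close>)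
  then show ?thesis using assms by (simp add: row_def cat_simps biprod_simps)
qed

lemma neg_col:
  assumes "e \<in> Arr D" "f \<in> Arr D" "Dom D e = Dom D f"
  shows "\<boxminus> col D e f = col D (\<boxminus> e) (\<boxminus> f)"
  using assms by (simp add: col_def cat_simps biprod_simps)

lemma neg_row:
  assumes "e \<in> Arr D" "f \<in> Arr D" "Cod D e = Cod D f"
  shows "\<boxminus> row D e f = row D (\<boxminus> e) (\<boxminus> f)"
  using assms by (simp add: row_def cat_simps biprod_simps)

lemma neg_mat:
  assumes "a \<in> Arr D" "b \<in> Arr D" "c \<in> Arr D" "d \<in> Arr D"
    "Cod D a = Cod D b" "Cod D c = Cod D d" "Dom D a = Dom D c" "Dom D b = Dom D d"
  shows "\<boxminus> mat D a b c d = mat D (\<boxminus> a) (\<boxminus> b) (\<boxminus> c) (\<boxminus> d)"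
  using assms by (simp add: mat_def neg_col neg_row row_typing)

lemma mat_comp_col:
  assumes "a \<in> Arr D" "b \<in> Arr D" "c \<in> Arr D" "d \<in> Arr D"
    "Cod D a = Cod D b" "Cod D c = Cod D d" "Dom D a = Dom D c" "Dom D b = Dom D d"
    "e \<in> Arr D" "f \<in> Arr D" "Dom D e = Dom D f" "Cod D e = Dom D c" "Cod D f = Dom D d"
  shows "mat D a b c d ** col D e f = col D ((a ** e) \<boxplus> (b ** f)) ((c ** e) \<boxplus> (d ** f))"
  using assms by (simp add: mat_def col_comp row_comp_col row_typing col_typing)

lemma row_comp_mat:
  assumes "a \<in> Arr D" "b \<in> Arr D" "c \<in> Arr D" "d \<in> Arr D"
    "Cod D a = Cod D b" "Cod D c = Cod D d" "Dom D a = Dom D c" "Dom D b = Dom D d"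
    "p \<in> Arr D" "q \<in> Arr D" "Cod D p = Cod D q" "Dom D p = Cod D b" "Dom D q = Cod D d"
  shows "row D p q ** mat D a b c d = row D ((p ** a) \<boxplus> (q ** c)) ((p ** b) \<boxplus> (q ** d))"
  using assms by (simp add: mat_def row_comp_col row_typing comp_row row_add comp_typing)

lemma mat_comp_mat:
  assumes "a \<in> Arr D" "b \<in> Arr D" "c \<in> Arr D" "d \<in> Arr D"
    "Cod D a = Cod D b" "Cod D c = Cod D d" "Dom D a = Dom D c" "Dom D b = Dom D d"
    "a' \<in> Arr D" "b' \<in> Arr D" "c' \<in> Arr D" "d' \<in> Arr D"
    "Cod D a' = Cod D b'" "Cod D c' = Cod D d'" "Dom D a' = Dom D c'" "Dom D b' = Dom D d'"
    "Dom D c = Cod D b'" "Dom D d = Cod D d'"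
  shows "mat D a b c d ** mat D a' b' c' d' =
    mat D ((a ** a') \<boxplus> (b ** c')) ((a ** b') \<boxplus> (b ** d')) ((c ** a') \<boxplus> (d ** c')) ((c ** b') \<boxplus> (d ** d'))"
proof -
  have "mat D a b c d ** mat D a' b' c' d' =
      col D (row D a b ** mat D a' b' c' d') (row D c d ** mat D a' b' c' d')"
    using assms unfolding mat_def[of D a b c d] by (simp add: col_comp row_typing mat_typing)
  then show ?thesis using assms by (simp add: row_comp_mat mat_def[of D "(a ** a') \<boxplus> (b ** c')"])
qed

lemma mat_zero:
  assumes "A \<in> Obj D" "B \<in> Obj D" "C \<in> Obj D" "E \<in> Obj D"
  shows "mat D (zr A C) (zr B C) (zr A E) (zr B E) = zr (dsum D A B) (dsum D C E)"
  using assms by (simp add: mat_def col_def row_def cat_simps biprod_simps)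

lemma idn_dsum:
  assumes "A \<in> Obj D" "B \<in> Obj D"
  shows "mat D (idn D A) (zr B A) (zr A B) (idn D B) = idn D (dsum D A B)"
  using assms by (simp add: mat_def col_def row_def cat_simps biprod_simps)

end

context preadditive_category
begin

lemma init_cpx_in:
  assumes "X \<in> cpxs D (Suc n)"
  shows "init_cpx n X \<in> cpxs D n"
  using assms by (simp add: cpxs_def init_cpx_def mk_cpx_def)

lemma tail_cpx_in:
  assumes "X \<in> cpxs D (Suc n)"
  shows "tail_cpx n X \<in> cpxs D n"
  using assms by (simp add: cpxs_def tail_cpx_def mk_cpx_def)

text \<open>
  Conjugating all differentials by involutions is an isomorphism of complexes.
\<close>

lemma conjugate_cpx:
  assumes N: "N \<in> cpxs D (Suc n)" and wc: "weak_cokernel_cpx D n N" and epi: "epic D (df N n)"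
    and \<phi>: "\<And>i. i \<le> Suc n \<Longrightarrow> \<phi> i \<in> Hom D (ob N i) (ob N i)"
    and inv: "\<And>i. i \<le> Suc n \<Longrightarrow> \<phi> i ** \<phi> i = idn D (ob N i)"
    and M: "M = mk_cpx (Suc n) (ob N) (\<lambda>i. \<phi> (Suc i) ** (df N i ** \<phi> i))"
  shows "M \<in> cpxs D (Suc n)" "contra_left_exact D n M"
proof -
  have ob: "ob M i = ob N i" if "i \<le> Suc n" for i using that by (simp add: M mk_cpx_def)
  have df: "df M i = \<phi> (Suc i) ** (df N i ** \<phi> i)" if "i < Suc n" for i using that by (simp add: M mk_cpx_def)
  have t: "\<phi> i \<in> Arr D" "Dom D (\<phi> i) = ob N i" "Cod D (\<phi> i) = ob N i" if "i \<le> Suc n" for i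
    using \<phi>[OF that] by (simp_all add: in_Hom)
  have canc: "\<phi> i ** (\<phi> i ** g) = g" if "i \<le> Suc n" "g \<in> Arr D" "Cod D g = ob N i" for i g
    using that t comp_assoc'[of g "\<phi> i" "\<phi> i"] inv by (simp add: idn_left')
  note tt = t category_simps cpx_df_typing[OF N] cpx_ob[OF N]
  show Mc: "M \<in> cpxs D (Suc n)"
    unfolding cpxs_def
  proof (intro CollectI conjI allI impI)
    show "ob M \<in> extensional {..Suc n}" "df M \<in> extensional {..<Suc n}" by (simp_all add: M mk_cpx_def)
    show "ob M i \<in> Obj D" if "i \<le> Suc n" for i using that by (simp add: ob cpx_ob[OF N])
    show "df M i \<in> Hom D (ob M i) (ob M (Suc i))" if "i < Suc n" for i using that by (simp add: ob df tt)
    show "df M (Suc i) ** df M i = zr (ob M i) (ob M (Suc (Suc i)))" if "Suc i < Suc n" for i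
      using that by (simp add: ob df tt canc cpx_df_df_comp[OF N] comp_zero)
  qed
  have "weak_cokernel_cpx D n M" unfolding weak_cokernel_cpx_def
  proof (intro allI impI ballI)
    fix i Z g assume i: "i < n" and g: "g \<in> Hom D (ob M (Suc i)) Z" and gz: "g ** df M i = zr (ob M i) Z"
    have gt: "g \<in> Arr D" "Dom D g = ob N (Suc i)" "Cod D g = Z" using g i by (simp_all add: in_Hom ob)
    have Z: "Z \<in> Obj D" using Hom_obj[OF g] by simp
    have "g ** \<phi> (Suc i) ** df N i = g ** df M i ** \<phi> i"
      using i gt inv by (simp add: df tt)
    also have "\<dots> = zr (ob N i) Z" unfolding gz using i Z by (simp add: ob zero_comp t)
    finally have z: "g ** \<phi> (Suc i) ** df N i = zr (ob N i) Z" .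
    have "g ** \<phi> (Suc i) \<in> Hom D (ob N (Suc i)) Z" using i gt by (simp add: tt)
    from weak_cokernelE[OF wc i this z] obtain k where
      k: "k \<in> Hom D (ob N (Suc (Suc i))) Z" "g ** \<phi> (Suc i) = k ** df N (Suc i)" .
    have "g = g ** \<phi> (Suc i) ** \<phi> (Suc i)" using i gt inv by (simp add: tt)
    also have "\<dots> = k ** \<phi> (Suc (Suc i)) ** df M (Suc i)"
      unfolding k(2) using k(1) i by (simp add: df tt canc)
    finally have "g = k ** \<phi> (Suc (Suc i)) ** df M (Suc i)" .
    moreover have "k ** \<phi> (Suc (Suc i)) \<in> Hom D (ob M (Suc (Suc i))) Z" using k(1) i by (simp add: ob tt)
    ultimately show "\<exists>k \<in> Hom D (ob M (Suc (Suc i))) Z. g = k ** df M (Suc i)" by blast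
  qed
  moreover have "epic D (df M n)" unfolding epic_def
  proof (intro conjI ballI impI)
    show "df M n \<in> Arr D" by (simp add: df tt)
    fix Z g h assume g: "g \<in> Hom D (Cod D (df M n)) Z" and h: "h \<in> Hom D (Cod D (df M n)) Z"
      and eq: "g ** df M n = h ** df M n"
    have c: "Cod D (df M n) = ob N (Suc n)" by (simp add: df tt)
    have gt: "g \<in> Arr D" "Dom D g = ob N (Suc n)" "Cod D g = Z" "h \<in> Arr D" "Dom D h = ob N (Suc n)" "Cod D h = Z"
      using g h c by (simp_all add: in_Hom)
    have "g ** \<phi> (Suc n) ** df N n = g ** df M n ** \<phi> n" using gt inv by (simp add: df tt)
    also have "\<dots> = h ** \<phi> (Suc n) ** df N n" unfolding eq using gt inv by (simp add: df tt)
    finally have "g ** \<phi> (Suc n) ** df N n = h ** \<phi> (Suc n) ** df N n" .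
    moreover have "g ** \<phi> (Suc n) \<in> Hom D (ob N (Suc n)) Z" "h ** \<phi> (Suc n) \<in> Hom D (ob N (Suc n)) Z"
      using gt by (simp_all add: tt)
    ultimately have "g ** \<phi> (Suc n) = h ** \<phi> (Suc n)"
      using epicD[OF epi cpx_df[OF N lessI]] by blast
    then have "g ** \<phi> (Suc n) ** \<phi> (Suc n) = h ** \<phi> (Suc n) ** \<phi> (Suc n)" by simp
    then show "g = h" using gt inv by (simp add: tt)
  qed
  ultimately show "contra_left_exact D n M" using contra_left_exact_iff[OF Mc] by blast
qed

end

context additive_category
begin

text \<open>
  The cone of an n-pushout diagram and the cone of the dual of (EA2) differ only in signs. The
  involutions relating them are the diagonal matrices with entries -1 and 1, with a sign that
  alternates with the degree because conjugation by these matrices alone turns every differential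
  but the first into the negative of the required one.
\<close>

lemma cone_eq_conjugate_Ncone:
  assumes X: "X \<in> cpxs D (Suc n)" and Y: "Y \<in> cpxs D (Suc n)" and f: "chain_map D (Suc n) X Y f"
    and n: "n \<ge> 1"
  defines "\<sigma> \<equiv> \<lambda>i. mat D (\<boxminus> idn D (ob X i)) (zr (ob Y (i - 1)) (ob X i))
                         (zr (ob X i) (ob Y (i - 1))) (idn D (ob Y (i - 1)))"
  defines "\<phi> \<equiv> \<lambda>i. let s = (if i = 0 then idn D (ob X 0) else if i = Suc n then idn D (ob Y n) else \<sigma> i)
                     in if i = 0 \<or> odd i then s else \<boxminus> s"
  shows "i \<le> Suc n \<Longrightarrow> \<phi> i \<in> Hom D (ob (Ncone D n X Y f) i) (ob (Ncone D n X Y f) i)"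
    and "i \<le> Suc n \<Longrightarrow> \<phi> i ** \<phi> i = idn D (ob (Ncone D n X Y f) i)"
    and "cone D n (init_cpx n X) (init_cpx n Y) f = mk_cpx (Suc n) (ob (Ncone D n X Y f))
           (\<lambda>i. \<phi> (Suc i) ** (df (Ncone D n X Y f) i ** \<phi> i))"
proof -
  let ?N = "Ncone D n X Y f"
  note ty = cpx_ob[OF X] cpx_ob[OF Y] cpx_df_typing[OF X] cpx_df_typing[OF Y] chain_map_typing[OF f]
    col_typing row_typing mat_typing biprod_simps(1)
  have N0: "ob ?N 0 = ob X 0" and Nl: "ob ?N (Suc n) = ob Y n"
    and Ni: "\<And>i. 0 < i \<Longrightarrow> i \<le> n \<Longrightarrow> ob ?N i = dsum D (ob X i) (ob Y (i - 1))"
    using n by (simp_all add: Ncone_def mk_cpx_def)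
  have s: "\<sigma> i \<in> Hom D (dsum D (ob X i) (ob Y (i - 1))) (dsum D (ob X i) (ob Y (i - 1)))"
    and ss: "\<sigma> i ** \<sigma> i = idn D (dsum D (ob X i) (ob Y (i - 1)))" if "i \<le> n" for i
    using that by (simp_all add: \<sigma>_def ty cat_simps mat_comp_mat idn_dsum)
  show ph: "\<phi> i \<in> Hom D (ob ?N i) (ob ?N i)" if i: "i \<le> Suc n" for i
  proof -
    consider "i = 0" | "0 < i" "i \<le> n" | "i = Suc n" using i by linarith
    then show ?thesis
    proof cases
      case 2
      then show ?thesis using s[of i] by (simp add: \<phi>_def Let_def Ni neg_hom)
    qed (simp_all add: \<phi>_def Let_def N0 Nl ty idn_hom neg_hom)
  qed
  show "\<phi> i ** \<phi> i = idn D (ob ?N i)" if i: "i \<le> Suc n" for i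
  proof -
    consider "i = 0" | "0 < i" "i \<le> n" | "i = Suc n" using i by linarith
    then show ?thesis
    proof cases
      case 2
      then show ?thesis using s[of i] ss[of i]
        by (simp add: \<phi>_def Let_def Ni in_Hom comp_neg neg_comp neg_neg neg_typing comp_typing idn_typing ty)
    qed (simp_all add: \<phi>_def Let_def N0 Nl ty cat_simps)
  qed
  have d0: "df ?N 0 = col D (df X 0) (f 0)"
    and dm: "\<And>i. 0 < i \<Longrightarrow> i < n \<Longrightarrow> df ?N i = mat D (df X i) (zr (ob Y (i - 1)) (ob X (i + 1))) (f i) (\<boxminus> df Y (i - 1))"
    and dn: "df ?N n = row D (f n) (\<boxminus> df Y (n - 1))"
    using n by (simp_all add: Ncone_def mk_cpx_def)
  let ?M = "cone D n (init_cpx n X) (init_cpx n Y) f"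
  have "df ?M i = \<phi> (Suc i) ** (df ?N i ** \<phi> i)" if i: "i < Suc n" for i
  proof -
    consider "i = 0" | j where "i = Suc j" "i < n" | "i = n"
      using i by (cases i) (auto simp: less_Suc_eq)
    then show ?thesis
    proof cases
      case 1
      then show ?thesis using n
        by (simp add: cone_def mk_cpx_def init_cpx_def d0 \<phi>_def Let_def \<sigma>_def ty cat_simps mat_comp_col)
    next
      case 2
      have "df ?M i = \<boxminus> (\<sigma> (Suc i) ** (df ?N i ** \<sigma> i))"
        using 2 by (simp add: cone_def mk_cpx_def init_cpx_def dm \<sigma>_def ty cat_simps mat_comp_mat neg_mat)
      moreover have "df ?N i \<in> Hom D (dsum D (ob X i) (ob Y (i - 1))) (dsum D (ob X (Suc i)) (ob Y i))"
        using 2 by (simp add: dm ty cat_simps)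
      ultimately show ?thesis using 2 s[of i] s[of "Suc i"]
        by (simp add: \<phi>_def Let_def in_Hom comp_neg neg_comp neg_neg neg_typing comp_typing)
    next
      case 3
      have "df ?M i = \<boxminus> (df ?N i ** \<sigma> i)"
        using 3 n by (simp add: cone_def mk_cpx_def init_cpx_def dn \<sigma>_def ty cat_simps row_comp_mat neg_row)
      moreover have "df ?N i \<in> Hom D (dsum D (ob X i) (ob Y (i - 1))) (ob Y n)"
        using 3 n by (simp add: dn ty cat_simps)
      ultimately show ?thesis using 3 n s[of i]
        by (simp add: \<phi>_def Let_def in_Hom comp_neg neg_comp neg_neg neg_typing comp_typing idn_typing idn_left' ty)
    qed
  qed
  moreover have "ob ?M i = ob ?N i" if "i \<le> Suc n" for i
    using that by (auto simp: cone_def Ncone_def mk_cpx_def init_cpx_def)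
  ultimately have "restrict (ob ?M) {..Suc n} = restrict (ob ?N) {..Suc n}"
    "restrict (df ?M) {..<Suc n} = restrict (\<lambda>i. \<phi> (Suc i) ** (df ?N i ** \<phi> i)) {..<Suc n}"
    by (auto intro!: restrict_ext)
  moreover have "?M = mk_cpx (Suc n) (ob ?M) (df ?M)" by (simp add: cone_def mk_cpx_def)
  ultimately show "?M = mk_cpx (Suc n) (ob ?N) (\<lambda>i. \<phi> (Suc i) ** (df ?N i ** \<phi> i))"
    by (simp add: mk_cpx_def)
qed

lemma n_pushout_of_Ncone:
  assumes X: "X \<in> cpxs D (Suc n)" and Y: "Y \<in> cpxs D (Suc n)" and f: "chain_map D (Suc n) X Y f"
    and n: "n \<ge> 1" and N: "n_exact_seq D n (Ncone D n X Y f)"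
  shows "n_pushout D n (init_cpx n X) (init_cpx n Y) f"
proof -
  note N' = n_exact_seqD[OF N]
  have "contra_left_exact D n (cone D n (init_cpx n X) (init_cpx n Y) f)"
    using conjugate_cpx(2)[OF N'(1,4,5) cone_eq_conjugate_Ncone[OF X Y f n]] .
  moreover have "chain_map D n (init_cpx n X) (init_cpx n Y) f"
    using f by (simp add: chain_map_def init_cpx_def mk_cpx_def)
  ultimately show ?thesis using init_cpx_in X Y by (simp add: n_pushout_def)
qed

text \<open>
  On the other side the sign conventions agree literally.
\<close>

lemma Mcone_eq_cone_tail:
  assumes n: "n \<ge> 1"
  shows "Mcone D n X Y f = cone D n (tail_cpx n X) (tail_cpx n Y) (\<lambda>i. f (Suc i))"
proof -
  have "(if i = 0 then ob X 1 else if i \<le> n then dsum D (ob X (i + 1)) (ob Y i) else ob Y (n + 1)) =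
     (if i = 0 then ob (tail_cpx n X) 0
          else if i \<le> n then dsum D (ob (tail_cpx n X) i) (ob (tail_cpx n Y) (i - 1))
          else ob (tail_cpx n Y) n)" if "i \<le> Suc n" for i
    using that by (auto simp: tail_cpx_def mk_cpx_def)
  moreover have "(if i = 0 then col D (neg_arr D (df X 1)) (f 1)
          else if i < n then
            mat D (neg_arr D (df X (i + 1))) (zero_arr D (ob Y i) (ob X (i + 2)))
                  (f (i + 1)) (df Y i)
          else row D (f (n + 1)) (df Y n)) =
     (if i = 0 then col D (neg_arr D (df (tail_cpx n X) 0)) (f (Suc 0))
          else if i < n then
            mat D (neg_arr D (df (tail_cpx n X) i)) (zero_arr D (ob (tail_cpx n Y) (i - 1)) (ob (tail_cpx n X) (i + 1)))
                  (f (Suc i)) (df (tail_cpx n Y) (i - 1))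
          else row D (f (Suc n)) (df (tail_cpx n Y) (n - 1)))" if "i < Suc n" for i
    using that n by (auto simp: tail_cpx_def mk_cpx_def)
  ultimately show ?thesis
    unfolding Mcone_def cone_def mk_cpx_def by (auto intro!: restrict_ext)
qed

lemma n_pullback_of_Mcone:
  assumes X: "X \<in> cpxs D (Suc n)" and Y: "Y \<in> cpxs D (Suc n)" and f: "chain_map D (Suc n) X Y f"
    and n: "n \<ge> 1" and M: "n_exact_seq D n (Mcone D n X Y f)"
  shows "n_pullback D n (tail_cpx n X) (tail_cpx n Y) (\<lambda>i. f (Suc i))"
proof -
  have "co_left_exact D n (cone D n (tail_cpx n X) (tail_cpx n Y) (\<lambda>i. f (Suc i)))"
    using M Mcone_eq_cone_tail[OF n, of X Y f] by (simp add: n_exact_seq_def)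
  moreover have "chain_map D n (tail_cpx n X) (tail_cpx n Y) (\<lambda>i. f (Suc i))"
    using f by (simp add: chain_map_def tail_cpx_def mk_cpx_def)
  ultimately show ?thesis using tail_cpx_in X Y by (simp add: n_pullback_def)
qed

end

section \<open>Transport of n-exangulated structures\<close>

context n_exangulated_category
begin

lemma exact_at_same_kernel:
  assumes "exact_at A B K u v" and "\<And>x. x \<in> carrier B \<Longrightarrow> v' x = \<one>\<^bsub>K'\<^esub> \<longleftrightarrow> v x = \<one>\<^bsub>K\<^esub>"
  shows "exact_at A B K' u v'"
  using assms by (auto simp: exact_at_def kernel_def)

text \<open>
  All axioms of an n-exangulated category only mention elements of the extension groups, so they
  can be carried along any family of bijections that respects the operations and the realisation.
\<close>

lemma transport_structure:
  fixes G' :: "('o, 'm, 'd) bifun" and r' :: "('o, 'm, 'd) realisation" and \<Gamma> :: "'o \<Rightarrow> 'o \<Rightarrow> 'e \<Rightarrow> 'd"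
  assumes bij: "\<And>C A. \<lbrakk>C \<in> Obj D; A \<in> Obj D\<rbrakk> \<Longrightarrow> bij_betw (\<Gamma> C A) (Ext C A) (carrier (grp G' C A))"
    and mult: "\<And>C A \<delta> \<epsilon>. \<lbrakk>C \<in> Obj D; A \<in> Obj D; \<delta> \<in> Ext C A; \<epsilon> \<in> Ext C A\<rbrakk>
      \<Longrightarrow> \<Gamma> C A (\<delta> \<otimes>\<^bsub>grp G C A\<^esub> \<epsilon>) = \<Gamma> C A \<delta> \<otimes>\<^bsub>grp G' C A\<^esub> \<Gamma> C A \<epsilon>"
    and one: "\<And>C A. \<lbrakk>C \<in> Obj D; A \<in> Obj D\<rbrakk> \<Longrightarrow> \<Gamma> C A \<one>\<^bsub>grp G C A\<^esub> = \<one>\<^bsub>grp G' C A\<^esub>"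
    and act: "\<And>C C' A A' c a \<delta>. \<lbrakk>c \<in> Hom D C' C; a \<in> Hom D A A'; \<delta> \<in> Ext C A\<rbrakk>
      \<Longrightarrow> act G' c a (\<Gamma> C A \<delta>) = \<Gamma> C' A' (act G c a \<delta>)"
    and real: "\<And>C A \<delta>. \<lbrakk>C \<in> Obj D; A \<in> Obj D; \<delta> \<in> Ext C A\<rbrakk> \<Longrightarrow> r' C A (\<Gamma> C A \<delta>) = r C A \<delta>"
  shows "n_exangulated_category n D G' r'"
proof -
  have onto: "\<exists>\<delta>. \<delta> \<in> Ext C A \<and> x = \<Gamma> C A \<delta>"
    if "C \<in> Obj D" "A \<in> Obj D" "x \<in> carrier (grp G' C A)" for C A x
    using bij[OF that(1,2)] that(3) unfolding bij_betw_def by blast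
  have closed: "\<Gamma> C A \<delta> \<in> carrier (grp G' C A)" if "C \<in> Obj D" "A \<in> Obj D" "\<delta> \<in> Ext C A" for C A \<delta>
    using bij[OF that(1,2)] that(3) unfolding bij_betw_def by blast
  have inj: "\<Gamma> C A \<delta> = \<Gamma> C A \<epsilon> \<longleftrightarrow> \<delta> = \<epsilon>"
    if "C \<in> Obj D" "A \<in> Obj D" "\<delta> \<in> Ext C A" "\<epsilon> \<in> Ext C A" for C A \<delta> \<epsilon>
    using bij[OF that(1,2)] that(3,4) unfolding bij_betw_def inj_on_def by blast
  have one_iff: "\<Gamma> C A \<delta> = \<one>\<^bsub>grp G' C A\<^esub> \<longleftrightarrow> \<delta> = \<one>\<^bsub>grp G C A\<^esub>"
    if "C \<in> Obj D" "A \<in> Obj D" "\<delta> \<in> Ext C A" for C A \<delta>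
  proof -
    interpret g: comm_group "grp G C A" using grp_comm_group that by blast
    show ?thesis using inj[OF that g.one_closed] one[OF that(1,2)] by simp
  qed
  have push': "push D G' C a (\<Gamma> C A \<delta>) = \<Gamma> C A' (push D G C a \<delta>)"
    if "C \<in> Obj D" "a \<in> Hom D A A'" "\<delta> \<in> Ext C A" for C A A' a \<delta>
    using act[OF idn_hom[OF that(1)] that(2,3)] by (simp add: push_def)
  have pull': "pull D G' c A (\<Gamma> C A \<delta>) = \<Gamma> C' A (pull D G c A \<delta>)"
    if "A \<in> Obj D" "c \<in> Hom D C' C" "\<delta> \<in> Ext C A" for C C' A c \<delta>
    using act[OF that(2) idn_hom[OF that(1)] that(3)] by (simp add: pull_def)
  have act_closed: "act G c a \<delta> \<in> Ext C' A'"
    if "c \<in> Hom D C' C" "a \<in> Hom D A A'" "\<delta> \<in> Ext C A" for c C C' a A A' \<delta>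
    using act_hom[OF that(1,2)] that(3) by (auto simp: hom_def)
  have comm: "comm_group (grp G' C A)" if o: "C \<in> Obj D" "A \<in> Obj D" for C A
  proof -
    have "\<Gamma> C A \<in> iso (grp G C A) (grp G' C A)"
      using bij[OF o] mult[OF o] closed[OF o] by (simp add: iso_def hom_def)
    from comm_group.iso_imp_img_comm_group[OF grp_comm_group[OF o] this]
    show ?thesis by (simp add: one[OF o])
  qed
  have biadd: "biadditive_functor D G'"
  proof (intro biadditive_functor.intro biadditive_functor_axioms.intro additive_category_axioms)
    show "comm_group (grp G' C A)" if "C \<in> Obj D" "A \<in> Obj D" for C A using comm that .
  next
    fix c C' C a A A' assume ca: "c \<in> Hom D C' C" "a \<in> Hom D A A'"
    note o = Hom_obj[OF ca(1)] Hom_obj[OF ca(2)]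
    interpret g: comm_group "grp G C A" using grp_comm_group o by blast
    show "act G' c a \<in> hom (grp G' C A) (grp G' C' A')"
    proof (rule homI)
      fix x assume x: "x \<in> carrier (grp G' C A)"
      obtain x0 where x0: "x0 \<in> Ext C A" "x = \<Gamma> C A x0" using onto[OF o(2,3) x] by blast
      show "act G' c a x \<in> carrier (grp G' C' A')"
        unfolding x0(2) act[OF ca x0(1)] using closed[OF o(1,4) act_closed[OF ca x0(1)]] .
    next
      fix x y assume x: "x \<in> carrier (grp G' C A)" and y: "y \<in> carrier (grp G' C A)"
      obtain x0 y0 where xy: "x0 \<in> Ext C A" "x = \<Gamma> C A x0" "y0 \<in> Ext C A" "y = \<Gamma> C A y0"
        using onto[OF o(2,3) x] onto[OF o(2,3) y] by blast
      have "act G' c a (x \<otimes>\<^bsub>grp G' C A\<^esub> y) = \<Gamma> C' A' (act G c a (x0 \<otimes>\<^bsub>grp G C A\<^esub> y0))"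
        unfolding xy(2,4) mult[OF o(2,3) xy(1,3), symmetric] using act[OF ca g.m_closed[OF xy(1,3)]] .
      also have "\<dots> = \<Gamma> C' A' (act G c a x0 \<otimes>\<^bsub>grp G C' A'\<^esub> act G c a y0)"
        using act_hom[OF ca] xy(1,3) by (simp add: hom_def)
      also have "\<dots> = act G' c a x \<otimes>\<^bsub>grp G' C' A'\<^esub> act G' c a y"
        using mult[OF o(1,4) act_closed[OF ca xy(1)] act_closed[OF ca xy(3)]] act[OF ca] xy by simp
      finally show "act G' c a (x \<otimes>\<^bsub>grp G' C A\<^esub> y) = act G' c a x \<otimes>\<^bsub>grp G' C' A'\<^esub> act G' c a y" .
    qed
  next
    fix C A \<delta> assume o: "C \<in> Obj D" "A \<in> Obj D" and \<delta>: "\<delta> \<in> carrier (grp G' C A)"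
    obtain d where d: "d \<in> Ext C A" "\<delta> = \<Gamma> C A d" using onto[OF o \<delta>] by blast
    show "act G' (idn D C) (idn D A) \<delta> = \<delta>"
      using act[OF idn_hom[OF o(1)] idn_hom[OF o(2)] d(1)] act_idn[OF o d(1)] d(2) by simp
  next
    fix c C C' c' C'' a A A' a' A'' \<delta>
    assume h: "c \<in> Hom D C' C" "c' \<in> Hom D C'' C'" "a \<in> Hom D A A'" "a' \<in> Hom D A' A''" and \<delta>: "\<delta> \<in> carrier (grp G' C A)"
    obtain d where d: "d \<in> Ext C A" "\<delta> = \<Gamma> C A d" using onto[OF Hom_obj(2)[OF h(1)] Hom_obj(1)[OF h(3)] \<delta>] by blast
    show "act G' (c ** c') (a' ** a) \<delta> = act G' c' a' (act G' c a \<delta>)"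
      unfolding d(2) act[OF h(1,3) d(1)] act[OF h(2,4) act_closed[OF h(1,3) d(1)]]
        act[OF comp_hom[OF h(2,1)] comp_hom[OF h(3,4)] d(1)] act_comp[OF h d(1)] ..
  next
    fix C a A A' b \<delta> assume h: "C \<in> Obj D" "a \<in> Hom D A A'" "b \<in> Hom D A A'" and \<delta>: "\<delta> \<in> carrier (grp G' C A)"
    obtain d where d: "d \<in> Ext C A" "\<delta> = \<Gamma> C A d" using onto[OF h(1) Hom_obj(1)[OF h(2)] \<delta>] by blast
    show "push D G' C (a \<boxplus> b) \<delta> = push D G' C a \<delta> \<otimes>\<^bsub>grp G' C A'\<^esub> push D G' C b \<delta>"
      unfolding d(2) push'[OF h(1,2) d(1)] push'[OF h(1,3) d(1)] push'[OF h(1) add_hom[OF h(2,3)] d(1)]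
        push_plus[OF h d(1)]
      using mult[OF h(1) Hom_obj(2)[OF h(2)] push_closed[OF h(1,2) d(1)] push_closed[OF h(1,3) d(1)]] .
  next
    fix A c C' C b \<delta> assume h: "A \<in> Obj D" "c \<in> Hom D C' C" "b \<in> Hom D C' C" and \<delta>: "\<delta> \<in> carrier (grp G' C A)"
    obtain d where d: "d \<in> Ext C A" "\<delta> = \<Gamma> C A d" using onto[OF Hom_obj(2)[OF h(2)] h(1) \<delta>] by blast
    show "pull D G' (c \<boxplus> b) A \<delta> = pull D G' c A \<delta> \<otimes>\<^bsub>grp G' C' A\<^esub> pull D G' b A \<delta>"
      unfolding d(2) pull'[OF h(1,2) d(1)] pull'[OF h(1,3) d(1)] pull'[OF h(1) add_hom[OF h(2,3)] d(1)]
        pull_plus[OF h d(1)]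
      using mult[OF Hom_obj(1)[OF h(2)] h(1) pull_closed[OF h(1,2) d(1)] pull_closed[OF h(1,3) d(1)]] .
  qed
  have dist_ob: "ob X 0 \<in> Obj D" "ob X (Suc n) \<in> Obj D" "ob X (n + 1) \<in> Obj D"
      "df X 0 \<in> Hom D (ob X 0) (ob X (Suc 0))" "df X n \<in> Hom D (ob X n) (ob X (Suc n))"
    if "X \<in> cpxs D (Suc n)" for X
    using cpx_ob[OF that] cpx_df[OF that] by simp_all
  have distE: "\<exists>d. \<delta> = \<Gamma> (ob X (Suc n)) (ob X 0) d \<and> distinguished n D G r X d"
    if "distinguished n D G' r' X \<delta>" for X \<delta>
  proof -
    have X: "X \<in> cpxs D (Suc n)" and d: "\<delta> \<in> carrier (grp G' (ob X (Suc n)) (ob X 0))"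
      "r' (ob X (Suc n)) (ob X 0) \<delta> = hclass D n X" using that by (simp_all add: distinguished_def)
    obtain d where "d \<in> Ext (ob X (Suc n)) (ob X 0)" "\<delta> = \<Gamma> (ob X (Suc n)) (ob X 0) d"
      using onto[OF dist_ob(2,1)[OF X] d(1)] by blast
    then show ?thesis using X d(2) real[OF dist_ob(2,1)[OF X]] by (auto simp: distinguished_def)
  qed
  have distI: "distinguished n D G' r' X (\<Gamma> (ob X (Suc n)) (ob X 0) d)" if "distinguished n D G r X d" for X d
    using that real closed dist_ob[of X] by (simp add: distinguished_def)
  have car: "d \<in> Ext (ob X (Suc n)) (ob X 0)" and cpx: "X \<in> cpxs D (Suc n)"
    if "distinguished n D G r X d" for X d using that by (simp_all add: distinguished_def)
  have conf: "conflation n D G' r' X \<longleftrightarrow> conflation n D G r X" for X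
    unfolding conflation_def using distE distI by blast
  have dist_iff: "distinguished n D G' r' X (\<Gamma> C A d) \<longleftrightarrow> distinguished n D G r X d"
    if h: "d \<in> Ext C A" "ob X (Suc n) = C" "ob X 0 = A" for X d C A
  proof
    assume X: "distinguished n D G' r' X (\<Gamma> C A d)"
    then obtain d' where d': "\<Gamma> C A d = \<Gamma> C A d'" "distinguished n D G r X d'" using distE h(2,3) by blast
    moreover have "C \<in> Obj D" "A \<in> Obj D" using dist_ob[OF cpx[OF d'(2)]] h(2,3) by auto
    ultimately show "distinguished n D G r X d" using inj[of C A d d'] car[OF d'(2)] h by blast
  next
    show "distinguished n D G r X d \<Longrightarrow> distinguished n D G' r' X (\<Gamma> C A d)" using distI h by blast
  qed
  have exact: "n_exangle n D G' X (\<Gamma> (ob X (Suc n)) (ob X 0) d)" if X: "distinguished n D G r X d" for X d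
  proof -
    let ?A = "ob X 0" and ?C = "ob X (Suc n)"
    note Xc = cpx[OF X] and d = car[OF X] and o = dist_ob[OF cpx[OF X]]
    have ex: "n_exangle n D G X d" using R1[OF X] .
    have p1: "push D G' ?C g (\<Gamma> ?C ?A d) = \<one>\<^bsub>grp G' ?C Z\<^esub> \<longleftrightarrow> push D G ?C g d = \<one>\<^bsub>grp G ?C Z\<^esub>"
      if "g \<in> Hom D ?A Z" for g Z
      using push'[OF o(2) that d] one_iff[OF o(2) Hom_obj(2)[OF that] push_closed[OF o(2) that d]] by simp
    have p2: "pull D G' g ?A (\<Gamma> ?C ?A d) = \<one>\<^bsub>grp G' Z ?A\<^esub> \<longleftrightarrow> pull D G g ?A d = \<one>\<^bsub>grp G Z ?A\<^esub>"
      if "g \<in> Hom D Z ?C" for g Z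
      using pull'[OF o(1) that d] one_iff[OF Hom_obj(1)[OF that] o(1) pull_closed[OF o(1) that d]] by simp
    show ?thesis unfolding n_exangle_def
    proof (intro conjI ballI)
      show "X \<in> cpxs D (Suc n)" using Xc .
      show "\<Gamma> ?C ?A d \<in> carrier (grp G' (ob X (n + 1)) ?A)" using closed[OF o(2,1) d] by simp
      show "push D G' (ob X (n + 1)) (df X 0) (\<Gamma> ?C ?A d) = \<one>\<^bsub>grp G' (ob X (n + 1)) (ob X 1)\<^esub>"
        using ex p1[OF o(4)] by (simp add: n_exangle_def)
      show "pull D G' (df X n) ?A (\<Gamma> ?C ?A d) = \<one>\<^bsub>grp G' (ob X n) ?A\<^esub>"
        using ex p2[OF o(5)] by (simp add: n_exangle_def)
      fix Z assume Z: "Z \<in> Obj D"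
      show "\<forall>i<n. co_exact_Suc D X Z i" "\<forall>i<n. contra_exact_Suc D X Z i"
        using ex Z unfolding n_exangle_def by blast+
      have "exact_at (homgrp D Z (ob X n)) (homgrp D Z (ob X (n + 1))) (grp G Z ?A)
          (\<lambda>f. df X n ** f) (\<lambda>f. pull D G f ?A d)" using ex Z unfolding n_exangle_def by blast
      then show "exact_at (homgrp D Z (ob X n)) (homgrp D Z (ob X (n + 1))) (grp G' Z ?A)
          (\<lambda>f. df X n ** f) (\<lambda>f. pull D G' f ?A (\<Gamma> ?C ?A d))"
        by (rule exact_at_same_kernel) (simp add: homgrp_def p2)
      have "exact_at (homgrp D (ob X 1) Z) (homgrp D ?A Z) (grp G (ob X (n + 1)) Z)
          (\<lambda>g. g ** df X 0) (\<lambda>g. push D G (ob X (n + 1)) g d)" using ex Z unfolding n_exangle_def by blast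
      then show "exact_at (homgrp D (ob X 1) Z) (homgrp D ?A Z) (grp G' (ob X (n + 1)) Z)
          (\<lambda>g. g ** df X 0) (\<lambda>g. push D G' (ob X (n + 1)) g (\<Gamma> ?C ?A d))"
        by (rule exact_at_same_kernel) (simp add: homgrp_def p1)
    qed
  qed
  show ?thesis
  proof (intro n_exangulated_category.intro exact_realisation.intro biadd
      n_exangulated_category_axioms.intro exact_realisation_axioms.intro)
    fix C A \<delta> assume o: "C \<in> Obj D" "A \<in> Obj D" "\<delta> \<in> carrier (grp G' C A)"
    then obtain d where d: "d \<in> Ext C A" "\<delta> = \<Gamma> C A d" using onto[OF o] by blast
    show "\<exists>X \<in> cpxs_between D n A C. r' C A \<delta> = hclass D n X"
      using realisation_class[OF o(1,2) d(1)] real[OF o(1,2) d(1)] d(2) by simp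
  next
    fix X \<delta> Y \<rho> a c
    assume X: "distinguished n D G' r' X \<delta>" and Y: "distinguished n D G' r' Y \<rho>"
      and a: "a \<in> Hom D (ob X 0) (ob Y 0)" and c: "c \<in> Hom D (ob X (n + 1)) (ob Y (n + 1))"
      and eq: "push D G' (ob X (n + 1)) a \<delta> = pull D G' c (ob Y 0) \<rho>"
    obtain d e where d: "\<delta> = \<Gamma> (ob X (Suc n)) (ob X 0) d" "distinguished n D G r X d"
      and e: "\<rho> = \<Gamma> (ob Y (Suc n)) (ob Y 0) e" "distinguished n D G r Y e" using distE[OF X] distE[OF Y] by blast
    note oX = dist_ob[OF cpx[OF d(2)]] and oY = dist_ob[OF cpx[OF e(2)]]
    have c': "c \<in> Hom D (ob X (Suc n)) (ob Y (Suc n))" using c by simp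
    have "push D G (ob X (Suc n)) a d = pull D G c (ob Y 0) e"
      using eq push'[OF oX(2) a car[OF d(2)]] pull'[OF oY(1) c' car[OF e(2)]] d(1) e(1)
        inj[OF oX(2) oY(1) push_closed[OF oX(2) a car[OF d(2)]] pull_closed[OF oY(1) c' car[OF e(2)]]] by simp
    then show "\<exists>f. lift_of D n X Y a c f" using R0[OF d(2) e(2) a c] by simp
  next
    fix X \<delta> assume "distinguished n D G' r' X \<delta>"
    then show "n_exangle n D G' X \<delta>" using distE exact by blast
  next
    fix A assume A: "A \<in> Obj D"
    have z: "zero_obj D \<in> Obj D" using someI_ex[OF ex_zero_obj] by (simp add: zero_obj_def is_zero_obj_def)
    interpret g: comm_group "grp G (zero_obj D) A" using grp_comm_group z A by blast
    interpret h: comm_group "grp G A (zero_obj D)" using grp_comm_group z A by blast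
    show "r' (zero_obj D) A \<one>\<^bsub>grp G' (zero_obj D) A\<^esub> = hclass D n (triv D n 0 A)"
      using R2_left[OF A] real[OF z A g.one_closed] one[OF z A] by simp
    show "r' A (zero_obj D) \<one>\<^bsub>grp G' A (zero_obj D)\<^esub> = hclass D n (triv D n n A)"
      using R2_right[OF A] real[OF A z h.one_closed] one[OF A z] by simp
  next
    show "comp_closed D {f. inflation n D G' r' f}" using EA1 by (simp add: inflation_def conf)
    show "comp_closed D {f. deflation n D G' r' f}" using EA1_op by (simp add: deflation_def conf)
  next
    fix Y \<rho> X c
    assume Y: "distinguished n D G' r' Y \<rho>" and XY: "ob X 0 = ob Y 0" and c: "c \<in> Hom D (ob X (n + 1)) (ob Y (n + 1))"
      and X: "distinguished n D G' r' X (pull D G' c (ob Y 0) \<rho>)"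
    obtain e where e: "\<rho> = \<Gamma> (ob Y (Suc n)) (ob Y 0) e" "distinguished n D G r Y e" using distE[OF Y] by blast
    note oY = dist_ob[OF cpx[OF e(2)]] and ce = car[OF e(2)]
    have c': "c \<in> Hom D (ob X (Suc n)) (ob Y (Suc n))" using c by simp
    have "distinguished n D G r X (pull D G c (ob Y 0) e)"
      using X unfolding e(1) pull'[OF oY(1) c' ce]
      using dist_iff[OF pull_closed[OF oY(1) c' ce] refl XY] by blast
    from EA2[OF e(2) XY c this] obtain f where f: "lift_of D n X Y (idn D (ob X 0)) c f"
      "distinguished n D G r (Mcone D n X Y f) (push D G (ob Y (Suc n)) (df X 0) e)" by auto
    have Xc: "X \<in> cpxs D (Suc n)" using X by (simp add: distinguished_def)
    have dX: "df X 0 \<in> Hom D (ob Y 0) (ob X (Suc 0))" using dist_ob(4)[OF Xc] XY by simp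
    have "distinguished n D G' r' (Mcone D n X Y f) (push D G' (ob Y (n + 1)) (df X 0) \<rho>)"
      using distI[OF f(2)] push'[OF oY(2) dX ce] e(1) by (simp add: Mcone_def mk_cpx_def)
    then show "\<exists>f. lift_of D n X Y (idn D (ob X 0)) c f \<and>
        distinguished n D G' r' (Mcone D n X Y f) (push D G' (ob Y (n + 1)) (df X 0) \<rho>)" using f(1) by blast
  next
    fix X \<delta> Y a
    assume X: "distinguished n D G' r' X \<delta>" and XY: "ob X (n + 1) = ob Y (n + 1)" and a: "a \<in> Hom D (ob X 0) (ob Y 0)"
      and Y: "distinguished n D G' r' Y (push D G' (ob X (n + 1)) a \<delta>)"
    obtain d where d: "\<delta> = \<Gamma> (ob X (Suc n)) (ob X 0) d" "distinguished n D G r X d" using distE[OF X] by blast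
    note oX = dist_ob[OF cpx[OF d(2)]] and cd = car[OF d(2)]
    have XY': "ob Y (Suc n) = ob X (Suc n)" using XY by simp
    have "distinguished n D G r Y (push D G (ob X (Suc n)) a d)"
      using Y push'[OF oX(2) a cd] dist_iff[OF push_closed[OF oX(2) a cd] XY' refl] d(1) by simp
    then have "distinguished n D G r Y (push D G (ob X (n + 1)) a d)" by simp
    from EA2_op[OF d(2) XY a this] obtain f where f: "lift_of D n X Y a (idn D (ob X (n + 1))) f"
      "distinguished n D G r (Ncone D n X Y f) (pull D G (df Y n) (ob X 0) d)" by auto
    have Yc: "Y \<in> cpxs D (Suc n)" using Y by (simp add: distinguished_def)
    have dY: "df Y n \<in> Hom D (ob Y n) (ob X (Suc n))" using dist_ob(5)[OF Yc] XY' by simp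
    have "distinguished n D G' r' (Ncone D n X Y f) (pull D G' (df Y n) (ob X 0) \<delta>)"
      using distI[OF f(2)] pull'[OF oX(1) dY cd] d(1) by (simp add: Ncone_def mk_cpx_def)
    then show "\<exists>f. lift_of D n X Y a (idn D (ob X (n + 1))) f \<and>
        distinguished n D G' r' (Ncone D n X Y f) (pull D G' (df Y n) (ob X 0) \<delta>)" using f(1) by blast
  qed
qed

end

section \<open>The n-exact structure of conflations\<close>

context category
begin

lemma is_isoE:
  assumes "is_iso D f" "f \<in> Hom D A B"
  obtains g where "g \<in> Hom D B A" "g ** f = idn D A" "f ** g = idn D B"
  using assms unfolding is_iso_def by (auto simp: in_Hom)

lemma is_isoI:
  assumes "f \<in> Hom D A B" "g \<in> Hom D B A" "g ** f = idn D A" "f ** g = idn D B"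
  shows "is_iso D f"
  using assms unfolding is_iso_def by (auto simp: in_Hom)

end

context preadditive_category
begin

text \<open>
  The inverses of two adjacent components form a commutative square, which extends in both
  directions.
\<close>

lemma inverse_chain_map:
  assumes X: "n_exact_seq D n X" and Y: "n_exact_seq D n Y" and f: "chain_map D (Suc n) X Y f"
    and k: "k \<le> n" and iso: "is_iso D (f k)" "is_iso D (f (Suc k))"
  obtains g where "chain_map D (Suc n) Y X g"
    "g k ** f k = idn D (ob X k)" "f k ** g k = idn D (ob Y k)"
    "g (Suc k) ** f (Suc k) = idn D (ob X (Suc k))" "f (Suc k) ** g (Suc k) = idn D (ob Y (Suc k))"
proof -
  note X' = n_exact_seqD[OF X] and Y' = n_exact_seqD[OF Y]
  have fk: "f k \<in> Hom D (ob X k) (ob Y k)" and fk1: "f (Suc k) \<in> Hom D (ob X (Suc k)) (ob Y (Suc k))"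
    using chain_map_hom[OF f] k by simp_all
  have dX: "df X k \<in> Hom D (ob X k) (ob X (Suc k))" and dY: "df Y k \<in> Hom D (ob Y k) (ob Y (Suc k))"
    using cpx_df[OF X'(1)] cpx_df[OF Y'(1)] k by simp_all
  obtain u where u: "u \<in> Hom D (ob Y k) (ob X k)" "u ** f k = idn D (ob X k)" "f k ** u = idn D (ob Y k)"
    using is_isoE[OF iso(1) fk] .
  obtain v where v: "v \<in> Hom D (ob Y (Suc k)) (ob X (Suc k))" "v ** f (Suc k) = idn D (ob X (Suc k))"
      "f (Suc k) ** v = idn D (ob Y (Suc k))"
    using is_isoE[OF iso(2) fk1] .
  have "df X k ** u = v ** f (Suc k) ** df X k ** u"
    using u(1) v(2) dX by (simp add: in_Hom idn_left')
  also have "\<dots> = v ** (f (Suc k) ** df X k) ** u"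
    using u(1) v(1) dX fk1 by (simp add: category_simps)
  also have "\<dots> = v ** (df Y k ** f k) ** u" using chain_map_comm[OF f, of k] k by simp
  also have "\<dots> = v ** df Y k" using u v(1) dY fk by (simp add: category_simps)
  finally obtain g where g: "chain_map D (Suc n) Y X g" "g k = u" "g (Suc k) = v"
    using chain_map_of_square[OF Y'(1) X'(1) Y'(4) X'(2) k u(1) v(1)] by blast
  show ?thesis using that[OF g(1)] u v g by simp
qed

end

context additive_category
begin

text \<open>
  A direct sum is exact because exactness can be tested after composing with the structure maps
  of the biproduct, which are chain maps in every degree.
\<close>

lemma n_exact_seq_dsum_cpx:
  assumes Xe: "n_exact_seq D n X" and Ye: "n_exact_seq D n Y"
  shows "n_exact_seq D n (dsum_cpx D n X Y)"
    and "chain_map D (Suc n) X (dsum_cpx D n X Y) (\<lambda>i. in1 D (ob X i) (ob Y i))"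
    and "chain_map D (Suc n) Y (dsum_cpx D n X Y) (\<lambda>i. in2 D (ob X i) (ob Y i))"
    and "chain_map D (Suc n) (dsum_cpx D n X Y) X (\<lambda>i. pr1 D (ob X i) (ob Y i))"
    and "chain_map D (Suc n) (dsum_cpx D n X Y) Y (\<lambda>i. pr2 D (ob X i) (ob Y i))"
proof -
  let ?S = "dsum_cpx D n X Y"
  note X' = n_exact_seqD[OF Xe] and Y' = n_exact_seqD[OF Ye]
  note Xc = X'(1) and Yc = Y'(1)
  note ty = cpx_ob[OF Xc] cpx_ob[OF Yc] cpx_df_typing[OF Xc] cpx_df_typing[OF Yc]
    col_typing row_typing mat_typing
  have Sob: "ob ?S i = dsum D (ob X i) (ob Y i)" if "i \<le> Suc n" for i using that by (simp add: dsum_cpx_def mk_cpx_def)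
  have Sdf: "df ?S i = mat D (df X i) (zr (ob Y i) (ob X (Suc i))) (zr (ob X i) (ob Y (Suc i))) (df Y i)"
    if "i < Suc n" for i using that by (simp add: dsum_cpx_def mk_cpx_def)
  have Sc: "?S \<in> cpxs D (Suc n)" unfolding cpxs_def
  proof (intro CollectI conjI allI impI)
    show "ob ?S \<in> extensional {..Suc n}" "df ?S \<in> extensional {..<Suc n}" by (simp_all add: dsum_cpx_def mk_cpx_def)
    show "ob ?S i \<in> Obj D" if "i \<le> Suc n" for i using that by (simp add: Sob ty biprod_simps(1))
    show "df ?S i \<in> Hom D (ob ?S i) (ob ?S (Suc i))" if "i < Suc n" for i
      using that by (simp add: Sob Sdf ty cat_simps)
    show "df ?S (Suc i) ** df ?S i = zr (ob ?S i) (ob ?S (Suc (Suc i)))" if "Suc i < Suc n" for i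
      using that by (simp add: Sob Sdf ty cat_simps mat_comp_mat cpx_df_df[OF Xc] cpx_df_df[OF Yc] mat_zero)
  qed
  define j1 where "j1 i = in1 D (ob X i) (ob Y i)" for i
  define j2 where "j2 i = in2 D (ob X i) (ob Y i)" for i
  define q1 where "q1 i = pr1 D (ob X i) (ob Y i)" for i
  define q2 where "q2 i = pr2 D (ob X i) (ob Y i)" for i
  note js = j1_def j2_def q1_def q2_def
  have j1: "chain_map D (Suc n) X ?S j1" and j2: "chain_map D (Suc n) Y ?S j2"
    and q1: "chain_map D (Suc n) ?S X q1" and q2: "chain_map D (Suc n) ?S Y q2"
    by (simp_all add: chain_map_def js Sob Sdf ty cat_simps biprod_simps mat_def row_def col_def pr_in_comp)
  have jq: "j1 i ** q1 i \<boxplus> j2 i ** q2 i = idn D (ob ?S i)" if "i \<le> Suc n" for i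
    using that by (simp add: js Sob ty biprod_simps)
  have jt: "j1 i \<in> Hom D (ob X i) (ob ?S i)" "j2 i \<in> Hom D (ob Y i) (ob ?S i)"
    "q1 i \<in> Hom D (ob ?S i) (ob X i)" "q2 i \<in> Hom D (ob ?S i) (ob Y i)" if "i \<le> Suc n" for i
    using that by (simp_all add: js Sob ty biprod_simps in_Hom)
  have split_left: "g = j1 i ** (q1 i ** g) \<boxplus> j2 i ** (q2 i ** g)" if "i \<le> Suc n" "g \<in> Hom D Z (ob ?S i)" for i g Z
  proof -
    have "g = idn D (ob ?S i) ** g" using that(2) by (simp add: in_Hom idn_left')
    also have "\<dots> = j1 i ** (q1 i ** g) \<boxplus> j2 i ** (q2 i ** g)"
      unfolding jq[OF that(1), symmetric] using jt[OF that(1)] that(2) by (simp add: cat_simps)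
    finally show ?thesis .
  qed
  have split_right: "g = g ** j1 i ** q1 i \<boxplus> g ** j2 i ** q2 i" if "i \<le> Suc n" "g \<in> Hom D (ob ?S i) Z" for i g Z
  proof -
    have "g = g ** idn D (ob ?S i)" using that(2) by (simp add: in_Hom idn_right')
    also have "\<dots> = g ** j1 i ** q1 i \<boxplus> g ** j2 i ** q2 i"
      unfolding jq[OF that(1), symmetric] using jt[OF that(1)] that(2) by (simp add: cat_simps)
    finally show ?thesis .
  qed
  note Sty = cpx_df_typing[OF Sc] cpx_ob[OF Sc]
  \<comment> \<open>exactness of the sum is tested on the summands, on which these identities move the differentials\<close>
  have dq1: "df X i ** (q1 i ** g) = q1 (Suc i) ** (df ?S i ** g)" and dq2: "df Y i ** (q2 i ** g) = q2 (Suc i) ** (df ?S i ** g)"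
    if "i < Suc n" "g \<in> Hom D Z (ob ?S i)" for i g Z
    using that jt[of i] jt[of "Suc i"] chain_map_comm[OF q1, of i] chain_map_comm[OF q2, of i]
      comp_assoc'[of g "q1 i" "df X i"] comp_assoc'[of g "q2 i" "df Y i"]
      comp_assoc'[of g "df ?S i" "q1 (Suc i)"] comp_assoc'[of g "df ?S i" "q2 (Suc i)"]
    by (simp_all add: in_Hom Sty ty)
  have dj1: "g ** j1 (Suc i) ** df X i = g ** df ?S i ** j1 i" and dj2: "g ** j2 (Suc i) ** df Y i = g ** df ?S i ** j2 i"
    if "i < Suc n" "g \<in> Hom D (ob ?S (Suc i)) Z" for i g Z
    using that jt[of i] jt[of "Suc i"] chain_map_comm[OF j1, of i] chain_map_comm[OF j2, of i]
    by (simp_all add: in_Hom Sty ty comp_assoc')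
  have "weak_kernel_cpx D n ?S" unfolding weak_kernel_cpx_def
  proof (intro allI impI ballI)
    fix i Z g assume i: "i < n" and g: "g \<in> Hom D Z (ob ?S (Suc i))"
      and gz: "df ?S (Suc i) ** g = zr Z (ob ?S (Suc (Suc i)))"
    note Z = Hom_obj(1)[OF g]
    have g1: "q1 (Suc i) ** g \<in> Hom D Z (ob X (Suc i))" "q2 (Suc i) ** g \<in> Hom D Z (ob Y (Suc i))"
      using comp_hom[OF g jt(3)] comp_hom[OF g jt(4)] i by simp_all
    have "df X (Suc i) ** (q1 (Suc i) ** g) = zr Z (ob X (Suc (Suc i)))"
      "df Y (Suc i) ** (q2 (Suc i) ** g) = zr Z (ob Y (Suc (Suc i)))"
      using dq1[OF _ g] dq2[OF _ g] gz jt[of "Suc (Suc i)"] i Z by (simp_all add: in_Hom comp_zero)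
    from weak_kernelE[OF X'(2) i g1(1) this(1)] weak_kernelE[OF Y'(2) i g1(2) this(2)]
    obtain k l where k: "k \<in> Hom D Z (ob X i)" "q1 (Suc i) ** g = df X i ** k"
      and l: "l \<in> Hom D Z (ob Y i)" "q2 (Suc i) ** g = df Y i ** l" by metis
    have "g = j1 (Suc i) ** (df X i ** k) \<boxplus> j2 (Suc i) ** (df Y i ** l)"
      using split_left[OF _ g] i k(2) l(2) by simp
    also have "\<dots> = df ?S i ** (j1 i ** k \<boxplus> j2 i ** l)"
      using i k(1) l(1) jt[of i] jt[of "Suc i"] chain_map_comm[OF j1, of i] chain_map_comm[OF j2, of i]
        comp_assoc'[of k "df X i" "j1 (Suc i)"] comp_assoc'[of l "df Y i" "j2 (Suc i)"]
        comp_assoc'[of k "j1 i" "df ?S i"] comp_assoc'[of l "j2 i" "df ?S i"]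
      by (simp add: in_Hom Sty ty comp_add comp_typing)
    finally have "g = df ?S i ** (j1 i ** k \<boxplus> j2 i ** l)" .
    moreover have "j1 i ** k \<boxplus> j2 i ** l \<in> Hom D Z (ob ?S i)"
      using add_hom[OF comp_hom[OF k(1) jt(1)] comp_hom[OF l(1) jt(2)]] i by simp
    ultimately show "\<exists>k \<in> Hom D Z (ob ?S i). g = df ?S i ** k" by blast
  qed
  moreover have "weak_cokernel_cpx D n ?S" unfolding weak_cokernel_cpx_def
  proof (intro allI impI ballI)
    fix i Z g assume i: "i < n" and g: "g \<in> Hom D (ob ?S (Suc i)) Z"
      and gz: "g ** df ?S i = zr (ob ?S i) Z"
    note Z = Hom_obj(2)[OF g]
    have g1: "g ** j1 (Suc i) \<in> Hom D (ob X (Suc i)) Z" "g ** j2 (Suc i) \<in> Hom D (ob Y (Suc i)) Z"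
      using comp_hom[OF jt(1) g] comp_hom[OF jt(2) g] i by simp_all
    have "g ** j1 (Suc i) ** df X i = zr (ob X i) Z" "g ** j2 (Suc i) ** df Y i = zr (ob Y i) Z"
      using dj1[OF _ g] dj2[OF _ g] gz jt[of i] i Z by (simp_all add: in_Hom zero_comp)
    from weak_cokernelE[OF X'(4) i g1(1) this(1)] weak_cokernelE[OF Y'(4) i g1(2) this(2)]
    obtain k l where k: "k \<in> Hom D (ob X (Suc (Suc i))) Z" "g ** j1 (Suc i) = k ** df X (Suc i)"
      and l: "l \<in> Hom D (ob Y (Suc (Suc i))) Z" "g ** j2 (Suc i) = l ** df Y (Suc i)" by metis
    have "g = k ** df X (Suc i) ** q1 (Suc i) \<boxplus> l ** df Y (Suc i) ** q2 (Suc i)"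
      using split_right[OF _ g] i k(2) l(2) by simp
    also have "\<dots> = (k ** q1 (Suc (Suc i)) \<boxplus> l ** q2 (Suc (Suc i))) ** df ?S (Suc i)"
      using i k(1) l(1) jt[of "Suc i"] jt[of "Suc (Suc i)"] chain_map_comm[OF q1, of "Suc i"] chain_map_comm[OF q2, of "Suc i"]
      by (simp add: in_Hom Sty ty add_comp comp_typing comp_assoc')
    finally have "g = (k ** q1 (Suc (Suc i)) \<boxplus> l ** q2 (Suc (Suc i))) ** df ?S (Suc i)" .
    moreover have "k ** q1 (Suc (Suc i)) \<boxplus> l ** q2 (Suc (Suc i)) \<in> Hom D (ob ?S (Suc (Suc i))) Z"
      using add_hom[OF comp_hom[OF jt(3) k(1)] comp_hom[OF jt(4) l(1)]] i by simp
    ultimately show "\<exists>k \<in> Hom D (ob ?S (Suc (Suc i))) Z. g = k ** df ?S (Suc i)" by blast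
  qed
  moreover have "monic D (df ?S 0)" unfolding monic_def
  proof (intro conjI ballI impI)
    show "df ?S 0 \<in> Arr D" by (simp add: Sty)
    fix Z g h assume "g \<in> Hom D Z (Dom D (df ?S 0))" "h \<in> Hom D Z (Dom D (df ?S 0))" and eq: "df ?S 0 ** g = df ?S 0 ** h"
    then have g: "g \<in> Hom D Z (ob ?S 0)" and h: "h \<in> Hom D Z (ob ?S 0)" by (simp_all add: Sty)
    have "q1 0 ** g = q1 0 ** h"
      using monicD[OF X'(3) cpx_df[OF Xc zero_less_Suc] comp_hom[OF g jt(3)] comp_hom[OF h jt(3)]] dq1[OF _ g] dq1[OF _ h] eq by simp
    moreover have "q2 0 ** g = q2 0 ** h"
      using monicD[OF Y'(3) cpx_df[OF Yc zero_less_Suc] comp_hom[OF g jt(4)] comp_hom[OF h jt(4)]] dq2[OF _ g] dq2[OF _ h] eq by simp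
    ultimately show "g = h" using split_left[OF _ g] split_left[OF _ h] by simp
  qed
  moreover have "epic D (df ?S n)" unfolding epic_def
  proof (intro conjI ballI impI)
    show "df ?S n \<in> Arr D" by (simp add: Sty)
    fix Z g h assume "g \<in> Hom D (Cod D (df ?S n)) Z" "h \<in> Hom D (Cod D (df ?S n)) Z" and eq: "g ** df ?S n = h ** df ?S n"
    then have g: "g \<in> Hom D (ob ?S (Suc n)) Z" and h: "h \<in> Hom D (ob ?S (Suc n)) Z" by (simp_all add: Sty)
    have "g ** j1 (Suc n) = h ** j1 (Suc n)"
      using epicD[OF X'(5) cpx_df[OF Xc lessI] comp_hom[OF jt(1) g] comp_hom[OF jt(1) h]] dj1[OF _ g] dj1[OF _ h] eq by simp
    moreover have "g ** j2 (Suc n) = h ** j2 (Suc n)"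
      using epicD[OF Y'(5) cpx_df[OF Yc lessI] comp_hom[OF jt(2) g] comp_hom[OF jt(2) h]] dj2[OF _ g] dj2[OF _ h] eq by simp
    ultimately show "g = h" using split_right[OF _ g] split_right[OF _ h] by simp
  qed
  ultimately show "n_exact_seq D n ?S" using Sc by (simp add: n_exact_seq_iff)
  show "chain_map D (Suc n) X ?S (\<lambda>i. in1 D (ob X i) (ob Y i))"
    "chain_map D (Suc n) Y ?S (\<lambda>i. in2 D (ob X i) (ob Y i))"
    "chain_map D (Suc n) ?S X (\<lambda>i. pr1 D (ob X i) (ob Y i))"
    "chain_map D (Suc n) ?S Y (\<lambda>i. pr2 D (ob X i) (ob Y i))"
    using j1 j2 q1 q2 unfolding js .
qed

end

context monic_epic_exangulated
begin

lemma conflation_of_middle_iso: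
  assumes X: "dist X \<delta>" and Y: "n_exact_seq D n Y" and f: "chain_map D (Suc n) X Y f"
    and k: "k \<le> n" and iso: "is_iso D (f k)" "is_iso D (f (Suc k))"
  shows "conflation n D G r Y"
proof -
  note Xc = dist_cpx[OF X] and Xe = dist_exact[OF X] and Y' = n_exact_seqD[OF Y]
  obtain g where g: "chain_map D (Suc n) Y X g"
    "g k ** f k = idn D (ob X k)" "f k ** g k = idn D (ob Y k)"
    "g (Suc k) ** f (Suc k) = idn D (ob X (Suc k))" "f (Suc k) ** g (Suc k) = idn D (ob Y (Suc k))"
    using inverse_chain_map[OF Xe Y f k iso] .
  have oX: "ob X k \<in> Obj D" "ob X (Suc k) \<in> Obj D" and oY: "ob Y k \<in> Obj D" "ob Y (Suc k) \<in> Obj D"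
    using cpx_ob[OF Xc] cpx_ob[OF Y'(1)] k by simp_all
  have gf: "chain_map D (Suc n) X X (\<lambda>i. g i ** f i \<boxplus> \<boxminus> idn D (ob X i))"
    using chain_map_diff[OF Xc Xc chain_map_comp[OF Xc Y'(1) Xc f g(1)] chain_map_idn[OF Xc]] .
  have "g (Suc k) ** f (Suc k) \<boxplus> \<boxminus> idn D (ob X (Suc k)) = df X k ** zr (ob X (Suc k)) (ob X k)"
    using g(4) oX k by (simp add: idn_typing add_neg comp_zero cpx_df_typing[OF Xc])
  from first_component_factors[OF Xc Xe gf k zero_hom[OF oX(2,1)] this]
  obtain h where h: "h \<in> Hom D (ob X (Suc 0)) (ob X 0)" "g 0 ** f 0 \<boxplus> \<boxminus> idn D (ob X 0) = h ** df X 0" by auto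
  have fg: "chain_map D (Suc n) Y Y (\<lambda>i. f i ** g i \<boxplus> \<boxminus> idn D (ob Y i))"
    using chain_map_diff[OF Y'(1) Y'(1) chain_map_comp[OF Y'(1) Xc Y'(1) g(1) f] chain_map_idn[OF Y'(1)]] .
  have "f k ** g k \<boxplus> \<boxminus> idn D (ob Y k) = zr (ob Y (Suc k)) (ob Y k) ** df Y k"
    using g(3) oY k by (simp add: idn_typing add_neg zero_comp cpx_df_typing[OF Y'(1)])
  from last_component_factors[OF Y Y'(1) fg k zero_hom[OF oY(2,1)] this]
  obtain t where t: "t \<in> Hom D (ob Y (Suc n)) (ob Y n)"
    "f (Suc n) ** g (Suc n) \<boxplus> \<boxminus> idn D (ob Y (Suc n)) = df Y n ** t" by auto
  show ?thesis
    using dist_of_almost_iso_ends[OF X Y f _ _ h t] chain_map_hom[OF g(1)] by simp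
qed

text \<open>
  If two adjacent components are invertible, their inverses extend to a weak isomorphism in the
  opposite direction, so one implication suffices. If the two end components are invertible, there
  is no chain map back at hand, and each implication uses one of the two lemmas on chain maps with
  identities at the ends.
\<close>

lemma conflation_iff_of_weak_iso:
  assumes w: "weak_iso D n X Y f"
  shows "conflation n D G r X \<longleftrightarrow> conflation n D G r Y"
proof -
  have X: "n_exact_seq D n X" and Y: "n_exact_seq D n Y" and f: "chain_map D (Suc n) X Y f"
    using w by (simp_all add: weak_iso_def)
  note X' = n_exact_seqD[OF X] and Y' = n_exact_seqD[OF Y]
  have f0: "f 0 \<in> Hom D (ob X 0) (ob Y 0)" and fl: "f (Suc n) \<in> Hom D (ob X (Suc n)) (ob Y (Suc n))"
    using chain_map_hom[OF f] by simp_all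
  have oX: "ob X 0 \<in> Obj D" "ob X (Suc 0) \<in> Obj D" "ob X (Suc n) \<in> Obj D"
    and oY: "ob Y 0 \<in> Obj D" "ob Y n \<in> Obj D" "ob Y (Suc n) \<in> Obj D"
    using cpx_ob[OF X'(1)] cpx_ob[OF Y'(1)] by simp_all
  consider k where "k \<le> n" "is_iso D (f k)" "is_iso D (f (Suc k))"
    | "is_iso D (f 0)" "is_iso D (f (Suc n))"
    using w by (auto simp: weak_iso_def)
  then show ?thesis
  proof cases
    case (1 k)
    obtain g where g: "chain_map D (Suc n) Y X g"
      "g k ** f k = idn D (ob X k)" "f k ** g k = idn D (ob Y k)"
      "g (Suc k) ** f (Suc k) = idn D (ob X (Suc k))" "f (Suc k) ** g (Suc k) = idn D (ob Y (Suc k))"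
      using inverse_chain_map[OF X Y f 1] .
    have "is_iso D (g k)" "is_iso D (g (Suc k))"
      using is_isoI[OF chain_map_hom[OF g(1)] chain_map_hom[OF f] g(3,2)]
        is_isoI[OF chain_map_hom[OF g(1)] chain_map_hom[OF f] g(5,4)] 1(1) by simp_all
    with g(1) 1 f show ?thesis
      using conflation_of_middle_iso[OF _ Y f 1] conflation_of_middle_iso[OF _ X g(1) 1(1)]
      unfolding conflation_def by blast
  next
    case 2
    obtain a where a: "a \<in> Hom D (ob Y 0) (ob X 0)" "a ** f 0 = idn D (ob X 0)" "f 0 ** a = idn D (ob Y 0)"
      using is_isoE[OF 2(1) f0] .
    obtain c where c: "c \<in> Hom D (ob Y (Suc n)) (ob X (Suc n))" "c ** f (Suc n) = idn D (ob X (Suc n))"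
      "f (Suc n) ** c = idn D (ob Y (Suc n))"
      using is_isoE[OF 2(2) fl] .
    have "conflation n D G r Y" if "dist X \<delta>" for \<delta>
    proof -
      have h: "a ** f 0 \<boxplus> \<boxminus> idn D (ob X 0) = zr (ob X (Suc 0)) (ob X 0) ** df X 0"
        using a(2) oX by (simp add: idn_typing add_neg zero_comp cpx_df_typing[OF X'(1)])
      have t: "f (Suc n) ** c \<boxplus> \<boxminus> idn D (ob Y (Suc n)) = df Y n ** zr (ob Y (Suc n)) (ob Y n)"
        using c(3) oY by (simp add: idn_typing add_neg comp_zero cpx_df_typing[OF Y'(1)])
      show ?thesis
        using dist_of_almost_iso_ends[OF that Y f a(1) c(1) zero_hom[OF oX(2,1)] h zero_hom[OF oY(3,2)] t] .
    qed
    moreover have "conflation n D G r X" if Yd: "dist Y \<rho>" for \<rho>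
    proof -
      note \<rho> = dist_carrier[OF Yd]
      let ?\<epsilon> = "pull D G (f (Suc n)) (ob Y 0) \<rho>"
      have \<epsilon>: "?\<epsilon> \<in> Ext (ob X (Suc n)) (ob Y 0)" using pull_closed[OF oY(1) fl \<rho>] .
      let ?\<delta> = "push D G (ob X (Suc n)) a ?\<epsilon>"
      have \<delta>: "?\<delta> \<in> Ext (ob X (Suc n)) (ob X 0)" using push_closed[OF oX(3) a(1) \<epsilon>] .
      obtain W where W: "dist W ?\<delta>" "ob W 0 = ob X 0" "ob W (Suc n) = ob X (Suc n)"
        using realise[OF oX(3,1) \<delta>] .
      have "pull D G c (ob X 0) ?\<delta> = push D G (ob Y (Suc n)) a (pull D G c (ob Y 0) ?\<epsilon>)"
        using push_pull_commute[OF c(1) a(1) \<epsilon>] by simp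
      also have "pull D G c (ob Y 0) ?\<epsilon> = \<rho>"
        using pull_comp[OF oY(1) fl c(1) \<rho>] c(3) pull_idn[OF oY(3,1) \<rho>] by simp
      finally obtain w where w: "chain_map D (Suc n) Y W w" "w 0 = a" "w (Suc n) = c"
        using dist_lift[OF Yd W(1), of a c] a(1) c(1) W(2,3) by auto
      have "chain_map_between D n X W (\<lambda>i. w i ** f i)"
        using chain_map_comp[OF X'(1) Y'(1) dist_cpx[OF W(1)] f w(1)] a(2) c(2) w(2,3)
        by (simp add: chain_map_between_def)
      then show ?thesis using dist_of_chain_map_to[OF X W(1)] unfolding conflation_def by blast
    qed
    ultimately show ?thesis unfolding conflation_def by blast
  qed
qed

lemma zero_obj_in: "zero_obj D \<in> Obj D"
  and idn_zero_obj: "idn D (zero_obj D) = zr (zero_obj D) (zero_obj D)"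
proof -
  have z: "is_zero_obj D (zero_obj D)" unfolding zero_obj_def using someI_ex[OF ex_zero_obj] .
  then show o: "zero_obj D \<in> Obj D" by (simp add: is_zero_obj_def)
  have "\<exists>!f. f \<in> Hom D (zero_obj D) (zero_obj D)" using z o unfolding is_zero_obj_def by blast
  then show "idn D (zero_obj D) = zr (zero_obj D) (zero_obj D)" using idn_hom[OF o] zero_hom[OF o o] by blast
qed

lemma zero_cpx_conflation: "conflation n D G r (zero_cpx D n)"
proof -
  let ?Z = "zero_obj D"
  interpret g: comm_group "grp G ?Z ?Z" using grp_comm_group zero_obj_in by blast
  have eq: "zero_cpx D n = triv D n 0 ?Z"
    by (simp add: zero_cpx_def triv_def mk_cpx_def Let_def idn_zero_obj cong: if_cong)
  have "zero_cpx D n \<in> cpxs D (Suc n)"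
    by (simp add: cpxs_def zero_cpx_def mk_cpx_def zero_obj_in zero_hom comp_zero zero_typing)
  moreover have "ob (zero_cpx D n) 0 = ?Z" "ob (zero_cpx D n) (Suc n) = ?Z" by (simp_all add: zero_cpx_def mk_cpx_def)
  ultimately have "dist (zero_cpx D n) \<one>\<^bsub>grp G ?Z ?Z\<^esub>"
    using R2_left[OF zero_obj_in] eq by (simp add: distinguished_def)
  then show ?thesis unfolding conflation_def by blast
qed

lemma exists_n_pushout:
  assumes X: "dist X \<delta>" and a: "a \<in> Hom D (ob X 0) B"
  obtains Y f where "dist Y (push D G (ob X (Suc n)) a \<delta>)" "ob Y 0 = B" "ob Y (Suc n) = ob X (Suc n)"
    "lift_of D n X Y a (idn D (ob X (Suc n))) f" "n_pushout D n (init_cpx n X) (init_cpx n Y) f"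
proof -
  note oX = dist_obj(3)[OF X]
  obtain Y where Y: "dist Y (push D G (ob X (Suc n)) a \<delta>)" "ob Y 0 = B" "ob Y (Suc n) = ob X (Suc n)"
    using realise[OF oX Hom_obj(2)[OF a] push_closed[OF oX a dist_carrier[OF X]]] .
  obtain f where f: "lift_of D n X Y a (idn D (ob X (Suc n))) f"
      "dist (Ncone D n X Y f) (pull D G (df Y n) (ob X 0) \<delta>)"
    using EA2_op[OF X, of Y a] Y a by auto
  have "chain_map D (Suc n) X Y f" using f(1) by (simp add: lift_of_def)
  from n_pushout_of_Ncone[OF dist_cpx[OF X] dist_cpx[OF Y(1)] this n_pos dist_exact[OF f(2)]]
  show ?thesis using that Y f(1) by blast
qed

lemma exists_n_pullback:
  assumes X: "dist X \<delta>" and c: "c \<in> Hom D B (ob X (Suc n))"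
  obtains Y f where "dist Y (pull D G c (ob X 0) \<delta>)" "ob Y 0 = ob X 0" "ob Y (Suc n) = B"
    "lift_of D n Y X (idn D (ob X 0)) c f" "n_pullback D n (tail_cpx n Y) (tail_cpx n X) (\<lambda>i. f (Suc i))"
proof -
  note oX = dist_obj(2)[OF X]
  obtain Y where Y: "dist Y (pull D G c (ob X 0) \<delta>)" "ob Y 0 = ob X 0" "ob Y (Suc n) = B"
    using realise[OF Hom_obj(1)[OF c] oX pull_closed[OF oX c dist_carrier[OF X]]] .
  obtain f where f: "lift_of D n Y X (idn D (ob X 0)) c f"
      "dist (Mcone D n Y X f) (push D G (ob X (Suc n)) (df Y 0) \<delta>)"
    using EA2[OF X, of Y c] Y c by auto
  have "chain_map D (Suc n) Y X f" using f(1) by (simp add: lift_of_def)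
  from n_pullback_of_Mcone[OF dist_cpx[OF Y(1)] dist_cpx[OF X] this n_pos dist_exact[OF f(2)]]
  show ?thesis using that Y f(1) by blast
qed

abbreviation confl where "confl \<equiv> {X. conflation n D G r X}"

theorem n_exact_category_conflations: "n_exact_category n D confl"
proof (intro n_exact_category.intro additive_category_axioms n_exact_category_axioms.intro)
  show "n_exact_seq D n X" if "X \<in> confl" for X using that dist_exact unfolding conflation_def by blast
  show "(X \<in> confl) = (Y \<in> confl)" if "weak_iso D n X Y f" for X Y f
    using conflation_iff_of_weak_iso[OF that] by simp
  show "zero_cpx D n \<in> confl" using zero_cpx_conflation by simp
  have "adm_mono confl = {f. inflation n D G r f}" by (auto simp: adm_mono_def inflation_def)
  then show "comp_closed D (adm_mono confl)" using EA1 by simp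
  have "adm_epi n confl = {f. deflation n D G r f}" by (auto simp: adm_epi_def deflation_def)
  then show "comp_closed D (adm_epi n confl)" using EA1_op by simp
  fix X u B assume X: "X \<in> confl"
  then obtain \<delta> where d: "dist X \<delta>" unfolding conflation_def by blast
  {
    assume u: "u \<in> Hom D (ob X 0) B"
    obtain Y f where Y: "dist Y (push D G (ob X (Suc n)) u \<delta>)"
      "lift_of D n X Y u (idn D (ob X (Suc n))) f" "n_pushout D n (init_cpx n X) (init_cpx n Y) f"
      using exists_n_pushout[OF d u] by blast
    have "df (init_cpx n Y) 0 = df Y 0" using n_pos by (simp add: init_cpx_def mk_cpx_def)
    then have "df (init_cpx n Y) 0 \<in> adm_mono confl" using Y(1) unfolding adm_mono_def conflation_def by blast
    then show "\<exists>Y h. n_pushout D n (init_cpx n X) Y h \<and> h 0 = u \<and> df Y 0 \<in> adm_mono confl"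
      using Y(2,3) unfolding lift_of_def by blast
  next
    fix g assume g: "g \<in> Hom D B (ob X (n + 1))"
    then have g': "g \<in> Hom D B (ob X (Suc n))" by simp
    obtain Y f where Y: "dist Y (pull D G g (ob X 0) \<delta>)"
      "lift_of D n Y X (idn D (ob X 0)) g f" "n_pullback D n (tail_cpx n Y) (tail_cpx n X) (\<lambda>i. f (Suc i))"
      using exists_n_pullback[OF d g'] by blast
    have "df (tail_cpx n Y) (n - 1) = df Y n" using n_pos by (simp add: tail_cpx_def mk_cpx_def)
    then have "df (tail_cpx n Y) (n - 1) \<in> adm_epi n confl" using Y(1) unfolding adm_epi_def conflation_def by blast
    then show "\<exists>Y h. n_pullback D n Y (tail_cpx n X) h \<and> h n = g \<and> df Y (n - 1) \<in> adm_epi n confl"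
      using Y(2,3) unfolding lift_of_def by blast
  }
qed

section \<open>The extension bifunctor of the conflations\<close>

lemma dist_iff_class:
  assumes "X \<in> cpxs_between D n A C" "\<delta> \<in> Ext C A"
  shows "dist X \<delta> \<longleftrightarrow> r C A \<delta> = hclass D n X"
  using assms by (simp add: distinguished_def cpxs_between_def)

lemma realisation_inj:
  assumes "C \<in> Obj D" "A \<in> Obj D" "\<delta> \<in> Ext C A" "\<epsilon> \<in> Ext C A" "r C A \<delta> = r C A \<epsilon>"
  shows "\<delta> = \<epsilon>"
proof -
  obtain X where X: "dist X \<delta>" "ob X 0 = A" "ob X (Suc n) = C" using realise[OF assms(1-3)] .
  then have "dist X \<epsilon>" using assms(4,5) by (simp add: distinguished_def)
  then show ?thesis using dist_unique X(1) by blast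
qed

lemma ex_carrier_conflations:
  assumes "C \<in> Obj D" "A \<in> Obj D"
  shows "ex_carrier n D confl C A = r C A ` Ext C A"
proof
  show "ex_carrier n D confl C A \<subseteq> r C A ` Ext C A"
  proof
    fix \<xi> assume "\<xi> \<in> ex_carrier n D confl C A"
    then obtain X \<delta> where X: "dist X \<delta>" "X \<in> cpxs_between D n A C" "\<xi> = hclass D n X"
      unfolding ex_carrier_def conflation_def by blast
    then have "\<delta> \<in> Ext C A" "r C A \<delta> = \<xi>" by (simp_all add: distinguished_def cpxs_between_def)
    then show "\<xi> \<in> r C A ` Ext C A" by blast
  qed
  show "r C A ` Ext C A \<subseteq> ex_carrier n D confl C A"
  proof
    fix \<xi> assume "\<xi> \<in> r C A ` Ext C A"
    then obtain \<delta> where \<delta>: "\<delta> \<in> Ext C A" "\<xi> = r C A \<delta>" by blast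
    obtain X where X: "dist X \<delta>" "ob X 0 = A" "ob X (Suc n) = C" using realise[OF assms \<delta>(1)] .
    have "X \<in> cpxs_between D n A C" "\<xi> = hclass D n X" using X \<delta>(2) by (auto simp: distinguished_def cpxs_between_def)
    then show "\<xi> \<in> ex_carrier n D confl C A" using X(1) unfolding ex_carrier_def conflation_def by blast
  qed
qed

lemma conflation_class:
  assumes "X \<in> confl \<inter> cpxs_between D n A C"
  obtains \<delta> where "dist X \<delta>" "\<delta> \<in> Ext C A" "hclass D n X = r C A \<delta>" "ob X 0 = A" "ob X (Suc n) = C"
proof -
  obtain \<delta> where "dist X \<delta>" using assms unfolding conflation_def by blast
  moreover have "ob X 0 = A" "ob X (Suc n) = C" using assms by (simp_all add: cpxs_between_def)
  ultimately show ?thesis using that by (auto simp: distinguished_def)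
qed

lemma dist_between:
  assumes "dist X \<delta>" "ob X 0 = A" "ob X (Suc n) = C"
  shows "X \<in> confl \<inter> cpxs_between D n A C" "hclass D n X = r C A \<delta>"
  using assms unfolding conflation_def by (auto simp: distinguished_def cpxs_between_def)

text \<open>
  Existence of the pushout class comes from the dual of (EA2); that it does not depend on the
  choices is the fact that every chain map between conflations is a morphism of extensions.
\<close>

lemma ex_push_realisation:
  assumes C: "C \<in> Obj D" and a: "a \<in> Hom D A B" and \<delta>: "\<delta> \<in> Ext C A"
  shows "ex_push n D confl C a (r C A \<delta>) = r C B (push D G C a \<delta>)"
proof -
  have dc: "Dom D a = A" "Cod D a = B" using a by (simp_all add: in_Hom)
  note o = Hom_obj[OF a]
  show ?thesis unfolding ex_push_def dc
  proof (rule the_equality)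
    obtain X where X: "dist X \<delta>" "ob X 0 = A" "ob X (Suc n) = C" using realise[OF C o(1) \<delta>] .
    have aX: "a \<in> Hom D (ob X 0) B" using a X(2) by simp
    obtain Y f where Y: "dist Y (push D G C a \<delta>)" "ob Y 0 = B" "ob Y (Suc n) = C"
      "lift_of D n X Y a (idn D C) f" "n_pushout D n (init_cpx n X) (init_cpx n Y) f"
      using exists_n_pushout[OF X(1) aX] X(3) by metis
    show "\<exists>X Y f. X \<in> confl \<inter> cpxs_between D n A C \<and> r C A \<delta> = hclass D n X \<and>
       Y \<in> confl \<inter> cpxs_between D n B C \<and> r C B (push D G C a \<delta>) = hclass D n Y \<and>
       lift_of D n X Y a (idn D C) f \<and> n_pushout D n (init_cpx n X) (init_cpx n Y) f"
      using dist_between[OF X] dist_between[OF Y(1-3)] Y(4,5) by metis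
  next
    fix \<eta> assume "\<exists>X Y f. X \<in> confl \<inter> cpxs_between D n A C \<and> r C A \<delta> = hclass D n X \<and>
       Y \<in> confl \<inter> cpxs_between D n B C \<and> \<eta> = hclass D n Y \<and>
       lift_of D n X Y a (idn D C) f \<and> n_pushout D n (init_cpx n X) (init_cpx n Y) f"
    then obtain X Y f where h: "X \<in> confl \<inter> cpxs_between D n A C" "r C A \<delta> = hclass D n X"
       "Y \<in> confl \<inter> cpxs_between D n B C" "\<eta> = hclass D n Y" "lift_of D n X Y a (idn D C) f" by blast
    have X: "dist X \<delta>" using dist_iff_class[of X A C \<delta>] h(1,2) \<delta> by simp
    obtain \<rho> where \<rho>: "dist Y \<rho>" "\<rho> \<in> Ext C B" "hclass D n Y = r C B \<rho>" "ob Y 0 = B" "ob Y (Suc n) = C"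
      using conflation_class[OF h(3)] .
    have oX: "ob X (Suc n) = C" using h(1) by (simp add: cpxs_between_def)
    have f: "chain_map D (Suc n) X Y f" "f 0 = a" "f (Suc n) = idn D C" using h(5) by (simp_all add: lift_of_def)
    have "push D G C a \<delta> = \<rho>"
      using chain_map_is_extension_morphism[OF X \<rho>(1) f(1)] f(2,3) \<rho>(4) oX pull_idn[OF C o(2) \<rho>(2)] by simp
    then show "\<eta> = r C B (push D G C a \<delta>)" using h(4) \<rho>(3) by simp
  qed
qed

lemma ex_pull_realisation:
  assumes A: "A \<in> Obj D" and c: "c \<in> Hom D B C" and \<delta>: "\<delta> \<in> Ext C A"
  shows "ex_pull n D confl c A (r C A \<delta>) = r B A (pull D G c A \<delta>)"
proof -
  have dc: "Dom D c = B" "Cod D c = C" using c by (simp_all add: in_Hom)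
  note o = Hom_obj[OF c]
  show ?thesis unfolding ex_pull_def dc
  proof (rule the_equality)
    obtain X where X: "dist X \<delta>" "ob X 0 = A" "ob X (Suc n) = C" using realise[OF o(2) A \<delta>] .
    have cX: "c \<in> Hom D B (ob X (Suc n))" using c X(3) by simp
    obtain Y f where Y: "dist Y (pull D G c A \<delta>)" "ob Y 0 = A" "ob Y (Suc n) = B"
      "lift_of D n Y X (idn D A) c f" "n_pullback D n (tail_cpx n Y) (tail_cpx n X) (\<lambda>i. f (Suc i))"
      using exists_n_pullback[OF X(1) cX] X(2) by metis
    show "\<exists>X Y f. X \<in> confl \<inter> cpxs_between D n A C \<and> r C A \<delta> = hclass D n X \<and>
       Y \<in> confl \<inter> cpxs_between D n A B \<and> r B A (pull D G c A \<delta>) = hclass D n Y \<and>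
       lift_of D n Y X (idn D A) c f \<and> n_pullback D n (tail_cpx n Y) (tail_cpx n X) (\<lambda>i. f (Suc i))"
      using dist_between[OF X] dist_between[OF Y(1-3)] Y(4,5) by metis
  next
    fix \<eta> assume "\<exists>X Y f. X \<in> confl \<inter> cpxs_between D n A C \<and> r C A \<delta> = hclass D n X \<and>
       Y \<in> confl \<inter> cpxs_between D n A B \<and> \<eta> = hclass D n Y \<and>
       lift_of D n Y X (idn D A) c f \<and> n_pullback D n (tail_cpx n Y) (tail_cpx n X) (\<lambda>i. f (Suc i))"
    then obtain X Y f where h: "X \<in> confl \<inter> cpxs_between D n A C" "r C A \<delta> = hclass D n X"
       "Y \<in> confl \<inter> cpxs_between D n A B" "\<eta> = hclass D n Y" "lift_of D n Y X (idn D A) c f" by blast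
    have X: "dist X \<delta>" using dist_iff_class[of X A C \<delta>] h(1,2) \<delta> by simp
    obtain \<rho> where \<rho>: "dist Y \<rho>" "\<rho> \<in> Ext B A" "hclass D n Y = r B A \<rho>" "ob Y 0 = A" "ob Y (Suc n) = B"
      using conflation_class[OF h(3)] .
    have oX: "ob X 0 = A" using h(1) by (simp add: cpxs_between_def)
    have f: "chain_map D (Suc n) Y X f" "f 0 = idn D A" "f (Suc n) = c" using h(5) by (simp_all add: lift_of_def)
    have "pull D G c A \<delta> = \<rho>"
      using chain_map_is_extension_morphism[OF \<rho>(1) X f(1)] f(2,3) \<rho>(5) oX push_idn[OF o(1) A \<rho>(2)] by simp
    then show "\<eta> = r B A (pull D G c A \<delta>)" using h(4) \<rho>(3) by simp
  qed
qed

lemma ex_act_realisation: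
  assumes c: "c \<in> Hom D C' C" and a: "a \<in> Hom D A A'" and \<delta>: "\<delta> \<in> Ext C A"
  shows "ex_act n D confl c a (r C A \<delta>) = r C' A' (act G c a \<delta>)"
proof -
  note o = Hom_obj[OF c] Hom_obj[OF a]
  have "Cod D c = C" "Cod D a = A'" using c a by (simp_all add: in_Hom)
  then show ?thesis
    unfolding ex_act_def act_pull_push[OF c a \<delta>]
    using ex_push_realisation[OF o(2) a \<delta>] ex_pull_realisation[OF o(4) c push_closed[OF o(2) a \<delta>]] by simp
qed

text \<open>
  The extension \<open>\<theta>\<close> is the external direct sum of \<open>\<delta>\<close> and \<open>\<epsilon>\<close>, so that the injections and the
  projections of the end terms are morphisms of extensions. Their lifts assemble to chain maps in
  both directions between the direct sum of the conflations and a realisation of \<open>\<theta>\<close>, with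
  identities at the ends.
\<close>

lemma dist_dsum_cpx:
  assumes X: "dist X \<delta>" and Y: "dist Y \<epsilon>"
    and ends: "ob X 0 = A" "ob Y 0 = B" "ob X (Suc n) = C" "ob Y (Suc n) = E"
  defines "\<theta> \<equiv> push D G (dsum D C E) (in1 D A B) (pull D G (pr1 D C E) A \<delta>)
     \<otimes>\<^bsub>grp G (dsum D C E) (dsum D A B)\<^esub> push D G (dsum D C E) (in2 D A B) (pull D G (pr2 D C E) B \<epsilon>)"
  shows "dist (dsum_cpx D n X Y) \<theta>"
proof -
  let ?S = "dsum_cpx D n X Y" and ?P = "dsum D C E" and ?Q = "dsum D A B"
  note Xc = dist_cpx[OF X] and Yc = dist_cpx[OF Y] and Xe = dist_exact[OF X] and Ye = dist_exact[OF Y]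
  have o: "A \<in> Obj D" "B \<in> Obj D" "C \<in> Obj D" "E \<in> Obj D"
    using dist_obj[OF X] dist_obj[OF Y] ends by auto
  note bp = biprod_simps[OF o(1,2)] biprod_simps[OF o(3,4)]
  have \<delta>: "\<delta> \<in> Ext C A" and \<epsilon>: "\<epsilon> \<in> Ext E B"
    using dist_carrier[OF X] dist_carrier[OF Y] ends by simp_all
  note Se = n_exact_seq_dsum_cpx(1)[OF Xe Ye] and maps = n_exact_seq_dsum_cpx(2-5)[OF Xe Ye]
  note Sc = n_exact_seqD(1)[OF Se]
  have S0: "ob ?S 0 = ?Q" and Sl: "ob ?S (Suc n) = ?P" using ends by (simp_all add: dsum_cpx_def mk_cpx_def)
  have m: "in1 D A B \<in> Hom D A ?Q" "in2 D A B \<in> Hom D B ?Q" "pr1 D A B \<in> Hom D ?Q A" "pr2 D A B \<in> Hom D ?Q B"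
    "in1 D C E \<in> Hom D C ?P" "in2 D C E \<in> Hom D E ?P" "pr1 D C E \<in> Hom D ?P C" "pr2 D C E \<in> Hom D ?P E"
    using bp by (simp_all add: in_Hom)
  have oPQ: "?P \<in> Obj D" "?Q \<in> Obj D" using bp by simp_all
  let ?d = "pull D G (pr1 D C E) A \<delta>" and ?e = "pull D G (pr2 D C E) B \<epsilon>"
  have de: "?d \<in> Ext ?P A" "?e \<in> Ext ?P B"
    using pull_closed[OF o(1) m(7) \<delta>] pull_closed[OF o(2) m(8) \<epsilon>] .
  let ?\<theta>1 = "push D G ?P (in1 D A B) ?d" and ?\<theta>2 = "push D G ?P (in2 D A B) ?e"
  have \<theta>12: "?\<theta>1 \<in> Ext ?P ?Q" "?\<theta>2 \<in> Ext ?P ?Q"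
    using push_closed[OF oPQ(1) m(1) de(1)] push_closed[OF oPQ(1) m(2) de(2)] .
  interpret PQ: comm_group "grp G ?P ?Q" using grp_comm_group oPQ by blast
  interpret PA: comm_group "grp G ?P A" using grp_comm_group oPQ o by blast
  interpret PB: comm_group "grp G ?P B" using grp_comm_group oPQ o by blast
  interpret CQ: comm_group "grp G C ?Q" using grp_comm_group oPQ o by blast
  interpret EQ: comm_group "grp G E ?Q" using grp_comm_group oPQ o by blast
  have \<theta>: "\<theta> \<in> Ext ?P ?Q" unfolding \<theta>_def using \<theta>12 by simp
  have p1: "push D G ?P (pr1 D A B) ?\<theta>1 = ?d" "push D G ?P (pr1 D A B) ?\<theta>2 = \<one>\<^bsub>grp G ?P A\<^esub>"
    "push D G ?P (pr2 D A B) ?\<theta>1 = \<one>\<^bsub>grp G ?P B\<^esub>" "push D G ?P (pr2 D A B) ?\<theta>2 = ?e"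
    using push_comp[OF oPQ(1) m(1) m(3) de(1), symmetric] push_comp[OF oPQ(1) m(2) m(3) de(2), symmetric]
      push_comp[OF oPQ(1) m(1) m(4) de(1), symmetric] push_comp[OF oPQ(1) m(2) m(4) de(2), symmetric]
      push_idn[OF oPQ(1) o(1) de(1)] push_idn[OF oPQ(1) o(2) de(2)]
      push_zero[OF oPQ(1) o(1) o(2) de(1)] push_zero[OF oPQ(1) o(2) o(1) de(2)] bp by simp_all
  have pr1\<theta>: "push D G ?P (pr1 D A B) \<theta> = ?d"
    unfolding \<theta>_def using push_mult[OF oPQ(1) m(3) \<theta>12] p1 de by simp
  have pr2\<theta>: "push D G ?P (pr2 D A B) \<theta> = ?e"
    unfolding \<theta>_def using push_mult[OF oPQ(1) m(4) \<theta>12] p1 de by simp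
  have l1: "pull D G (in1 D C E) ?Q ?\<theta>1 = push D G C (in1 D A B) \<delta>"
    "pull D G (in1 D C E) ?Q ?\<theta>2 = \<one>\<^bsub>grp G C ?Q\<^esub>"
    "pull D G (in2 D C E) ?Q ?\<theta>1 = \<one>\<^bsub>grp G E ?Q\<^esub>"
    "pull D G (in2 D C E) ?Q ?\<theta>2 = push D G E (in2 D A B) \<epsilon>"
    using push_pull_commute[OF m(5) m(1) de(1), symmetric] push_pull_commute[OF m(5) m(2) de(2), symmetric]
      push_pull_commute[OF m(6) m(1) de(1), symmetric] push_pull_commute[OF m(6) m(2) de(2), symmetric]
      pull_comp[OF o(1) m(7) m(5) \<delta>, symmetric] pull_comp[OF o(2) m(8) m(5) \<epsilon>, symmetric]
      pull_comp[OF o(1) m(7) m(6) \<delta>, symmetric] pull_comp[OF o(2) m(8) m(6) \<epsilon>, symmetric]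
      pull_idn[OF o(3,1) \<delta>] pull_idn[OF o(4,2) \<epsilon>] pull_zero[OF o(3,1,4) \<delta>] pull_zero[OF o(4,2,3) \<epsilon>]
      push_one[OF o(3) m(2)] push_one[OF o(4) m(1)] bp by simp_all
  have in1\<theta>: "pull D G (in1 D C E) ?Q \<theta> = push D G C (in1 D A B) \<delta>"
    unfolding \<theta>_def using pull_mult[OF oPQ(2) m(5) \<theta>12] l1 push_closed[OF o(3) m(1) \<delta>] by simp
  have in2\<theta>: "pull D G (in2 D C E) ?Q \<theta> = push D G E (in2 D A B) \<epsilon>"
    unfolding \<theta>_def using pull_mult[OF oPQ(2) m(6) \<theta>12] l1 push_closed[OF o(4) m(2) \<epsilon>] by simp
  obtain W where W: "dist W \<theta>" "ob W 0 = ?Q" "ob W (Suc n) = ?P" using realise[OF oPQ \<theta>] .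
  note Wc = dist_cpx[OF W(1)]
  obtain u where u: "chain_map D (Suc n) X W u" "u 0 = in1 D A B" "u (Suc n) = in1 D C E"
    using dist_lift[OF X W(1), of "in1 D A B" "in1 D C E"] m W(2,3) ends in1\<theta> by auto
  obtain v where v: "chain_map D (Suc n) Y W v" "v 0 = in2 D A B" "v (Suc n) = in2 D C E"
    using dist_lift[OF Y W(1), of "in2 D A B" "in2 D C E"] m W(2,3) ends in2\<theta> by auto
  obtain s where s: "chain_map D (Suc n) W X s" "s 0 = pr1 D A B" "s (Suc n) = pr1 D C E"
    using dist_lift[OF W(1) X, of "pr1 D A B" "pr1 D C E"] m W(2,3) ends pr1\<theta> by auto
  obtain t where t: "chain_map D (Suc n) W Y t" "t 0 = pr2 D A B" "t (Suc n) = pr2 D C E"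
    using dist_lift[OF W(1) Y, of "pr2 D A B" "pr2 D C E"] m W(2,3) ends pr2\<theta> by auto
  have "chain_map_between D n ?S W (\<lambda>i. u i ** pr1 D (ob X i) (ob Y i) \<boxplus> v i ** pr2 D (ob X i) (ob Y i))"
    using chain_map_add[OF Sc Wc chain_map_comp[OF Sc Xc Wc maps(3) u(1)] chain_map_comp[OF Sc Yc Wc maps(4) v(1)]]
      u v bp S0 Sl ends by (simp add: chain_map_between_def)
  moreover have "chain_map_between D n W ?S (\<lambda>i. in1 D (ob X i) (ob Y i) ** s i \<boxplus> in2 D (ob X i) (ob Y i) ** t i)"
    using chain_map_add[OF Wc Sc chain_map_comp[OF Wc Xc Sc s(1) maps(1)] chain_map_comp[OF Wc Yc Sc t(1) maps(2)]]
      s t bp W(2,3) ends by (simp add: chain_map_between_def)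
  ultimately show ?thesis using dist_transport[OF W(1) Se] by blast
qed

text \<open>
  Pulling \<open>\<theta>\<close> back along the diagonal and pushing it along the codiagonal turns the direct sum
  into the sum in the extension group.
\<close>

lemma baer_sum_realisation:
  assumes C: "C \<in> Obj D" and A: "A \<in> Obj D"
    and \<delta>: "\<delta> \<in> Ext C A" and \<epsilon>: "\<epsilon> \<in> Ext C A"
  shows "baer_sum n D confl C A (r C A \<delta>) (r C A \<epsilon>) = r C A (\<delta> \<otimes>\<^bsub>grp G C A\<^esub> \<epsilon>)"
proof -
  let ?M = "col D (idn D C) (idn D C)" and ?N = "row D (idn D A) (idn D A)"
  have main: "ex_act n D confl ?M ?N (hclass D n (dsum_cpx D n X Y)) = r C A (\<delta> \<otimes>\<^bsub>grp G C A\<^esub> \<epsilon>)"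
    if X: "dist X \<delta>" "ob X 0 = A" "ob X (Suc n) = C" and Y: "dist Y \<epsilon>" "ob Y 0 = A" "ob Y (Suc n) = C" for X Y
  proof -
    let ?P = "dsum D C C" and ?Q = "dsum D A A"
    note bp = biprod_simps[OF A A] biprod_simps[OF C C]
    have oPQ: "?P \<in> Obj D" "?Q \<in> Obj D" using bp by simp_all
    have m: "in1 D A A \<in> Hom D A ?Q" "in2 D A A \<in> Hom D A ?Q" "pr1 D C C \<in> Hom D ?P C" "pr2 D C C \<in> Hom D ?P C"
      using bp by (simp_all add: in_Hom)
    have dn: "?M \<in> Hom D C ?P" "?N \<in> Hom D ?Q A" using A C by (simp_all add: in_Hom col_typing row_typing idn_typing)
    have dn': "pr1 D C C ** ?M = idn D C" "pr2 D C C ** ?M = idn D C" "?N ** in1 D A A = idn D A" "?N ** in2 D A A = idn D A"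
      using A C bp by (simp_all add: col_def row_def cat_simps pr_in_comp)
    define \<theta> where "\<theta> = push D G ?P (in1 D A A) (pull D G (pr1 D C C) A \<delta>)
     \<otimes>\<^bsub>grp G ?P ?Q\<^esub> push D G ?P (in2 D A A) (pull D G (pr2 D C C) A \<epsilon>)"
    have S: "dist (dsum_cpx D n X Y) \<theta>"
      unfolding \<theta>_def using dist_dsum_cpx[OF X(1) Y(1) X(2) Y(2) X(3) Y(3)] .
    have Sends: "ob (dsum_cpx D n X Y) 0 = ?Q" "ob (dsum_cpx D n X Y) (Suc n) = ?P"
      using X Y by (simp_all add: dsum_cpx_def mk_cpx_def)
    have \<theta>: "\<theta> \<in> Ext ?P ?Q" using dist_carrier[OF S] Sends by simp
    have "hclass D n (dsum_cpx D n X Y) = r ?P ?Q \<theta>" using dist_hclass[OF S] Sends by simp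
    then have "ex_act n D confl ?M ?N (hclass D n (dsum_cpx D n X Y)) = r C A (act G ?M ?N \<theta>)"
      using ex_act_realisation[OF dn \<theta>] by simp
    also have "act G ?M ?N \<theta> = \<delta> \<otimes>\<^bsub>grp G C A\<^esub> \<epsilon>"
    proof -
      have d: "pull D G (pr1 D C C) A \<delta> \<in> Ext ?P A" "pull D G (pr2 D C C) A \<epsilon> \<in> Ext ?P A"
        using pull_closed[OF A m(3) \<delta>] pull_closed[OF A m(4) \<epsilon>] .
      have d1: "push D G ?P (in1 D A A) (pull D G (pr1 D C C) A \<delta>) \<in> Ext ?P ?Q"
        "push D G ?P (in2 D A A) (pull D G (pr2 D C C) A \<epsilon>) \<in> Ext ?P ?Q"
        using push_closed[OF oPQ(1) m(1) d(1)] push_closed[OF oPQ(1) m(2) d(2)] .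
      have "push D G ?P ?N \<theta> = pull D G (pr1 D C C) A \<delta> \<otimes>\<^bsub>grp G ?P A\<^esub> pull D G (pr2 D C C) A \<epsilon>"
        unfolding \<theta>_def
        using push_mult[OF oPQ(1) dn(2) d1] push_comp[OF oPQ(1) m(1) dn(2) d(1), symmetric]
          push_comp[OF oPQ(1) m(2) dn(2) d(2), symmetric] dn' push_idn[OF oPQ(1) A d(1)] push_idn[OF oPQ(1) A d(2)]
        by simp
      then have "act G ?M ?N \<theta> = pull D G ?M A (pull D G (pr1 D C C) A \<delta> \<otimes>\<^bsub>grp G ?P A\<^esub> pull D G (pr2 D C C) A \<epsilon>)"
        using act_pull_push[OF dn \<theta>] by simp
      also have "\<dots> = \<delta> \<otimes>\<^bsub>grp G C A\<^esub> \<epsilon>"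
        using pull_mult[OF A dn(1) d] pull_comp[OF A m(3) dn(1) \<delta>, symmetric] pull_comp[OF A m(4) dn(1) \<epsilon>, symmetric]
          dn' pull_idn[OF C A \<delta>] pull_idn[OF C A \<epsilon>] by simp
      finally show ?thesis .
    qed
    finally show ?thesis .
  qed
  show ?thesis unfolding baer_sum_def
  proof (rule the_equality)
    obtain X where X: "dist X \<delta>" "ob X 0 = A" "ob X (Suc n) = C" using realise[OF C A \<delta>] .
    obtain Y where Y: "dist Y \<epsilon>" "ob Y 0 = A" "ob Y (Suc n) = C" using realise[OF C A \<epsilon>] .
    show "\<exists>X Y. X \<in> confl \<inter> cpxs_between D n A C \<and> r C A \<delta> = hclass D n X \<and>
       Y \<in> confl \<inter> cpxs_between D n A C \<and> r C A \<epsilon> = hclass D n Y \<and>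
       r C A (\<delta> \<otimes>\<^bsub>grp G C A\<^esub> \<epsilon>) = ex_act n D confl ?M ?N (hclass D n (dsum_cpx D n X Y))"
      using dist_between[OF X] dist_between[OF Y] main[OF X Y] by metis
  next
    fix \<zeta> assume "\<exists>X Y. X \<in> confl \<inter> cpxs_between D n A C \<and> r C A \<delta> = hclass D n X \<and>
       Y \<in> confl \<inter> cpxs_between D n A C \<and> r C A \<epsilon> = hclass D n Y \<and>
       \<zeta> = ex_act n D confl ?M ?N (hclass D n (dsum_cpx D n X Y))"
    then obtain X Y where h: "X \<in> cpxs_between D n A C" "r C A \<delta> = hclass D n X"
       "Y \<in> cpxs_between D n A C" "r C A \<epsilon> = hclass D n Y"
       "\<zeta> = ex_act n D confl ?M ?N (hclass D n (dsum_cpx D n X Y))" by blast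
    have "dist X \<delta>" "dist Y \<epsilon>" using dist_iff_class[OF h(1) \<delta>] dist_iff_class[OF h(3) \<epsilon>] h(2,4) by simp_all
    moreover have "ob X 0 = A" "ob X (Suc n) = C" "ob Y 0 = A" "ob Y (Suc n) = C"
      using h(1,3) by (simp_all add: cpxs_between_def)
    ultimately show "\<zeta> = r C A (\<delta> \<otimes>\<^bsub>grp G C A\<^esub> \<epsilon>)" using main h(5) by simp
  qed
qed

lemma ex_grp_one:
  assumes C: "C \<in> Obj D" and A: "A \<in> Obj D"
  shows "\<one>\<^bsub>ex_grp n D confl C A\<^esub> = r C A \<one>\<^bsub>grp G C A\<^esub>"
proof -
  interpret g: comm_group "grp G C A" using grp_comm_group C A by blast
  have unit: "baer_sum n D confl C A (r C A \<one>\<^bsub>grp G C A\<^esub>) \<xi> = \<xi> \<and> baer_sum n D confl C A \<xi> (r C A \<one>\<^bsub>grp G C A\<^esub>) = \<xi>"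
    if "\<xi> \<in> r C A ` Ext C A" for \<xi>
    using that baer_sum_realisation[OF C A g.one_closed] baer_sum_realisation[OF C A _ g.one_closed] by auto
  have "(THE \<epsilon>. \<epsilon> \<in> r C A ` Ext C A \<and> (\<forall>\<xi> \<in> r C A ` Ext C A.
       baer_sum n D confl C A \<epsilon> \<xi> = \<xi> \<and> baer_sum n D confl C A \<xi> \<epsilon> = \<xi>)) = r C A \<one>\<^bsub>grp G C A\<^esub>"
  proof (rule the_equality)
    show "r C A \<one>\<^bsub>grp G C A\<^esub> \<in> r C A ` Ext C A \<and> (\<forall>\<xi> \<in> r C A ` Ext C A.
       baer_sum n D confl C A (r C A \<one>\<^bsub>grp G C A\<^esub>) \<xi> = \<xi> \<and> baer_sum n D confl C A \<xi> (r C A \<one>\<^bsub>grp G C A\<^esub>) = \<xi>)"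
      using unit by blast
    fix \<epsilon> assume h: "\<epsilon> \<in> r C A ` Ext C A \<and> (\<forall>\<xi> \<in> r C A ` Ext C A.
       baer_sum n D confl C A \<epsilon> \<xi> = \<xi> \<and> baer_sum n D confl C A \<xi> \<epsilon> = \<xi>)"
    have "r C A \<one>\<^bsub>grp G C A\<^esub> \<in> r C A ` Ext C A" by simp
    from bspec[OF conjunct2[OF h] this]
    have "baer_sum n D confl C A \<epsilon> (r C A \<one>\<^bsub>grp G C A\<^esub>) = r C A \<one>\<^bsub>grp G C A\<^esub>" by (rule conjunct1)
    moreover have "baer_sum n D confl C A \<epsilon> (r C A \<one>\<^bsub>grp G C A\<^esub>) = \<epsilon>"
      using unit[OF conjunct1[OF h]] by (rule conjunct2)
    ultimately show "\<epsilon> = r C A \<one>\<^bsub>grp G C A\<^esub>" by simp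
  qed
  then show ?thesis by (simp add: ex_grp_def ex_carrier_conflations[OF C A])
qed

lemma realisation_bij:
  assumes "C \<in> Obj D" "A \<in> Obj D"
  shows "bij_betw (r C A) (Ext C A) (carrier (grp (ex_bifun n D confl) C A))"
  using realisation_inj[OF assms] ex_carrier_conflations[OF assms]
  by (auto simp: bij_betw_def inj_on_def ex_bifun_def ex_grp_def)

lemma realisation_mult:
  assumes "C \<in> Obj D" "A \<in> Obj D" "\<delta> \<in> Ext C A" "\<epsilon> \<in> Ext C A"
  shows "r C A (\<delta> \<otimes>\<^bsub>grp G C A\<^esub> \<epsilon>) = r C A \<delta> \<otimes>\<^bsub>grp (ex_bifun n D confl) C A\<^esub> r C A \<epsilon>"
  using baer_sum_realisation[OF assms] by (simp add: ex_bifun_def ex_grp_def)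

text \<open>
  The realisation itself is the isomorphism of bifunctors, so the structure on the classes of
  conflations is the transported one.
\<close>

theorem conflations_exangulated: "n_exangulated_category n D (ex_bifun n D confl) ex_realisation"
proof (rule transport_structure[where \<Gamma> = r])
  show "r C A \<one>\<^bsub>grp G C A\<^esub> = \<one>\<^bsub>grp (ex_bifun n D confl) C A\<^esub>" if "C \<in> Obj D" "A \<in> Obj D" for C A
    using ex_grp_one[OF that] by (simp add: ex_bifun_def)
qed (use realisation_bij realisation_mult ex_act_realisation in \<open>simp_all add: ex_bifun_def ex_realisation_def\<close>)

lemma identity_is_equivalence: "is_equivalence D D id id"
proof -
  have f: "is_functor D D id id" by (simp add: is_functor_def)
  have "nat_iso D D id id id id (idn D)" unfolding nat_iso_def
  proof (intro conjI ballI allI)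
    fix A assume A: "A \<in> Obj D"
    show "idn D A \<in> Hom D (id A) (id A)" using idn_hom[OF A] by simp
    show "is_iso D (idn D A)" using is_isoI[OF idn_hom[OF A] idn_hom[OF A]] A by (simp add: idn_left' idn_typing)
  next
    fix A B f assume "f \<in> Hom D A B"
    then show "idn D B ** id f = id f ** idn D A" by (simp add: idn_left idn_right)
  qed
  then show ?thesis using f unfolding is_equivalence_def by (metis comp_id)
qed

theorem identity_is_exangulated_equivalence:
  "n_exangulated_equivalence n D G r D (ex_bifun n D confl) ex_realisation id id r"
proof -
  have "n_exangulated_functor n D G r D (ex_bifun n D confl) ex_realisation id id r"
    unfolding n_exangulated_functor_def
  proof (intro conjI ballI allI impI n_exangulated_category_axioms conflations_exangulated)
    show "is_additive_functor D D id id" by (simp add: is_additive_functor_def is_functor_def)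
  next
    fix C A assume o: "C \<in> Obj D" "A \<in> Obj D"
    show "r C A \<in> hom (grp G C A) (grp (ex_bifun n D confl) (id C) (id A))"
      using realisation_bij[OF o] realisation_mult[OF o] by (auto simp: hom_def bij_betw_def)
  next
    fix C C' A A' c a \<delta> assume "c \<in> Hom D C' C" "a \<in> Hom D A A'" "\<delta> \<in> Ext C A"
    then show "r C' A' (act G c a \<delta>) = act (ex_bifun n D confl) (id c) (id a) (r C A \<delta>)"
      using ex_act_realisation by (simp add: ex_bifun_def)
  next
    fix C A \<delta> X assume "X \<in> cpxs_between D n A C" "r C A \<delta> = hclass D n X"
    then show "ex_realisation (id C) (id A) (r C A \<delta>) = hclass D n (map_cpx n id id X)"
      by (simp add: ex_realisation_def map_cpx_id[of _ D] cpxs_between_def)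
  qed
  moreover have "r C A \<in> iso (grp G C A) (grp (ex_bifun n D confl) (id C) (id A))"
    if "C \<in> Obj D" "A \<in> Obj D" for C A
    using realisation_bij[OF that] realisation_mult[OF that] by (auto simp: iso_def hom_def bij_betw_def)
  ultimately show ?thesis
    unfolding n_exangulated_equivalence_def using identity_is_equivalence by blast
qed

end

section \<open>The characterisation\<close>

text \<open>
  The equivalence forces the homotopy class of a conflation \<open>X\<close> to be that of some member \<open>Y\<close> of
  the n-exact structure. The first differential of \<open>Y\<close> is monic and factors through that of \<open>X\<close>,
  by a chain map that is the identity in degree 0; dually at the other end.
\<close>

lemma inflation_monic_deflation_epic_of_equivalence:
  assumes ex: "n_exact_category n D \<X>"
    and eq: "n_exangulated_equivalence n D G r D (ex_bifun n D \<X>) ex_realisation id id \<Gamma>"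
    and X: "conflation n D G r X"
  shows "monic D (df X 0)" "epic D (df X n)"
proof -
  interpret E: n_exact_category n D \<X> by fact
  interpret c: n_exangulated_category n D G r
    using eq by (simp add: n_exangulated_equivalence_def n_exangulated_functor_def)
  obtain \<delta> where d: "distinguished n D G r X \<delta>" using X unfolding conflation_def by blast
  let ?A = "ob X 0" and ?C = "ob X (Suc n)"
  have Xc: "X \<in> cpxs D (Suc n)" and \<delta>: "\<delta> \<in> carrier (grp G ?C ?A)" and rX: "r ?C ?A \<delta> = hclass D n X"
    using d by (simp_all add: distinguished_def)
  have o: "?A \<in> Obj D" "?C \<in> Obj D" using E.cpx_ob[OF Xc] by simp_all
  have h: "\<Gamma> ?C ?A \<in> hom (grp G ?C ?A) (grp (ex_bifun n D \<X>) ?C ?A)"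
    using eq o by (simp add: n_exangulated_equivalence_def n_exangulated_functor_def)
  have "X \<in> cpxs_between D n ?A ?C" using Xc by (simp add: cpxs_between_def)
  then have "ex_realisation ?C ?A (\<Gamma> ?C ?A \<delta>) = hclass D n (map_cpx n id id X)"
    using eq o \<delta> rX unfolding n_exangulated_equivalence_def n_exangulated_functor_def by (metis id_apply)
  moreover have "map_cpx n id id X = X"
    using map_cpx_id[OF Xc] .
  ultimately have "\<Gamma> ?C ?A \<delta> = hclass D n X" by (simp add: ex_realisation_def)
  moreover have "\<Gamma> ?C ?A \<delta> \<in> ex_carrier n D \<X> ?C ?A"
    using h \<delta> by (auto simp: hom_def ex_bifun_def ex_grp_def)
  ultimately obtain Y where Y: "Y \<in> \<X>" "hclass D n X = hclass D n Y" unfolding ex_carrier_def by auto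
  have Ye: "n_exact_seq D n Y" using E.n_exact[OF Y(1)] .
  note Y' = E.n_exact_seqD[OF Ye]
  have "X \<in> hclass D n Y" using E.hclass_self[OF Xc] Y(2) by simp
  then obtain f g where f: "chain_map_between D n X Y f" and g: "chain_map_between D n Y X g"
    unfolding hclass_def by blast
  have f': "chain_map D (Suc n) X Y f" "f 0 = idn D ?A" and g': "chain_map D (Suc n) Y X g" "g (Suc n) = idn D (ob Y (Suc n))"
    using f g by (simp_all add: chain_map_between_def)
  have ends: "ob Y 0 = ?A" using E.chain_map_typing(3)[OF f'(1), of 0] f'(2) o by (simp add: E.idn_typing)
  have ends2: "ob X (Suc n) = ob Y (Suc n)"
    using E.chain_map_typing(3)[OF g'(1), of "Suc n"] g'(2) E.cpx_ob[OF Y'(1), of "Suc n"] by (simp add: E.idn_typing)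
  have dX: "df X 0 \<in> Hom D ?A (ob X (Suc 0))" "df X n \<in> Hom D (ob X n) ?C" using E.cpx_df[OF Xc] by simp_all
  have dY: "df Y 0 \<in> Hom D ?A (ob Y (Suc 0))" "df Y n \<in> Hom D (ob Y n) ?C"
    using E.cpx_df[OF Y'(1), of 0] E.cpx_df[OF Y'(1), of n] ends ends2 by simp_all
  have f1: "f (Suc 0) \<in> Hom D (ob X (Suc 0)) (ob Y (Suc 0))" and gn: "g n \<in> Hom D (ob Y n) (ob X n)"
    using E.chain_map_hom[OF f'(1)] E.chain_map_hom[OF g'(1)] by simp_all
  have df0: "f (Suc 0) \<cdot>\<^bsub>D\<^esub> df X 0 = df Y 0"
    using E.chain_map_comm[OF f'(1), of 0] f'(2) dY(1) by (simp add: E.in_Hom E.idn_right')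
  have dfn: "df X n \<cdot>\<^bsub>D\<^esub> g n = df Y n"
    using E.chain_map_comm[OF g'(1), of n] g'(2) dY(2) ends2 by (simp add: E.in_Hom E.idn_left')
  show "monic D (df X 0)" unfolding monic_def
  proof (intro conjI ballI impI)
    show "df X 0 \<in> Arr D" using dX by (simp add: E.in_Hom)
    fix Z u v assume "u \<in> Hom D Z (Dom D (df X 0))" "v \<in> Hom D Z (Dom D (df X 0))" and eq: "df X 0 \<cdot>\<^bsub>D\<^esub> u = df X 0 \<cdot>\<^bsub>D\<^esub> v"
    then have u: "u \<in> Hom D Z ?A" and v: "v \<in> Hom D Z ?A" using dX by (simp_all add: E.in_Hom)
    have "df Y 0 \<cdot>\<^bsub>D\<^esub> u = df Y 0 \<cdot>\<^bsub>D\<^esub> v"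
      unfolding df0[symmetric] E.comp_assoc[OF u dX(1) f1] E.comp_assoc[OF v dX(1) f1] eq ..
    then show "u = v" using E.monicD[OF Y'(3) dY(1) u v] by blast
  qed
  show "epic D (df X n)" unfolding epic_def
  proof (intro conjI ballI impI)
    show "df X n \<in> Arr D" using dX by (simp add: E.in_Hom)
    fix Z u v assume "u \<in> Hom D (Cod D (df X n)) Z" "v \<in> Hom D (Cod D (df X n)) Z" and eq: "u \<cdot>\<^bsub>D\<^esub> df X n = v \<cdot>\<^bsub>D\<^esub> df X n"
    then have u: "u \<in> Hom D ?C Z" and v: "v \<in> Hom D ?C Z" using dX by (simp_all add: E.in_Hom)
    have "u \<cdot>\<^bsub>D\<^esub> df Y n = v \<cdot>\<^bsub>D\<^esub> df Y n"
      unfolding dfn[symmetric] E.comp_assoc[OF gn dX(2) u, symmetric] E.comp_assoc[OF gn dX(2) v, symmetric] eq ..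
    then show "u = v" using E.epicD[OF Y'(5) dY(2) u v] by blast
  qed
qed

theorem corollary4p12:
  fixes n :: nat
    and \<C> :: "('o, 'm) addcat"
    and \<E> :: "('o, 'm, 'e) bifun"
    and \<s> :: "('o, 'm, 'e) realisation"
  assumes "n \<ge> 1"
    and "n_exangulated_category n \<C> \<E> \<s>"
  shows "(\<exists>\<X> \<Gamma>. n_exact_category n \<C> \<X> \<and>
            n_exangulated_equivalence n \<C> \<E> \<s> \<C> (ex_bifun n \<C> \<X>) ex_realisation id id \<Gamma>)
         \<longleftrightarrow>
         ((\<forall>f. inflation n \<C> \<E> \<s> f \<longrightarrow> monic \<C> f) \<and>
          (\<forall>f. deflation n \<C> \<E> \<s> f \<longrightarrow> epic \<C> f))"
proof
  assume "\<exists>\<X> \<Gamma>. n_exact_category n \<C> \<X> \<and>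
            n_exangulated_equivalence n \<C> \<E> \<s> \<C> (ex_bifun n \<C> \<X>) ex_realisation id id \<Gamma>"
  then show "(\<forall>f. inflation n \<C> \<E> \<s> f \<longrightarrow> monic \<C> f) \<and> (\<forall>f. deflation n \<C> \<E> \<s> f \<longrightarrow> epic \<C> f)"
    using inflation_monic_deflation_epic_of_equivalence unfolding inflation_def deflation_def by blast
next
  assume h: "(\<forall>f. inflation n \<C> \<E> \<s> f \<longrightarrow> monic \<C> f) \<and> (\<forall>f. deflation n \<C> \<E> \<s> f \<longrightarrow> epic \<C> f)"
  interpret c: n_exangulated_category n \<C> \<E> \<s> by fact
  interpret monic_epic_exangulated n \<C> \<E> \<s>
    by unfold_locales (use assms(1) h in auto)
  show "\<exists>\<X> \<Gamma>. n_exact_category n \<C> \<X> \<and>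
            n_exangulated_equivalence n \<C> \<E> \<s> \<C> (ex_bifun n \<C> \<X>) ex_realisation id id \<Gamma>"
    using n_exact_category_conflations identity_is_exangulated_equivalence by blast
qed

end
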